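(* Let $0<\beta<1$ and let $M$ be the maximum of a standard skew Brownian bridge with parameter $\beta$. Then $M$ has a density given, for $z>0$, by $$\frac{\mathbb{P}(M\in dz)}{dz}=8\beta z\sum_{k\geq1}(1-2\beta)^{k-1}k^2e^{-2k^2 z^2}.$$
   Context: For $0<\beta<1$, the skew Brownian motion with parameter $\beta$ is the one-dimensional diffusion $X$ started at $0$ obtained from a reflected Brownian motion by independently giving each excursion away from $0$ a positive sign with probability $\beta$ and a negative sign with probability $1-\beta$, so that $\mathbb{P}(X_1>0)=\beta$. Equivalently, with $\sigma(x)=1/\beta$ for $x\ge0$ and $\sigma(x)=1/(1-\beta)$ for $x<0$, it has scale function $s(x)=\sigma(x)x$ and speed measure $m(dx)=\frac{2}{\sigma(x)}dx$. The standard skew Brownian bridge is $X$ conditioned on $X_1=0$, considered on $[0,1]$. For it, $M=\sup_{0\le u\le1}X_u$. The convention $0^0=1$ is used when $\beta=1/2$. *)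

theory Defs
  imports "HOL-Probability.Probability"
begin

definition standard_brownian_motion :: "'a measure \<Rightarrow> (real \<Rightarrow> 'a \<Rightarrow> real) \<Rightarrow> bool" where
  "standard_brownian_motion M B \<longleftrightarrow>
     prob_space M \<and>
     (\<forall>t\<ge>0. B t \<in> borel_measurable M) \<and>
     (\<forall>\<omega>\<in>space M. B 0 \<omega> = 0 \<and> continuous_on {0..} (\<lambda>t. B t \<omega>)) \<and>
     (\<forall>s t. 0 \<le> s \<and> s < t \<longrightarrow>
        distributed M lborel (\<lambda>\<omega>. B t \<omega> - B s \<omega>) (normal_density 0 (sqrt (t - s)))) \<and>
     (\<forall>(n::nat) (t::nat \<Rightarrow> real). 0 \<le> t 0 \<and> strict_mono_on {..n} t \<longrightarrow>
        prob_space.indep_vars M (\<lambda>_. borel) (\<lambda>i \<omega>. B (t (Suc i)) \<omega> - B (t i) \<omega>) {..<n})"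

definition reflected_brownian_motion :: "'a measure \<Rightarrow> (real \<Rightarrow> 'a \<Rightarrow> real) \<Rightarrow> bool" where
  "reflected_brownian_motion M R \<longleftrightarrow>
     (\<exists>B. standard_brownian_motion M B \<and> (\<forall>t\<ge>0. \<forall>\<omega>\<in>space M. R t \<omega> = \<bar>B t \<omega>\<bar>))"

text \<open>The excursion interval of the path \<^term>\<open>r\<close> straddling the time \<^term>\<open>t\<close>; it is empty
  if \<^prop>\<open>r t = 0\<close>.\<close>

definition excursion_interval :: "(real \<Rightarrow> real) \<Rightarrow> real \<Rightarrow> real set" where
  "excursion_interval r t = connected_component_set {u. 0 \<le> u \<and> r u \<noteq> 0} t"

text \<open>A measurable numbering of the excursions: along the enumeration \<^term>\<open>from_nat\<close> of the
  rationals, an excursion is labelled by the first rational lying in its interval. For a continuous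
  path started at 0 the excursion intervals are open and disjoint, so that all times in one excursion
  get the same label, and different excursions get different labels.\<close>

definition excursion_index :: "(real \<Rightarrow> real) \<Rightarrow> real \<Rightarrow> nat" where
  "excursion_index r t =
     (LEAST n. real_of_rat (from_nat n) \<in> excursion_interval r t)"

text \<open>\<^term>\<open>S n \<omega>\<close> says that the excursion labelled \<^term>\<open>n\<close> is positive. Labels not used by
  the path carry a sign too, which has no effect.\<close>

definition skew_brownian_motion ::
  "real \<Rightarrow> 'a measure \<Rightarrow> (real \<Rightarrow> 'a \<Rightarrow> real) \<Rightarrow> bool" where
  "skew_brownian_motion \<beta> M X \<longleftrightarrow>
     (\<exists>(R :: real \<Rightarrow> 'a \<Rightarrow> real) (S :: nat \<Rightarrow> 'a \<Rightarrow> bool).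
        reflected_brownian_motion M R \<and>
        prob_space.indep_vars M (\<lambda>_. count_space UNIV) S UNIV \<and>
        (\<forall>n. distr M (count_space UNIV) (S n) = measure_pmf (bernoulli_pmf \<beta>)) \<and>
        prob_space.indep_set M
          (sets (vimage_algebra (space M) (\<lambda>\<omega>. \<lambda>t\<in>{0..}. R t \<omega>) (\<Pi>\<^sub>M t\<in>{0..}. borel)))
          (sets (vimage_algebra (space M) (\<lambda>\<omega> n. S n \<omega>) (\<Pi>\<^sub>M n\<in>UNIV. count_space UNIV))) \<and>
        (\<forall>t\<ge>0. \<forall>\<omega>\<in>space M.
           X t \<omega> = (if S (excursion_index (\<lambda>u. R u \<omega>) t) \<omega> then R t \<omega> else - R t \<omega>)))"

text \<open>The space of continuous functions on the unit interval with the supremum metric is embedded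
  isometrically into the bounded continuous functions on the line, extending by constants. The
  embedding has a continuous left inverse (restrict, then extend), so continuous functionals on
  either space give the same notion of weak convergence.\<close>

definition unit_path :: "(real \<Rightarrow> 'a \<Rightarrow> real) \<Rightarrow> 'a \<Rightarrow> (real \<Rightarrow>\<^sub>C real)" where
  "unit_path X \<omega> = Bcontfun (ext_cont (\<lambda>t. X t \<omega>) 0 1)"

text \<open>The process \<^term>\<open>X\<close>, conditioned on the null event that it vanishes at time 1 and considered
  on the unit interval: the law of \<^term>\<open>Y\<close> is the weak limit of the conditional laws of \<^term>\<open>X\<close>
  given \<^prop>\<open>\<bar>X 1 \<omega>\<bar> < \<epsilon>\<close>, as \<^term>\<open>\<epsilon>\<close> decreases to 0.\<close>

definition conditioned_to_vanish_at_1 ::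
  "'a measure \<Rightarrow> (real \<Rightarrow> 'a \<Rightarrow> real) \<Rightarrow> 'b measure \<Rightarrow> (real \<Rightarrow> 'b \<Rightarrow> real) \<Rightarrow> bool" where
  "conditioned_to_vanish_at_1 M X N Y \<longleftrightarrow>
     prob_space N \<and>
     (\<forall>t\<in>{0..1}. Y t \<in> borel_measurable N) \<and>
     (\<forall>\<omega>\<in>space N. continuous_on {0..1} (\<lambda>t. Y t \<omega>)) \<and>
     (\<forall>F :: (real \<Rightarrow>\<^sub>C real) \<Rightarrow> real.
        continuous_on UNIV F \<and> bounded (range F) \<longrightarrow>
        ((\<lambda>\<epsilon>. \<integral>\<omega>. F (unit_path X \<omega>) \<partial>uniform_measure M {\<omega> \<in> space M. \<bar>X 1 \<omega>\<bar> < \<epsilon>})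
           \<longlongrightarrow> (\<integral>\<omega>. F (unit_path Y \<omega>) \<partial>N)) (at_right 0))"

definition skew_brownian_bridge ::
  "real \<Rightarrow> 'a measure \<Rightarrow> (real \<Rightarrow> 'a \<Rightarrow> real) \<Rightarrow> 'b measure \<Rightarrow> (real \<Rightarrow> 'b \<Rightarrow> real) \<Rightarrow> bool" where
  "skew_brownian_bridge \<beta> M X N Y \<longleftrightarrow>
     skew_brownian_motion \<beta> M X \<and> conditioned_to_vanish_at_1 M X N Y"

end

theory Submission
  imports Defs
begin

text \<open>Conditionally on the reflected path, the maximum of the skew Brownian motion stays below \<open>z\<close>
  with probability \<open>(1 - \<beta>) ^ n\<close>, where \<open>n\<close> is the number of excursions that reach \<open>z\<close>. On a
  dyadic grid this weight is a function of a symmetric random walk, whose runs of constant sign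
  play the role of the excursions.

  Let \<open>a j\<close> be the probability that the skew walk hits \<open>z\<close> and afterwards, continued as a free
  walk, is displaced by \<open>j * z\<close>. Reflecting at the first hit of \<open>z\<close>, the probability of a
  maximum above \<open>z\<close> and an end point near 0 is \<open>a 1\<close>. A path that ends near \<open>2 * m * z\<close> has
  hit \<open>z\<close>, and reflecting at the first return to 0 afterwards yields
  \<open>2 * \<beta> * P(B 1 near 2 * m * z) = a (2 * m - 1) - (1 - 2 * \<beta>) * a (2 * m + 1)\<close>.
  Up to overshoots, which vanish with the mesh, \<open>a 1\<close> is therefore the sum of
  \<open>2 * \<beta> * (1 - 2 * \<beta>) ^ (m - 1) * P(B 1 near 2 * m * z)\<close> over \<open>m \<ge> 1\<close>. Dividing by
  \<open>P(B 1 near 0)\<close> and shrinking the window gives the tail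
  \<open>2 * \<beta> * (\<Sum>m\<ge>1. (1 - 2 * \<beta>) ^ (m - 1) * exp (- 2 * m\<^sup>2 * z\<^sup>2))\<close> of the maximum.\<close>

section \<open>Runs of constant sign\<close>

text \<open>The re-signed walk is never constructed: its hitting probabilities enter only as the
  weights \<open>hit\<close> and \<open>survive\<close> attached to a symmetric walk. The weight at
  index \<open>i\<close> depends on the path up to \<open>i\<close> alone, so a hitting or return
  time can be split into the events that it equals a fixed index, and invariance of the law under
  reflection at fixed indices takes the place of the strong Markov property. On a grid the levels
  \<open>z\<close> and 0 are not met exactly. Lipschitz test functions tolerate this with an error
  governed by the largest step, and as the hitting weights sum to at most 1, the error does not grow
  with the number of grid points. The indicator of the end window is recovered once the mesh has
  vanished. The other obstacle is that runs on a grid need not be excursions, since a zero between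
  grid points may leave no visible change of sign. Almost surely the path takes both signs in every
  dyadic interval that contains a zero and stays away from time 0, and for indices at height
  \<open>z\<close> this makes runs and excursions agree on all fine grids.\<close>

definition same_side :: "(nat \<Rightarrow> real) \<Rightarrow> nat \<Rightarrow> nat \<Rightarrow> bool" where
  "same_side w i j \<longleftrightarrow> (\<forall>l\<in>{i..j}. 0 < w l) \<or> (\<forall>l\<in>{i..j}. w l \<le> 0)"

text \<open>Each run of height at least \<open>z\<close> has exactly one fresh index, its first high
  one, so a product over fresh indices has one factor for each high run.\<close>

definition fresh :: "real \<Rightarrow> (nat \<Rightarrow> real) \<Rightarrow> nat \<Rightarrow> bool" where
  "fresh z w i \<longleftrightarrow> z \<le> \<bar>w i\<bar> \<and> (\<forall>j<i. z \<le> \<bar>w j\<bar> \<longrightarrow> \<not> same_side w j i)"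

text \<open>Give every run of constant sign that reaches height \<^term>\<open>z\<close> a fresh independent sign,
  positive with probability \<^term>\<open>\<beta>\<close>. Then \<^term>\<open>survive \<beta> z w n\<close> is the conditional probability
  that the re-signed path stays below \<^term>\<open>z\<close> before step \<^term>\<open>n\<close>, and \<^term>\<open>hit \<beta> z w i\<close> is the
  conditional probability that it reaches \<^term>\<open>z\<close> for the first time at step \<^term>\<open>i\<close>.\<close>

definition survive :: "real \<Rightarrow> real \<Rightarrow> (nat \<Rightarrow> real) \<Rightarrow> nat \<Rightarrow> real" where
  "survive \<beta> z w n = (\<Prod>i<n. if fresh z w i then 1 - \<beta> else 1)"

definition hit :: "real \<Rightarrow> real \<Rightarrow> (nat \<Rightarrow> real) \<Rightarrow> nat \<Rightarrow> real" where
  "hit \<beta> z w i = (if fresh z w i then \<beta> * survive \<beta> z w i else 0)"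

text \<open>The value 0 counts as negative, as in \<open>same_side\<close>, so that every index
  belongs to exactly one run and the side is constant along it.\<close>

definition side :: "(nat \<Rightarrow> real) \<Rightarrow> nat \<Rightarrow> real" where
  "side w i = (if w i > 0 then 1 else -1)"

text \<open>For \<open>i < k\<close> this says that \<open>k\<close> is the first index at which the
  run of \<open>i\<close> is over, a fact decided by the path up to \<open>k\<close>.\<close>

definition turn :: "(nat \<Rightarrow> real) \<Rightarrow> nat \<Rightarrow> nat \<Rightarrow> bool" where
  "turn w i k \<longleftrightarrow> same_side w i (k - 1) \<and> \<not> same_side w i k"

definition max_step :: "(nat \<Rightarrow> real) \<Rightarrow> nat \<Rightarrow> real" where
  "max_step w K = Max ((\<lambda>j. \<bar>w (Suc j) - w j\<bar>) ` {..<K})"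

text \<open>Negates the increments after index \<open>k\<close>, which is a fixed index and not a
  hitting time.\<close>

definition reflect_from :: "nat \<Rightarrow> (nat \<Rightarrow> real) \<Rightarrow> nat \<Rightarrow> real" where
  "reflect_from k w j = (if j \<le> k then w j else 2 * w k - w j)"

lemma survive_0 [simp]: "survive \<beta> z w 0 = 1"
  by (simp add: survive_def)

lemma survive_Suc: "survive \<beta> z w (Suc n) = survive \<beta> z w n - hit \<beta> z w n"
  by (simp add: survive_def hit_def algebra_simps)

lemma sum_hit: "(\<Sum>i<n. hit \<beta> z w i) = 1 - survive \<beta> z w n"
  by (induction n) (simp_all add: survive_Suc)

lemma survive_bounds:
  assumes "0 \<le> \<beta>" "\<beta> \<le> 1"
  shows "0 \<le> survive \<beta> z w n" "survive \<beta> z w n \<le> 1"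
  unfolding survive_def using assms by (auto intro!: prod_nonneg prod_le_1)

lemma hit_bounds:
  assumes "0 \<le> \<beta>" "\<beta> \<le> 1"
  shows "0 \<le> hit \<beta> z w i" "hit \<beta> z w i \<le> 1"
  using survive_bounds[OF assms, of z w i] assms
  by (auto simp: hit_def mult_le_one)

lemma same_side_refl [simp]: "same_side w i i"
  by (auto simp: same_side_def)

lemma same_side_trans:
  assumes "same_side w i j" "same_side w j k" "i \<le> j" "j \<le> k"
  shows "same_side w i k"
proof -
  have "{i..k} = {i..j} \<union> {j..k}" "j \<in> {i..j}" "j \<in> {j..k}" using assms by auto
  then show ?thesis using assms(1,2) unfolding same_side_def by (metis Un_iff not_le)
qed

lemma same_side_subinterval:
  "same_side w i k \<Longrightarrow> i \<le> j \<Longrightarrow> j \<le> l \<Longrightarrow> l \<le> k \<Longrightarrow> same_side w j l"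
  unfolding same_side_def by (meson atLeastAtMost_iff order_trans)

text \<open>Both sides are the conditional probability that the re-signed path is positive at \<^term>\<open>K\<close>:
  it must have hit \<^term>\<open>z\<close> before, and its sign is then inherited, or drawn anew after a sign change.\<close>

lemma hit_last_run:
  assumes "z \<le> \<bar>w K\<bar>"
  shows "(\<Sum>i\<le>K. hit \<beta> z w i * (if same_side w i K then 1 else \<beta>)) = \<beta>"
proof -
  define P where "P i \<longleftrightarrow> z \<le> \<bar>w i\<bar> \<and> same_side w i K" for i
  \<comment> \<open>The run containing \<open>K\<close> reaches height \<open>z\<close> first at
    \<open>m\<close>, so \<open>m\<close> is its only fresh index up to \<open>K\<close>.\<close>
  define m where "m = (LEAST i. P i)"
  have "P K" using assms by (simp add: P_def)
  then have Pm: "P m" and mK: "m \<le> K"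
    unfolding m_def by (rule LeastI, rule Least_le)
  have less: "\<not> P i" if "i < m" for i
    using that not_less_Least unfolding m_def by blast
  have fm: "fresh z w m"
    unfolding fresh_def
  proof (intro conjI allI impI notI)
    show "z \<le> \<bar>w m\<bar>" using Pm by (simp add: P_def)
    fix j assume j: "j < m" "z \<le> \<bar>w j\<bar>" "same_side w j m"
    then have "same_side w j K" using Pm mK unfolding P_def by (metis less_imp_le same_side_trans)
    with j less show False by (simp add: P_def)
  qed
  have later: "\<not> fresh z w i" if "m < i" "i \<le> K" for i
    using that Pm same_side_subinterval[of w m K m i] unfolding fresh_def P_def by auto
  have early: "\<not> same_side w i K" if "i < m" "fresh z w i" for i
    using that less unfolding P_def fresh_def by auto
  \<comment> \<open>The terms before \<open>m\<close> belong to other runs and add up to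
    \<open>\<beta> * (1 - survive \<beta> z w m)\<close>; the term at \<open>m\<close> is
    \<open>\<beta> * survive \<beta> z w m\<close>.\<close>
  have "(\<Sum>i\<le>K. hit \<beta> z w i * (if same_side w i K then 1 else \<beta>))
      = (\<Sum>i\<le>m. hit \<beta> z w i * (if same_side w i K then 1 else \<beta>))"
    by (rule sum.mono_neutral_right) (use mK later in \<open>auto simp: hit_def\<close>)
  also have "\<dots> = (\<Sum>i<m. hit \<beta> z w i * (if same_side w i K then 1 else \<beta>)) + hit \<beta> z w m"
    using Pm by (simp add: P_def flip: lessThan_Suc_atMost)
  also have "(\<Sum>i<m. hit \<beta> z w i * (if same_side w i K then 1 else \<beta>)) = (\<Sum>i<m. hit \<beta> z w i * \<beta>)"
    by (rule sum.cong) (use early in \<open>auto simp: hit_def\<close>)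
  also have "\<dots> = (1 - survive \<beta> z w m) * \<beta>"
    by (simp flip: sum_hit sum_distrib_right)
  finally show ?thesis using fm by (simp add: hit_def algebra_simps)
qed

section \<open>Overshoot at hits and size at sign changes\<close>

lemma step_le_max_step: "j < K \<Longrightarrow> \<bar>w (Suc j) - w j\<bar> \<le> max_step w K"
  unfolding max_step_def by (rule Max_ge) auto

lemma max_step_nonneg: "0 < K \<Longrightarrow> 0 \<le> max_step w K"
  using step_le_max_step[of 0 K w] by linarith

lemma side_times: "side w i * w i = \<bar>w i\<bar>"
  by (simp add: side_def)

text \<open>If the walk was below height \<open>z\<close> one step earlier, it overshoots by at most
  that step. If it was already high, freshness forces a change of sign, and the step is then at
  least as long as \<open>\<bar>w i\<bar>\<close>. The start at 0 guarantees an earlier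
  index.\<close>

lemma fresh_overshoot:
  assumes "fresh z w i" "i \<le> K" "w 0 = 0" "0 < z"
  shows "\<bar>side w i * w i - z\<bar> \<le> max_step w K"
proof -
  have zi: "z \<le> \<bar>w i\<bar>" using assms by (simp add: fresh_def)
  with assms obtain j where j: "i = Suc j" by (cases i) auto
  have st: "\<bar>w i - w j\<bar> \<le> max_step w K" using step_le_max_step[of j K w] assms j by simp
  show ?thesis
  proof (cases "z \<le> \<bar>w j\<bar>")
    case True
    then have "\<not> same_side w j i" using assms j by (auto simp: fresh_def)
    then have "(w i > 0) \<noteq> (w j > 0)"
      using j by (auto simp: same_side_def le_Suc_eq)
    then show ?thesis using st zi \<open>0 < z\<close> by (auto simp: side_times)
  next
    case False
    then show ?thesis using st zi by (auto simp: side_times)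
  qed
qed

lemma turn_small:
  assumes "turn w i k" "i < k" "k \<le> K"
  shows "\<bar>w k\<bar> \<le> max_step w K"
proof -
  obtain j where j: "k = Suc j" using assms by (cases k) auto
  have same: "same_side w i j" and "\<not> same_side w i k"
    using assms j by (simp_all add: turn_def)
  then have "(w k > 0) \<noteq> (w j > 0)"
    using assms j unfolding same_side_def
    by (metis atLeastAtMost_iff le_SucE less_Suc_eq_le not_le order_refl)
  then show ?thesis using step_le_max_step[of j K w] assms j by (auto split: if_splits)
qed

text \<open>The first sign change after \<open>i\<close> occurs at exactly one index. This splits a
  random time into fixed ones, at which reflection is available.\<close>

lemma not_same_side_sum:
  assumes "i \<le> K"
  shows "of_bool (\<not> same_side w i K) = (\<Sum>k\<in>{i<..K}. of_bool (turn w i k) :: real)"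
  using assms
proof (induction K rule: dec_induct)
  case base
  show ?case by simp
next
  case (step n)
  have "{i<..Suc n} = insert (Suc n) {i<..n}" using step by auto
  moreover have "same_side w i (Suc n) \<Longrightarrow> same_side w i n"
    using step by (auto simp: same_side_def)
  ultimately show ?case using step.IH
    by (simp del: sum_of_bool_eq flip: step.IH) (auto simp: turn_def)
qed

section \<open>The past is unaffected by reflection at a fixed index\<close>

lemma same_side_reflect_from: "j \<le> k \<Longrightarrow> i \<le> j \<Longrightarrow> same_side (reflect_from k w) i j = same_side w i j"
  by (auto simp: same_side_def reflect_from_def)

lemma fresh_reflect_from: "i \<le> k \<Longrightarrow> fresh z (reflect_from k w) i = fresh z w i"
  by (auto simp: fresh_def same_side_reflect_from) (auto simp: reflect_from_def)

lemma hit_reflect_from: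
  assumes "i \<le> k"
  shows "hit \<beta> z (reflect_from k w) i = hit \<beta> z w i"
proof -
  have "survive \<beta> z (reflect_from k w) i = survive \<beta> z w i"
    unfolding survive_def by (rule prod.cong) (use assms in \<open>auto simp: fresh_reflect_from\<close>)
  then show ?thesis using assms by (simp add: hit_def fresh_reflect_from)
qed

lemma turn_reflect_from: "i < k \<Longrightarrow> turn (reflect_from k w) i k = turn w i k"
  by (simp add: turn_def same_side_reflect_from)

section \<open>Measurability on path space\<close>

lemma measurable_path_coordinate [measurable]:
  "(\<lambda>w. w i) \<in> borel_measurable (PiM UNIV (\<lambda>_::nat. borel :: real measure))"
  by (rule measurable_component_singleton) simp

lemma measurable_same_side [measurable]:
  "Measurable.pred (PiM UNIV (\<lambda>_. borel)) (\<lambda>w. same_side w i j)"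
  unfolding same_side_def by measurable

lemma measurable_fresh [measurable]: "Measurable.pred (PiM UNIV (\<lambda>_. borel)) (\<lambda>w. fresh z w i)"
  unfolding fresh_def by measurable

lemma measurable_turn [measurable]: "Measurable.pred (PiM UNIV (\<lambda>_. borel)) (\<lambda>w. turn w i k)"
  unfolding turn_def by measurable

lemma measurable_survive [measurable]:
  "(\<lambda>w. survive \<beta> z w i) \<in> borel_measurable (PiM UNIV (\<lambda>_. borel))"
  unfolding survive_def by measurable

lemma measurable_hit [measurable]: "(\<lambda>w. hit \<beta> z w i) \<in> borel_measurable (PiM UNIV (\<lambda>_. borel))"
  unfolding hit_def by measurable

lemma measurable_side [measurable]: "(\<lambda>w. side w i) \<in> borel_measurable (PiM UNIV (\<lambda>_. borel))"
  unfolding side_def by measurable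

lemma measurable_max_step [measurable]:
  "(\<lambda>w. max_step w K) \<in> borel_measurable (PiM UNIV (\<lambda>_. borel))"
  unfolding max_step_def by measurable

lemma measurable_reflect_from [measurable]:
  "reflect_from k \<in> measurable (PiM UNIV (\<lambda>_. borel)) (PiM UNIV (\<lambda>_. borel))"
proof -
  have "(\<lambda>w j. reflect_from k w j) \<in> measurable (PiM UNIV (\<lambda>_. borel)) (PiM UNIV (\<lambda>_. borel))"
    unfolding reflect_from_def by (rule measurable_PiM_single') auto
  then show ?thesis by simp
qed

section \<open>Reflection of random walks\<close>

lemma Lipschitz_unit_interval:
  fixes f :: "real \<Rightarrow> real"
  assumes "\<And>x. 0 \<le> f x" "\<And>x. f x \<le> 1" "\<And>x y. \<bar>f x - f y\<bar> \<le> L * \<bar>x - y\<bar>"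
    and "\<bar>x - y\<bar> \<le> d" "0 \<le> L"
  shows "\<bar>f x - f y\<bar> \<le> min 1 (L * d)"
proof -
  have "\<bar>f x - f y\<bar> \<le> L * d" using assms(3)[of x y] assms(4,5) by (meson mult_left_mono order_trans)
  moreover have "\<bar>f x - f y\<bar> \<le> 1" using assms(1,2)[of x] assms(1,2)[of y] by linarith
  ultimately show ?thesis by simp
qed

lemma (in prob_space) integrable_abs_le_1:
  fixes H :: "'a \<Rightarrow> real"
  assumes "H \<in> borel_measurable M" "\<And>\<omega>. \<bar>H \<omega>\<bar> \<le> 1"
  shows "integrable M H"
  by (rule integrable_const_bound[where B = 1]) (use assms in auto)

lemma (in prob_space) abs_expectation_le_1:
  fixes H :: "'a \<Rightarrow> real"
  assumes "H \<in> borel_measurable M" "\<And>\<omega>. \<bar>H \<omega>\<bar> \<le> 1"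
  shows "\<bar>expectation H\<bar> \<le> 1"
proof -
  have "\<bar>expectation H\<bar> \<le> (\<integral>\<omega>. \<bar>H \<omega>\<bar> \<partial>M)" by (rule integral_abs_bound)
  also have "\<dots> \<le> (\<integral>\<omega>. 1 \<partial>M)"
    by (rule integral_mono) (auto simp: assms(2) intro!: integrable_abs integrable_abs_le_1 assms)
  finally show ?thesis by (simp add: prob_space)
qed

text \<open>Abstracts the law of the grid walk. Reflection at a fixed index is enough, because hits
  and sign changes are decided by the past.\<close>

locale reflection_invariant_walk = prob_space \<mu> for \<mu> :: "(nat \<Rightarrow> real) measure" +
  assumes sets_eq [measurable_cong]: "sets \<mu> = sets (PiM UNIV (\<lambda>_. borel))"
    and distr_reflect_from: "distr \<mu> (PiM UNIV (\<lambda>_. borel)) (reflect_from k) = \<mu>"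
    and starts_at_0: "AE w in \<mu>. w 0 = 0"
begin

lemma integral_reflect_from:
  fixes H :: "(nat \<Rightarrow> real) \<Rightarrow> real"
  assumes [measurable]: "H \<in> borel_measurable (PiM UNIV (\<lambda>_. borel))"
  shows "(\<integral>w. H w \<partial>\<mu>) = (\<integral>w. H (reflect_from k w) \<partial>\<mu>)"
proof -
  have "(\<integral>w. H w \<partial>\<mu>) = (\<integral>w. H w \<partial>distr \<mu> (PiM UNIV (\<lambda>_. borel)) (reflect_from k))"
    by (simp add: distr_reflect_from)
  also have "\<dots> = (\<integral>w. H (reflect_from k w) \<partial>\<mu>)"
    by (rule integral_distr) measurable
  finally show ?thesis .
qed

end

text \<open>\<open>f\<close> is a smoothed indicator of the end window. The Lipschitz bound absorbs
  overshoots, evenness makes \<open>f\<close> blind to the sign given to the last run, and the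
  support condition makes the translates by \<open>2 * real m * z\<close> with \<open>0 < m\<close>
  vanish up to height \<open>z\<close>.\<close>

locale reflected_test_function = reflection_invariant_walk +
  fixes \<beta> z L :: real and K :: nat and f :: "real \<Rightarrow> real"
  assumes \<beta>: "0 < \<beta>" "\<beta> < 1" and z: "0 < z" and L: "0 \<le> L" and K: "0 < K"
    and f_nonneg: "\<And>x. 0 \<le> f x" and f_le_1: "\<And>x. f x \<le> 1"
    and f_Lipschitz: "\<And>x y. \<bar>f x - f y\<bar> \<le> L * \<bar>x - y\<bar>"
    and f_even: "\<And>x. f (- x) = f x"
    and f_supp: "\<And>x. z \<le> \<bar>x\<bar> \<Longrightarrow> f x = 0"
begin

lemma measurable_f [measurable]: "f \<in> borel_measurable borel"
proof -
  have "L-lipschitz_on UNIV f"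
    by (rule lipschitz_onI) (use f_Lipschitz L in \<open>auto simp: dist_real_def\<close>)
  then show ?thesis
    by (intro borel_measurable_continuous_onI lipschitz_on_continuous_on)
qed

text \<open>The factor 2 stems from reflection at a sign change, which moves the end point by twice
  the value there. The cap at 1 provides the domination needed when the mesh shrinks.\<close>

definition err :: "(nat \<Rightarrow> real) \<Rightarrow> real" where
  "err w = min 1 (L * (2 * max_step w K))"

abbreviation h :: "(nat \<Rightarrow> real) \<Rightarrow> nat \<Rightarrow> real" where "h w i \<equiv> hit \<beta> z w i"

abbreviation disp :: "(nat \<Rightarrow> real) \<Rightarrow> nat \<Rightarrow> real" where
  "disp w i \<equiv> side w i * (w K - w i)"

lemma measurable_err [measurable]: "err \<in> borel_measurable (PiM UNIV (\<lambda>_. borel))"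
  unfolding err_def by measurable

lemma err_bounds: "0 \<le> err w" "err w \<le> 1"
  using max_step_nonneg[OF K, of w] L by (auto simp: err_def)

lemma abs_f_le_1: "\<bar>f x\<bar> \<le> 1"
  using f_nonneg[of x] f_le_1[of x] by simp

lemma h_bounds: "0 \<le> h w i" "h w i \<le> 1"
  using hit_bounds[of \<beta> z w i] \<beta> by auto

lemma f_close: "\<bar>x - y\<bar> \<le> 2 * max_step w K \<Longrightarrow> \<bar>f x - f y\<bar> \<le> err w"
  unfolding err_def by (rule Lipschitz_unit_interval) (use f_nonneg f_le_1 f_Lipschitz L in auto)

lemma integrable_h_times:
  fixes H :: "(nat \<Rightarrow> real) \<Rightarrow> real"
  assumes [measurable]: "H \<in> borel_measurable (PiM UNIV (\<lambda>_. borel))" and "\<And>w. \<bar>H w\<bar> \<le> 1"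
  shows "integrable \<mu> (\<lambda>w. h w i * H w)"
proof (rule integrable_abs_le_1)
  show "\<bar>h w i * H w\<bar> \<le> 1" for w
    using h_bounds[of w i] assms(2)[of w] by (simp add: abs_mult mult_le_one)
qed measurable

lemma integral_diff_le:
  fixes F G H :: "(nat \<Rightarrow> real) \<Rightarrow> real"
  assumes "integrable \<mu> F" "integrable \<mu> G" "integrable \<mu> H"
    and "AE w in \<mu>. \<bar>F w - G w\<bar> \<le> H w"
  shows "\<bar>(\<integral>w. F w \<partial>\<mu>) - (\<integral>w. G w \<partial>\<mu>)\<bar> \<le> (\<integral>w. H w \<partial>\<mu>)"
proof -
  have "\<bar>(\<integral>w. F w \<partial>\<mu>) - (\<integral>w. G w \<partial>\<mu>)\<bar> = \<bar>\<integral>w. F w - G w \<partial>\<mu>\<bar>"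
    using assms by simp
  also have "\<dots> \<le> (\<integral>w. \<bar>F w - G w\<bar> \<partial>\<mu>)" by (rule integral_abs_bound)
  also have "\<dots> \<le> (\<integral>w. H w \<partial>\<mu>)"
    by (rule integral_mono_AE) (use assms in auto)
  finally show ?thesis .
qed

text \<open>Orienting the later displacement by \<open>side w i\<close> treats the hitting run as
  one that received the positive sign; from the hit on the walk is continued freely. As
  \<open>f\<close> is even, \<open>c\<close> is, up to sign, the displacement that is tested
  for.\<close>

definition after_hit :: "real \<Rightarrow> nat \<Rightarrow> real" where
  "after_hit c i = (\<integral>w. h w i * f (c + disp w i) \<partial>\<mu>)"

text \<open>Reflection at \<open>i\<close> reverses the later displacement but keeps the weight and
  the side, which the path up to \<open>i\<close> determines.\<close>

lemma after_hit_minus: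
  assumes "i \<le> K"
  shows "(\<integral>w. h w i * f (c - disp w i) \<partial>\<mu>) = after_hit c i"
proof -
  have "after_hit c i = (\<integral>w. h (reflect_from i w) i * f (c + disp (reflect_from i w) i) \<partial>\<mu>)"
    unfolding after_hit_def by (rule integral_reflect_from) measurable
  also have "\<dots> = (\<integral>w. h w i * f (c - disp w i) \<partial>\<mu>)"
  proof (rule Bochner_Integration.integral_cong[OF refl])
    fix w
    have "disp (reflect_from i w) i = - disp w i"
      using assms by (auto simp: side_def reflect_from_def)
    then show "h (reflect_from i w) i * f (c + disp (reflect_from i w) i) = h w i * f (c - disp w i)"
      by (simp add: hit_reflect_from)
  qed
  finally show ?thesis by simp
qed

text \<open>Seen from the hitting side, the end point is \<open>side w i * w i\<close> plus the
  displacement, and the first summand is \<open>z\<close> up to the overshoot.\<close>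

lemma after_hit_approx:
  assumes "i \<le> K"
  shows "\<bar>(\<integral>w. h w i * f (side w i * w K + c) \<partial>\<mu>) - after_hit (z + c) i\<bar> \<le> (\<integral>w. h w i * err w \<partial>\<mu>)"
  unfolding after_hit_def
proof (rule integral_diff_le)
  show "AE w in \<mu>. \<bar>h w i * f (side w i * w K + c) - h w i * f (z + c + disp w i)\<bar> \<le> h w i * err w"
    using starts_at_0
  proof eventually_elim
    case (elim w)
    show ?case
    proof (cases "fresh z w i")
      case True
      have "\<bar>side w i * w i - z\<bar> \<le> max_step w K"
        by (rule fresh_overshoot) (use True assms elim z in auto)
      then have "\<bar>f (side w i * w K + c) - f (z + c + disp w i)\<bar> \<le> err w"
        using max_step_nonneg[OF K, of w] by (intro f_close) (auto simp: algebra_simps)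
      then show ?thesis using h_bounds[of w i]
        by (simp add: abs_mult mult_left_mono flip: right_diff_distrib)
    qed (simp add: hit_def)
  qed
qed (auto intro!: integrable_h_times abs_f_le_1 simp: err_bounds)

text \<open>Reflection at \<open>k\<close> turns \<open>w K\<close> into
  \<open>2 * w k - w K\<close>, and \<open>w k\<close> is small because the sign changes
  there.\<close>

lemma reflect_at_turn:
  assumes "i < k" "k \<le> K"
  shows "\<bar>(\<integral>w. h w i * (of_bool (turn w i k) * f (side w i * w K - c)) \<partial>\<mu>) -
      (\<integral>w. h w i * (of_bool (turn w i k) * f (- side w i * w K - c)) \<partial>\<mu>)\<bar>
     \<le> (\<integral>w. h w i * (of_bool (turn w i k) * err w) \<partial>\<mu>)"
proof -
  have "(\<integral>w. h w i * (of_bool (turn w i k) * f (side w i * w K - c)) \<partial>\<mu>) =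
    (\<integral>w. h (reflect_from k w) i * (of_bool (turn (reflect_from k w) i k) *
        f (side (reflect_from k w) i * reflect_from k w K - c)) \<partial>\<mu>)"
    by (rule integral_reflect_from) measurable
  also have "\<dots> = (\<integral>w. h w i * (of_bool (turn w i k) * f (side w i * (2 * w k - w K) - c)) \<partial>\<mu>)"
    using assms by (intro Bochner_Integration.integral_cong)
      (auto simp: hit_reflect_from turn_reflect_from side_def reflect_from_def)
  finally have eq: "(\<integral>w. h w i * (of_bool (turn w i k) * f (side w i * w K - c)) \<partial>\<mu>) =
    (\<integral>w. h w i * (of_bool (turn w i k) * f (side w i * (2 * w k - w K) - c)) \<partial>\<mu>)" .
  show ?thesis unfolding eq
  proof (rule integral_diff_le)
    show "AE w in \<mu>. \<bar>h w i * (of_bool (turn w i k) * f (side w i * (2 * w k - w K) - c)) -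
        h w i * (of_bool (turn w i k) * f (- side w i * w K - c))\<bar>
      \<le> h w i * (of_bool (turn w i k) * err w)"
    proof (intro AE_I2)
      fix w
      have "\<bar>f (side w i * (2 * w k - w K) - c) - f (- side w i * w K - c)\<bar> \<le> err w" if "turn w i k"
      proof (rule f_close)
        have "side w i * (2 * w k - w K) - c - (- side w i * w K - c) = 2 * (side w i * w k)"
          by (simp add: algebra_simps)
        moreover have "\<bar>side w i * w k\<bar> \<le> max_step w K"
          using turn_small[OF that assms] by (simp add: side_def)
        ultimately show "\<bar>side w i * (2 * w k - w K) - c - (- side w i * w K - c)\<bar> \<le> 2 * max_step w K"
          by linarith
      qed
      then show "\<bar>h w i * (of_bool (turn w i k) * f (side w i * (2 * w k - w K) - c)) -
        h w i * (of_bool (turn w i k) * f (- side w i * w K - c))\<bar>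
      \<le> h w i * (of_bool (turn w i k) * err w)"
        using h_bounds[of w i]
        by (cases "turn w i k") (auto simp: abs_mult mult_left_mono simp flip: right_diff_distrib)
    qed
  qed (auto intro!: integrable_h_times abs_f_le_1 simp: err_bounds)
qed

text \<open>After the return to 0 both sides are equally likely, whichever run was hit. The events
  of a first turn at \<open>k\<close> are disjoint, so their errors add up to a single one.\<close>

lemma reflect_at_first_turn:
  assumes "i \<le> K"
  shows "\<bar>(\<integral>w. h w i * (of_bool (\<not> same_side w i K) * f (side w i * w K - c)) \<partial>\<mu>) -
      (\<integral>w. h w i * (of_bool (\<not> same_side w i K) * f (- side w i * w K - c)) \<partial>\<mu>)\<bar>
     \<le> (\<integral>w. h w i * err w \<partial>\<mu>)"
proof -
  have split: "(\<integral>w. h w i * (of_bool (\<not> same_side w i K) * H w) \<partial>\<mu>) =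
      (\<Sum>k\<in>{i<..K}. \<integral>w. h w i * (of_bool (turn w i k) * H w) \<partial>\<mu>)"
    if [measurable]: "H \<in> borel_measurable (PiM UNIV (\<lambda>_. borel))" and "\<And>w. \<bar>H w\<bar> \<le> 1" for H
  proof -
    have "(\<integral>w. h w i * (of_bool (\<not> same_side w i K) * H w) \<partial>\<mu>) =
      (\<integral>w. (\<Sum>k\<in>{i<..K}. h w i * (of_bool (turn w i k) * H w)) \<partial>\<mu>)"
      using assms by (simp only: not_same_side_sum sum_distrib_left sum_distrib_right)
    also have "\<dots> = (\<Sum>k\<in>{i<..K}. \<integral>w. h w i * (of_bool (turn w i k) * H w) \<partial>\<mu>)"
      by (rule Bochner_Integration.integral_sum) (auto intro!: integrable_h_times that(2))
    finally show ?thesis .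
  qed
  have "\<bar>(\<integral>w. h w i * (of_bool (\<not> same_side w i K) * f (side w i * w K - c)) \<partial>\<mu>) -
      (\<integral>w. h w i * (of_bool (\<not> same_side w i K) * f (- side w i * w K - c)) \<partial>\<mu>)\<bar>
    = \<bar>\<Sum>k\<in>{i<..K}. (\<integral>w. h w i * (of_bool (turn w i k) * f (side w i * w K - c)) \<partial>\<mu>) -
      (\<integral>w. h w i * (of_bool (turn w i k) * f (- side w i * w K - c)) \<partial>\<mu>)\<bar>"
    by (subst (1 2) split) (auto simp: abs_f_le_1 sum_subtractf)
  also have "\<dots> \<le> (\<Sum>k\<in>{i<..K}. \<integral>w. h w i * (of_bool (turn w i k) * err w) \<partial>\<mu>)"
    by (rule order_trans[OF sum_abs]) (intro sum_mono reflect_at_turn; simp)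
  also have "\<dots> = (\<integral>w. h w i * (of_bool (\<not> same_side w i K) * err w) \<partial>\<mu>)"
    by (rule split[symmetric]) (auto simp: err_bounds)
  also have "\<dots> \<le> (\<integral>w. h w i * err w \<partial>\<mu>)"
    by (rule integral_mono) (auto intro!: integrable_h_times mult_left_mono simp: err_bounds h_bounds)
  finally show ?thesis .
qed

lemma last_run_approx:
  assumes i: "i \<le> K" and m: "0 < m"
  shows "\<bar>(\<integral>w. h w i * ((if same_side w i K then 1 else \<beta>) * f (\<bar>w K\<bar> - 2 * real m * z)) \<partial>\<mu>) -
      (after_hit ((2 * real m - 1) * z) i - (1 - 2 * \<beta>) * after_hit ((2 * real m + 1) * z) i)\<bar>
    \<le> 3 * (\<integral>w. h w i * err w \<partial>\<mu>)"
proof -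
  define g where "g x = f (x - 2 * real m * z)" for x
  have [measurable]: "g \<in> borel_measurable borel" unfolding g_def by measurable
  have abs_g: "\<bar>g x\<bar> \<le> 1" for x by (simp add: g_def abs_f_le_1)
  have g0: "g x = 0" if "x \<le> 0" for x
  proof -
    have "z \<le> 2 * real m * z" using m z by simp
    then have "z \<le> \<bar>x - 2 * real m * z\<bar>" using that by linarith
    then show ?thesis unfolding g_def by (rule f_supp)
  qed
  let ?T = "\<integral>w. h w i * ((if same_side w i K then 1 else \<beta>) * g \<bar>w K\<bar>) \<partial>\<mu>"
  let ?P = "\<integral>w. h w i * g (side w i * w K) \<partial>\<mu>" and ?N = "\<integral>w. h w i * g (- side w i * w K) \<partial>\<mu>"
  let ?P' = "\<integral>w. h w i * (of_bool (\<not> same_side w i K) * g (side w i * w K)) \<partial>\<mu>"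
  let ?N' = "\<integral>w. h w i * (of_bool (\<not> same_side w i K) * g (- side w i * w K)) \<partial>\<mu>"
  let ?e = "\<integral>w. h w i * err w \<partial>\<mu>"
  \<comment> \<open>Once the hitting run is over, both orientations of the end point carry the
    weight \<open>\<beta>\<close>. Writing the weight of the opposite one as
    \<open>(1 - \<beta>) - (1 - 2 * \<beta>)\<close> isolates a difference that reflection at the
    first sign change makes small; this is the origin of the factor \<open>1 - 2 * \<beta>\<close>.
    While the run lasts, the opposite orientation is outside the support of
    \<open>g\<close>.\<close>
  have pw: "h w i * ((if same_side w i K then 1 else \<beta>) * g \<bar>w K\<bar>) =
      h w i * g (side w i * w K) - (1 - 2 * \<beta>) * (h w i * g (- side w i * w K))
      - (1 - \<beta>) * (h w i * (of_bool (\<not> same_side w i K) * g (side w i * w K))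
           - h w i * (of_bool (\<not> same_side w i K) * g (- side w i * w K)))" for w
  proof (cases "same_side w i K")
    case True
    then have "(0 < w K \<and> 0 < w i) \<or> (w K \<le> 0 \<and> w i \<le> 0)"
      using i by (auto simp: same_side_def)
    then have "\<bar>w K\<bar> = side w i * w K" "- side w i * w K \<le> 0" by (auto simp: side_def)
    then show ?thesis using True g0[of "- side w i * w K"] by simp
  next
    case False
    have "g \<bar>w K\<bar> = g (side w i * w K) + g (- side w i * w K)"
      using g0[of "w K"] g0[of "- w K"] by (auto simp: side_def abs_if)
    then show ?thesis using False by (simp add: algebra_simps)
  qed
  have int: "integrable \<mu> (\<lambda>w. h w i * g (side w i * w K))" "integrable \<mu> (\<lambda>w. h w i * g (- side w i * w K))"
     "integrable \<mu> (\<lambda>w. h w i * (of_bool (\<not> same_side w i K) * g (side w i * w K)))"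
     "integrable \<mu> (\<lambda>w. h w i * (of_bool (\<not> same_side w i K) * g (- side w i * w K)))"
    by (auto intro!: integrable_h_times abs_g)
  have T: "?T = ?P - (1 - 2 * \<beta>) * ?N - (1 - \<beta>) * (?P' - ?N')"
    unfolding pw using int by simp
  have e0: "0 \<le> ?e" by (rule integral_nonneg_AE) (auto simp: err_bounds h_bounds)
  have "\<bar>?P' - ?N'\<bar> \<le> ?e" unfolding g_def by (rule reflect_at_first_turn[OF i])
  then have 1: "\<bar>(1 - \<beta>) * (?P' - ?N')\<bar> \<le> 1 * ?e"
    unfolding abs_mult using \<beta> by (intro mult_mono) auto
  \<comment> \<open>The required displacement is \<open>z - 2 * real m * z\<close>, which is
    negative; evenness of \<open>f\<close> and \<open>after_hit_minus\<close> remove its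
    sign.\<close>
  have "after_hit ((2 * real m - 1) * z) i = after_hit (z + (- 2 * real m * z)) i"
    by (subst after_hit_minus[OF i, symmetric], unfold after_hit_def, subst f_even[symmetric])
      (simp add: algebra_simps)
  then have 2: "\<bar>?P - after_hit ((2 * real m - 1) * z) i\<bar> \<le> ?e"
    using after_hit_approx[OF i, of "- 2 * real m * z"] by (simp add: g_def)
  have "?N = (\<integral>w. h w i * f (side w i * w K + 2 * real m * z) \<partial>\<mu>)"
    unfolding g_def by (subst f_even[symmetric]) simp
  then have "\<bar>?N - after_hit ((2 * real m + 1) * z) i\<bar> \<le> ?e"
    using after_hit_approx[OF i, of "2 * real m * z"] by (simp add: algebra_simps)
  then have 3: "\<bar>(1 - 2 * \<beta>) * (?N - after_hit ((2 * real m + 1) * z) i)\<bar> \<le> 1 * ?e"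
    unfolding abs_mult using \<beta> by (intro mult_mono) auto
  have "?T - (after_hit ((2 * real m - 1) * z) i - (1 - 2 * \<beta>) * after_hit ((2 * real m + 1) * z) i)
    = (?P - after_hit ((2 * real m - 1) * z) i)
      - (1 - 2 * \<beta>) * (?N - after_hit ((2 * real m + 1) * z) i) - (1 - \<beta>) * (?P' - ?N')"
    unfolding T by (simp add: algebra_simps)
  then show ?thesis using 1 2 3 unfolding g_def by linarith
qed

text \<open>\<open>total_after (j * z)\<close> is the smoothed form of \<open>a j\<close> in the
  overview.\<close>

definition total_after :: "real \<Rightarrow> real" where
  "total_after c = (\<Sum>i\<le>K. after_hit c i)"

lemma sum_h: "(\<Sum>i\<le>K. h w i) = 1 - survive \<beta> z w (Suc K)"
  using sum_hit[of \<beta> z w "Suc K"] by (simp only: lessThan_Suc_atMost)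

lemma sum_h_le_1: "(\<Sum>i\<le>K. h w i) \<le> 1" "0 \<le> (\<Sum>i\<le>K. h w i)"
  using survive_bounds[of \<beta> z w "Suc K"] \<beta> by (simp_all add: sum_h)

lemma sum_integral_h:
  fixes H :: "(nat \<Rightarrow> real) \<Rightarrow> real"
  assumes [measurable]: "H \<in> borel_measurable (PiM UNIV (\<lambda>_. borel))" and "\<And>w. \<bar>H w\<bar> \<le> 1"
  shows "(\<Sum>i\<le>K. \<integral>w. h w i * H w \<partial>\<mu>) = (\<integral>w. (1 - survive \<beta> z w (Suc K)) * H w \<partial>\<mu>)"
proof -
  have "(\<Sum>i\<le>K. \<integral>w. h w i * H w \<partial>\<mu>) = (\<integral>w. (\<Sum>i\<le>K. h w i * H w) \<partial>\<mu>)"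
    by (rule Bochner_Integration.integral_sum[symmetric]) (intro integrable_h_times assms)
  then show ?thesis by (simp only: sum_h flip: sum_distrib_right)
qed

text \<open>On every path the hitting weights sum to at most 1, so the error does not grow with the
  number of grid points.\<close>

lemma sum_h_err_le: "(\<Sum>i\<le>K. \<integral>w. h w i * err w \<partial>\<mu>) \<le> (\<integral>w. err w \<partial>\<mu>)"
proof (subst sum_integral_h)
  show "(\<integral>w. (1 - survive \<beta> z w (Suc K)) * err w \<partial>\<mu>) \<le> (\<integral>w. err w \<partial>\<mu>)"
  proof (rule integral_mono)
    show "integrable \<mu> err" by (rule integrable_abs_le_1) (auto simp: err_bounds)
    show "integrable \<mu> (\<lambda>w. (1 - survive \<beta> z w (Suc K)) * err w)"
      by (rule integrable_abs_le_1, measurable)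
        (use survive_bounds[of \<beta> z _ "Suc K"] \<beta> err_bounds in \<open>auto simp: abs_mult intro!: mult_le_one\<close>)
    show "(1 - survive \<beta> z w (Suc K)) * err w \<le> err w" for w
      using survive_bounds[of \<beta> z w "Suc K"] \<beta> err_bounds[of w] by (simp add: mult_left_le_one_le)
  qed
qed (auto simp: err_bounds)

text \<open>Since \<open>f\<close> is even, the end point may be read from the side of the hitting
  run, where the walk still has to travel the distance \<open>z\<close>.\<close>

lemma first_hit_approx:
  "\<bar>(\<integral>w. (1 - survive \<beta> z w (Suc K)) * f (w K) \<partial>\<mu>) - total_after z\<bar> \<le> (\<integral>w. err w \<partial>\<mu>)"
proof -
  have "\<bar>(\<integral>w. h w i * f (w K) \<partial>\<mu>) - after_hit z i\<bar> \<le> (\<integral>w. h w i * err w \<partial>\<mu>)" if "i \<le> K" for i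
  proof -
    have "f (side w i * w K) = f (w K)" for w by (simp add: side_def f_even)
    then show ?thesis using after_hit_approx[OF that, of 0] by simp
  qed
  then have "(\<Sum>i\<le>K. \<bar>(\<integral>w. h w i * f (w K) \<partial>\<mu>) - after_hit z i\<bar>) \<le> (\<Sum>i\<le>K. \<integral>w. h w i * err w \<partial>\<mu>)"
    by (intro sum_mono) simp
  then have "\<bar>\<Sum>i\<le>K. (\<integral>w. h w i * f (w K) \<partial>\<mu>) - after_hit z i\<bar> \<le> (\<integral>w. err w \<partial>\<mu>)"
    using sum_h_err_le sum_abs[of "\<lambda>i. (\<integral>w. h w i * f (w K) \<partial>\<mu>) - after_hit z i" "{..K}"] by linarith
  moreover have "(\<integral>w. (1 - survive \<beta> z w (Suc K)) * f (w K) \<partial>\<mu>) = (\<Sum>i\<le>K. \<integral>w. h w i * f (w K) \<partial>\<mu>)"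
    by (rule sum_integral_h[symmetric]) (auto simp: abs_f_le_1)
  ultimately show ?thesis by (simp add: total_after_def sum_subtractf)
qed

text \<open>Evaluates the probability that the re-signed walk ends near \<^term>\<open>2 * real m * z\<close>, directly and
  by decomposing at its first hit of \<^term>\<open>z\<close>.\<close>

lemma recursion_approx:
  assumes m: "0 < m"
  shows "\<bar>2 * \<beta> * (\<integral>w. f (w K - 2 * real m * z) \<partial>\<mu>) -
      (total_after ((2 * real m - 1) * z) - (1 - 2 * \<beta>) * total_after ((2 * real m + 1) * z))\<bar>
    \<le> 3 * (\<integral>w. err w \<partial>\<mu>)"
proof -
  let ?g = "\<lambda>x. f (x - 2 * real m * z)"
  let ?T = "\<lambda>i. \<integral>w. h w i * ((if same_side w i K then 1 else \<beta>) * ?g \<bar>w K\<bar>) \<partial>\<mu>"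
  let ?A = "\<lambda>i. after_hit ((2 * real m - 1) * z) i - (1 - 2 * \<beta>) * after_hit ((2 * real m + 1) * z) i"
  have mz: "2 * z \<le> 2 * real m * z" using m z by simp
  have g0: "?g x = 0" if "x \<le> z" for x
  proof (rule f_supp)
    show "z \<le> \<bar>x - 2 * real m * z\<bar>" using that mz by linarith
  qed
  have "(\<Sum>i\<le>K. ?T i) = (\<integral>w. (\<Sum>i\<le>K. h w i * ((if same_side w i K then 1 else \<beta>) * ?g \<bar>w K\<bar>)) \<partial>\<mu>)"
  proof (rule Bochner_Integration.integral_sum[symmetric], rule integrable_h_times)
    show "\<bar>(if same_side w i K then 1 else \<beta>) * ?g \<bar>w K\<bar>\<bar> \<le> 1" for i w
      using \<beta> abs_f_le_1[of "\<bar>w K\<bar> - 2 * real m * z"] by (auto simp: abs_mult intro!: mult_le_one)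
  qed measurable
  also have "\<dots> = (\<integral>w. \<beta> * (?g (w K) + ?g (- w K)) \<partial>\<mu>)"
  proof (rule Bochner_Integration.integral_cong[OF refl])
    fix w
    have "(\<Sum>i\<le>K. h w i * ((if same_side w i K then 1 else \<beta>) * ?g \<bar>w K\<bar>)) =
      (\<Sum>i\<le>K. h w i * (if same_side w i K then 1 else \<beta>)) * ?g \<bar>w K\<bar>"
      by (simp add: sum_distrib_right mult.assoc)
    \<comment> \<open>An end point in the support of \<open>?g\<close> is higher than
      \<open>z\<close>, so \<open>hit_last_run\<close> applies; for all others both sides
      vanish.\<close>
    also have "\<dots> = \<beta> * ?g \<bar>w K\<bar>"
      using hit_last_run[of z w K \<beta>] g0[of "\<bar>w K\<bar>"] by (cases "z \<le> \<bar>w K\<bar>") auto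
    also have "\<dots> = \<beta> * (?g (w K) + ?g (- w K))"
      using g0[of "w K"] g0[of "- w K"] z by (cases "w K \<ge> 0") auto
    finally show "(\<Sum>i\<le>K. h w i * ((if same_side w i K then 1 else \<beta>) * ?g \<bar>w K\<bar>)) =
        \<beta> * (?g (w K) + ?g (- w K))" .
  qed
  also have "\<dots> = \<beta> * ((\<integral>w. ?g (w K) \<partial>\<mu>) + (\<integral>w. ?g (- w K) \<partial>\<mu>))"
    by (subst Bochner_Integration.integral_mult_right_zero, subst Bochner_Integration.integral_add)
      (auto intro!: integrable_abs_le_1 abs_f_le_1)
  \<comment> \<open>Reflection at index 0, where the walk is almost surely 0, gives the symmetry of
    the end point.\<close>
  also have "(\<integral>w. ?g (- w K) \<partial>\<mu>) = (\<integral>w. ?g (- reflect_from 0 w K) \<partial>\<mu>)"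
    by (rule integral_reflect_from) measurable
  also have "\<dots> = (\<integral>w. ?g (w K) \<partial>\<mu>)"
  proof (rule integral_cong_AE)
    show "AE w in \<mu>. ?g (- reflect_from 0 w K) = ?g (w K)"
      using starts_at_0 by eventually_elim (use K in \<open>simp add: reflect_from_def\<close>)
  qed measurable
  finally have T: "(\<Sum>i\<le>K. ?T i) = 2 * \<beta> * (\<integral>w. ?g (w K) \<partial>\<mu>)" by simp
  have "\<bar>\<Sum>i\<le>K. ?T i - ?A i\<bar> \<le> (\<Sum>i\<le>K. 3 * (\<integral>w. h w i * err w \<partial>\<mu>))"
    by (rule order_trans[OF sum_abs]) (intro sum_mono last_run_approx m; simp)
  also have "\<dots> \<le> 3 * (\<integral>w. err w \<partial>\<mu>)"
    using sum_h_err_le by (simp flip: sum_distrib_left)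
  finally show ?thesis
    unfolding sum_subtractf T by (simp add: total_after_def sum_subtractf sum_distrib_left)
qed

lemma abs_total_after_le_1: "\<bar>total_after c\<bar> \<le> 1"
proof -
  have eq: "total_after c = (\<integral>w. (\<Sum>i\<le>K. h w i * f (c + disp w i)) \<partial>\<mu>)"
    unfolding total_after_def after_hit_def
    by (rule Bochner_Integration.integral_sum[symmetric]) (auto intro!: integrable_h_times abs_f_le_1)
  show ?thesis
    unfolding eq
  proof (rule abs_expectation_le_1)
    fix w
    have "\<bar>\<Sum>i\<le>K. h w i * f (c + disp w i)\<bar> \<le> (\<Sum>i\<le>K. h w i)"
      by (rule order_trans[OF sum_abs])
        (use h_bounds f_nonneg f_le_1 in \<open>auto intro!: sum_mono mult_left_le simp: abs_mult\<close>)
    then show "\<bar>\<Sum>i\<le>K. h w i * f (c + disp w i)\<bar> \<le> 1" using sum_h_le_1[of w] by simp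
  qed measurable
qed

text \<open>Unrolls the recursion \<open>n\<close> times. The remainder carries the factor
  \<open>(1 - 2 * \<beta>) ^ n\<close>, each step costs at most three errors, and replacing the
  hitting probability by \<open>total_after z\<close> costs one more.\<close>

lemma survive_series_approx:
  "\<bar>(\<integral>w. (1 - survive \<beta> z w (Suc K)) * f (w K) \<partial>\<mu>) -
      2 * \<beta> * (\<Sum>m<n. (1 - 2 * \<beta>) ^ m * (\<integral>w. f (w K - 2 * real (Suc m) * z) \<partial>\<mu>))\<bar>
    \<le> \<bar>1 - 2 * \<beta>\<bar> ^ n + (3 * real n + 1) * (\<integral>w. err w \<partial>\<mu>)"
proof -
  let ?p = "1 - 2 * \<beta>" and ?e = "\<integral>w. err w \<partial>\<mu>"
  let ?c = "\<lambda>m. \<integral>w. f (w K - 2 * real (Suc m) * z) \<partial>\<mu>"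
  have p1: "\<bar>?p\<bar> ^ n \<le> 1" for n using \<beta> by (intro power_le_one) auto
  have *: "\<bar>total_after z - 2 * \<beta> * (\<Sum>m<n. ?p ^ m * ?c m) - ?p ^ n * total_after ((2 * real n + 1) * z)\<bar>
      \<le> 3 * real n * ?e"
  proof (induction n)
    case (Suc n)
    define r where "r = 2 * \<beta> * ?c n - (total_after ((2 * real n + 1) * z) - ?p * total_after ((2 * real n + 3) * z))"
    have "\<bar>r\<bar> \<le> 3 * ?e"
      using recursion_approx[of "Suc n"] by (simp add: r_def algebra_simps)
    then have r: "\<bar>?p ^ n * r\<bar> \<le> 1 * (3 * ?e)"
      unfolding abs_mult power_abs by (intro mult_mono p1) auto
    have eq: "total_after z - 2 * \<beta> * (\<Sum>m<Suc n. ?p ^ m * ?c m) - ?p ^ Suc n * total_after ((2 * real (Suc n) + 1) * z)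
      = (total_after z - 2 * \<beta> * (\<Sum>m<n. ?p ^ m * ?c m) - ?p ^ n * total_after ((2 * real n + 1) * z)) - ?p ^ n * r"
      by (simp add: r_def algebra_simps)
    have "3 * real (Suc n) * ?e = 3 * real n * ?e + 3 * ?e" by (simp add: algebra_simps)
    with Suc.IH r show ?case unfolding eq by linarith
  qed simp
  have "\<bar>?p ^ n * total_after ((2 * real n + 1) * z)\<bar> \<le> \<bar>?p\<bar> ^ n * 1"
    unfolding abs_mult power_abs by (intro mult_mono abs_total_after_le_1) auto
  moreover have "(3 * real n + 1) * ?e = 3 * real n * ?e + ?e" by (simp add: algebra_simps)
  ultimately show ?thesis using * first_hit_approx by linarith
qed

end

section \<open>From random walks to Brownian motion\<close>

text \<open>With dyadic meshes the grids are nested, and index \<open>2 ^ n\<close> is time 1 on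
  each of them.\<close>

definition walk :: "(real \<Rightarrow> 'a \<Rightarrow> real) \<Rightarrow> nat \<Rightarrow> 'a \<Rightarrow> nat \<Rightarrow> real" where
  "walk B n \<omega> j = B (real j / 2 ^ n) \<omega>"

definition walk_step :: "(real \<Rightarrow> 'a \<Rightarrow> real) \<Rightarrow> nat \<Rightarrow> nat \<Rightarrow> 'a \<Rightarrow> real" where
  "walk_step B n i \<omega> = B (real (Suc i) / 2 ^ n) \<omega> - B (real i / 2 ^ n) \<omega>"

lemma tendsto_suminf_dominated:
  fixes a :: "nat \<Rightarrow> 'b \<Rightarrow> real"
  assumes "\<And>k. (a k \<longlongrightarrow> b k) F" "\<forall>\<^sub>F n in F. \<forall>k. \<bar>a k n\<bar> \<le> M k" "summable M" "F \<noteq> bot"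
  shows "((\<lambda>n. \<Sum>k. a k n) \<longlongrightarrow> (\<Sum>k. b k)) F"
proof -
  have "eventually (\<lambda>(k,n). norm (a k n) \<le> M k) (at_top \<times>\<^sub>F F)"
  proof -
    have "\<forall>\<^sub>F x in (at_top :: nat filter) \<times>\<^sub>F F. \<forall>k. \<bar>a k (snd x)\<bar> \<le> M k"
      using eventually_prod2[of "at_top :: nat filter" "\<lambda>n. \<forall>k. \<bar>a k n\<bar> \<le> M k" F] assms(2)
      by (simp add: case_prod_unfold)
    then show ?thesis by eventually_elim auto
  qed
  from tannerys_theorem[OF assms(1) this assms(3,4)] show ?thesis by blast
qed

text \<open>The truncation has to be fixed before the mesh, because the factor \<open>C k\<close> of
  the mesh error may grow with \<open>k\<close>.\<close>

lemma LIMSEQ_from_truncated_bounds: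
  fixes x e :: "nat \<Rightarrow> real"
  assumes bound: "\<And>n k. \<bar>x n - S k\<bar> \<le> r k + C k * e n"
    and "e \<longlonglongrightarrow> 0" "r \<longlonglongrightarrow> 0" "S \<longlonglongrightarrow> l"
  shows "x \<longlonglongrightarrow> l"
proof (rule LIMSEQ_I)
  fix d :: real assume "0 < d"
  have "(\<lambda>k. r k + \<bar>S k - l\<bar>) \<longlonglongrightarrow> 0 + \<bar>l - l\<bar>" by (intro tendsto_intros assms)
  then obtain k where k: "r k + \<bar>S k - l\<bar> < d / 2"
    using \<open>0 < d\<close> by (auto dest!: order_tendstoD(2)[where a = "d / 2"] eventually_happens)
  have "(\<lambda>n. C k * e n) \<longlonglongrightarrow> C k * 0" by (intro tendsto_intros assms)
  then have "\<forall>\<^sub>F n in sequentially. C k * e n < d / 2"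
    using \<open>0 < d\<close> by (auto dest!: order_tendstoD(2)[where a = "d / 2"])
  then obtain N where N: "\<And>n. n \<ge> N \<Longrightarrow> C k * e n < d / 2" by (auto simp: eventually_sequentially)
  show "\<exists>N. \<forall>n\<ge>N. norm (x n - l) < d"
  proof (intro exI allI impI)
    fix n assume "N \<le> n"
    show "norm (x n - l) < d" using bound[of n k] N[OF \<open>N \<le> n\<close>] k by (simp add: abs_if split: if_splits)
  qed
qed

section \<open>Brownian motion on a dyadic grid\<close>

locale brownian_motion =
  fixes M :: "'a measure" and B :: "real \<Rightarrow> 'a \<Rightarrow> real"
  assumes bm: "standard_brownian_motion M B"

sublocale brownian_motion \<subseteq> prob_space M
  using bm by (simp add: standard_brownian_motion_def)

context brownian_motion
begin

lemma measurable_B: "0 \<le> t \<Longrightarrow> B t \<in> borel_measurable M"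
  using bm by (simp add: standard_brownian_motion_def)

lemma measurable_walk [measurable]: "(\<lambda>\<omega>. walk B n \<omega> j) \<in> borel_measurable M"
  unfolding walk_def by (rule measurable_B) simp

lemma measurable_B_1 [measurable]: "B 1 \<in> borel_measurable M"
  by (rule measurable_B) simp

lemma measurable_walk_step [measurable]: "walk_step B n i \<in> borel_measurable M"
  unfolding walk_step_def by (intro borel_measurable_diff measurable_B) auto

lemma measurable_walk_path [measurable]:
  "walk B n \<in> measurable M (PiM UNIV (\<lambda>_. borel))"
proof -
  have "(\<lambda>\<omega>. \<lambda>j. walk B n \<omega> j) \<in> measurable M (PiM UNIV (\<lambda>_. borel))"
    by (rule measurable_PiM_single') auto
  then show ?thesis by simp
qed

lemma B_0: "\<omega> \<in> space M \<Longrightarrow> B 0 \<omega> = 0"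
  using bm by (simp add: standard_brownian_motion_def)

lemma continuous_B: "\<omega> \<in> space M \<Longrightarrow> continuous_on {0..} (\<lambda>t. B t \<omega>)"
  using bm by (simp add: standard_brownian_motion_def)

lemma distributed_increment:
  "0 \<le> s \<Longrightarrow> s < t \<Longrightarrow> distributed M lborel (\<lambda>\<omega>. B t \<omega> - B s \<omega>) (normal_density 0 (sqrt (t - s)))"
  using bm by (simp add: standard_brownian_motion_def)

lemma distributed_B:
  assumes "0 < t"
  shows "distributed M lborel (B t) (normal_density 0 (sqrt t))"
proof -
  have "distributed M lborel (\<lambda>\<omega>. B t \<omega> - B 0 \<omega>) (normal_density 0 (sqrt t))"
    using distributed_increment[of 0 t] assms by simp
  moreover have "distr M lborel (B t) = distr M lborel (\<lambda>\<omega>. B t \<omega> - B 0 \<omega>)"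
    by (rule distr_cong) (auto simp: B_0)
  ultimately show ?thesis using measurable_B[of t] assms by (simp add: distributed_def)
qed

lemma indep_vars_increments:
  "0 \<le> t 0 \<Longrightarrow> strict_mono_on {..n} t \<Longrightarrow>
    indep_vars (\<lambda>_. borel) (\<lambda>i \<omega>. B (t (Suc i)) \<omega> - B (t i) \<omega>) {..<n}" for t :: "nat \<Rightarrow> real"
  using bm by (simp add: standard_brownian_motion_def)

text \<open>Independence of an infinite family concerns only its finite subfamilies, and each of
  these lies in an initial segment.\<close>

lemma indep_vars_walk_step: "indep_vars (\<lambda>_. borel) (walk_step B n) UNIV"
proof -
  have fin: "indep_vars (\<lambda>_. borel) (walk_step B n) {..<N}" for N
    using indep_vars_increments[of "\<lambda>i. real i / 2 ^ n" N]
    by (simp add: walk_step_def[abs_def] strict_mono_on_def divide_strict_right_mono)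
  have "indep_sets (\<lambda>i. {walk_step B n i -` A \<inter> space M |A. A \<in> sets borel}) UNIV"
  proof (subst indep_sets_finite_index_sets, intro allI impI)
    fix J :: "nat set" assume "finite J"
    then have "J \<subseteq> {..<Suc (Max J)}" by (auto simp: less_Suc_eq_le)
    then show "indep_sets (\<lambda>i. {walk_step B n i -` A \<inter> space M |A. A \<in> sets borel}) J"
      using fin[of "Suc (Max J)"] unfolding indep_vars_def2 by (blast intro: indep_sets_mono_index)
  qed
  then show ?thesis by (simp add: indep_vars_def2)
qed

lemma distr_uminus_walk_step:
  "distr M borel (\<lambda>\<omega>. - walk_step B n i \<omega>) = distr M borel (walk_step B n i)"
proof -
  let ?\<sigma> = "sqrt (real (Suc i) / 2 ^ n - real i / 2 ^ n)"
  have lt: "real i / 2 ^ n < real (Suc i) / 2 ^ n" by (simp add: divide_strict_right_mono)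
  have D: "distributed M lborel (walk_step B n i) (normal_density 0 ?\<sigma>)"
    unfolding walk_step_def using lt by (intro distributed_increment) auto
  have "distributed M lborel (\<lambda>\<omega>. 0 + (- 1) * walk_step B n i \<omega>) (normal_density (0 + (- 1) * 0) (\<bar>- 1\<bar> * ?\<sigma>))"
    by (rule normal_density_affine[OF D]) (use lt in auto)
  then have D': "distributed M lborel (\<lambda>\<omega>. - walk_step B n i \<omega>) (normal_density 0 ?\<sigma>)" by simp
  have "distr M borel Z = distr M lborel Z" for Z :: "'a \<Rightarrow> real" by (rule distr_cong) auto
  then show ?thesis
    using D[THEN distributed_distr_eq_density] D'[THEN distributed_distr_eq_density] by simp
qed

definition path_law :: "nat \<Rightarrow> (nat \<Rightarrow> real) measure" where
  "path_law n = distr M (PiM UNIV (\<lambda>_. borel)) (walk B n)"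

lemma walk_eq_sum: "\<omega> \<in> space M \<Longrightarrow> walk B n \<omega> j = (\<Sum>i<j. walk_step B n i \<omega>)"
  using sum_lessThan_telescope[of "\<lambda>i. B (real i / 2 ^ n) \<omega>" j]
  by (simp add: walk_def walk_step_def B_0)

text \<open>The walk is the sequence of partial sums of its increments. Reflection flips some of
  their signs, which leaves the joint law of independent symmetric variables unchanged.\<close>

lemma path_law_invariant: "distr (path_law n) (PiM UNIV (\<lambda>_. borel)) (reflect_from k) = path_law n"
proof -
  let ?P = "PiM UNIV (\<lambda>_::nat. borel :: real measure)"
  \<comment> \<open>Increment \<open>i\<close> leads from index \<open>i\<close> to
    \<open>Suc i\<close>, so it comes after \<open>k\<close> exactly when
    \<open>k \<le> i\<close>.\<close>
  define flip where "flip i x = (if i < k then x else - x :: real)" for i :: nat and x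
  have [measurable]: "flip i \<in> borel_measurable borel" for i unfolding flip_def by measurable
  define S :: "(nat \<Rightarrow> real) \<Rightarrow> nat \<Rightarrow> real" where "S x j = (\<Sum>i<j. x i)" for x j
  have [measurable]: "S \<in> measurable ?P ?P"
  proof -
    have "(\<lambda>x j. S x j) \<in> measurable ?P ?P" unfolding S_def by (rule measurable_PiM_single') auto
    then show ?thesis by simp
  qed
  have step_vec [measurable]: "(\<lambda>\<omega> i. walk_step B n i \<omega>) \<in> measurable M ?P"
    "(\<lambda>\<omega> i. flip i (walk_step B n i \<omega>)) \<in> measurable M ?P"
    by (rule measurable_PiM_single'; auto)+
  have "indep_vars (\<lambda>_. borel) (\<lambda>i \<omega>. flip i (walk_step B n i \<omega>)) UNIV"
    by (rule indep_vars_compose2[OF indep_vars_walk_step]) auto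
  then have "distr M ?P (\<lambda>\<omega> i. flip i (walk_step B n i \<omega>)) =
      PiM UNIV (\<lambda>i. distr M borel (\<lambda>\<omega>. flip i (walk_step B n i \<omega>)))"
    by (subst (asm) indep_vars_iff_distr_eq_PiM) (auto simp: restrict_UNIV)
  also have "\<dots> = PiM UNIV (\<lambda>i. distr M borel (walk_step B n i))"
  proof (intro PiM_cong refl)
    show "distr M borel (\<lambda>\<omega>. flip i (walk_step B n i \<omega>)) = distr M borel (walk_step B n i)" for i
      by (cases "i < k") (simp_all add: flip_def distr_uminus_walk_step)
  qed
  also have "\<dots> = distr M ?P (\<lambda>\<omega> i. walk_step B n i \<omega>)"
    using indep_vars_walk_step by (subst (asm) indep_vars_iff_distr_eq_PiM) (auto simp: restrict_UNIV)
  finally have eq: "distr M ?P (\<lambda>\<omega> i. flip i (walk_step B n i \<omega>)) = distr M ?P (\<lambda>\<omega> i. walk_step B n i \<omega>)" .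
  have walk_S: "walk B n \<omega> = S (\<lambda>i. walk_step B n i \<omega>)" if "\<omega> \<in> space M" for \<omega>
    using that by (auto simp: S_def walk_eq_sum)
  have refl_S: "reflect_from k (walk B n \<omega>) = S (\<lambda>i. flip i (walk_step B n i \<omega>))" if "\<omega> \<in> space M" for \<omega>
  proof
    fix j
    show "reflect_from k (walk B n \<omega>) j = S (\<lambda>i. flip i (walk_step B n i \<omega>)) j"
    proof (cases "j \<le> k")
      case True
      then show ?thesis using that by (simp add: reflect_from_def S_def walk_eq_sum flip_def)
    next
      case False
      have "S x j = (\<Sum>i<k. x i) + (\<Sum>i=k..<j. x i)" for x
        unfolding S_def using False
        by (subst sum.union_disjoint[symmetric]) (auto intro!: sum.cong)
      then have "S (\<lambda>i. flip i (walk_step B n i \<omega>)) j =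
          (\<Sum>i<k. walk_step B n i \<omega>) - (\<Sum>i=k..<j. walk_step B n i \<omega>)"
        "walk B n \<omega> j = (\<Sum>i<k. walk_step B n i \<omega>) + (\<Sum>i=k..<j. walk_step B n i \<omega>)"
        using walk_S[OF that] by (simp_all add: flip_def sum_negf)
      then show ?thesis using False walk_eq_sum[OF that, of n k] by (simp add: reflect_from_def)
    qed
  qed
  have "distr (path_law n) ?P (reflect_from k) = distr M ?P (reflect_from k \<circ> walk B n)"
    unfolding path_law_def by (rule distr_distr) measurable
  also have "\<dots> = distr M ?P (S \<circ> (\<lambda>\<omega> i. flip i (walk_step B n i \<omega>)))"
    by (rule distr_cong) (auto simp: refl_S)
  also have "\<dots> = distr (distr M ?P (\<lambda>\<omega> i. flip i (walk_step B n i \<omega>))) ?P S"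
    by (rule distr_distr[symmetric]) measurable
  also have "\<dots> = distr M ?P (S \<circ> (\<lambda>\<omega> i. walk_step B n i \<omega>))"
    unfolding eq by (rule distr_distr) measurable
  also have "\<dots> = path_law n"
    unfolding path_law_def by (rule distr_cong) (auto simp: walk_S)
  finally show ?thesis .
qed

lemma reflection_invariant_path_law: "reflection_invariant_walk (path_law n)"
proof -
  interpret P: prob_space "path_law n" unfolding path_law_def by (rule prob_space_distr) measurable
  show ?thesis
  proof
    show "sets (path_law n) = sets (PiM UNIV (\<lambda>_. borel))" by (simp add: path_law_def)
    show "distr (path_law n) (PiM UNIV (\<lambda>_. borel)) (reflect_from k) = path_law n" for k
      by (rule path_law_invariant)
    show "AE w in path_law n. w 0 = 0"
      unfolding path_law_def by (subst AE_distr_iff) (auto simp: walk_def B_0)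
  qed
qed

lemma integral_path_law:
  fixes H :: "(nat \<Rightarrow> real) \<Rightarrow> real"
  assumes "H \<in> borel_measurable (PiM UNIV (\<lambda>_. borel))"
  shows "(\<integral>w. H w \<partial>path_law n) = (\<integral>\<omega>. H (walk B n \<omega>) \<partial>M)"
  unfolding path_law_def by (rule integral_distr) (use assms in measurable)

lemma walk_end: "walk B n \<omega> (2 ^ n) = B 1 \<omega>"
  by (simp add: walk_def)

section \<open>Vanishing mesh\<close>

lemma max_step_walk_tendsto_0:
  assumes "\<omega> \<in> space M"
  shows "(\<lambda>n. max_step (walk B n \<omega>) (2 ^ n)) \<longlonglongrightarrow> 0"
proof (rule LIMSEQ_I)
  fix e :: real assume "0 < e"
  have "uniformly_continuous_on {0..1} (\<lambda>t. B t \<omega>)"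
    by (intro compact_uniformly_continuous continuous_on_subset[OF continuous_B[OF assms]]) auto
  then obtain d where d: "0 < d"
    "\<And>s t. s \<in> {0..1} \<Longrightarrow> t \<in> {0..1} \<Longrightarrow> \<bar>t - s\<bar> < d \<Longrightarrow> \<bar>B t \<omega> - B s \<omega>\<bar> < e"
    unfolding uniformly_continuous_on_def dist_real_def using \<open>0 < e\<close> by metis
  obtain N where N: "(1 / 2) ^ N < d" using real_arch_pow_inv[OF d(1), of "1/2"] by auto
  show "\<exists>N. \<forall>n\<ge>N. norm (max_step (walk B n \<omega>) (2 ^ n) - 0) < e"
  proof (intro exI allI impI)
    fix n assume "N \<le> n"
    then have "(1 / 2 :: real) ^ n \<le> (1 / 2) ^ N" by (intro power_decreasing) auto
    with N have n: "1 / 2 ^ n < d" by (simp add: power_one_over)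
    have "max_step (walk B n \<omega>) (2 ^ n) < e"
      unfolding max_step_def
    proof (subst Max_less_iff)
      show "\<forall>a\<in>(\<lambda>j. \<bar>walk B n \<omega> (Suc j) - walk B n \<omega> j\<bar>) ` {..<2 ^ n}. a < e"
      proof safe
        fix j :: nat assume "j < 2 ^ n"
        then have "real (Suc j) \<le> 2 ^ n"
          by (metis Suc_leI of_nat_le_iff of_nat_numeral of_nat_power)
        then have "real j / 2 ^ n \<le> 1" "real (Suc j) / 2 ^ n \<le> 1"
          by (auto simp: divide_le_eq_1 simp del: of_nat_le_numeral_power_cancel_iff)
        moreover have "real (Suc j) / 2 ^ n - real j / 2 ^ n = 1 / 2 ^ n"
          by (simp add: field_simps)
        ultimately show "\<bar>walk B n \<omega> (Suc j) - walk B n \<omega> j\<bar> < e"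
          unfolding walk_def using n by (intro d(2)) auto
      qed
    qed (auto simp: lessThan_empty_iff)
    then show "norm (max_step (walk B n \<omega>) (2 ^ n) - 0) < e"
      using max_step_nonneg[of "2 ^ n" "walk B n \<omega>"] by simp
  qed
qed

text \<open>For each truncation of the series the mesh error vanishes, by continuity of the paths
  and dominated convergence.\<close>

lemma survive_series_Lipschitz:
  fixes f :: "real \<Rightarrow> real"
  assumes \<beta>: "0 < \<beta>" "\<beta> < 1" and z: "0 < z" and L: "0 \<le> L"
    and f: "\<And>x. 0 \<le> f x" "\<And>x. f x \<le> 1" "\<And>x y. \<bar>f x - f y\<bar> \<le> L * \<bar>x - y\<bar>"
      "\<And>x. f (- x) = f x" "\<And>x. z \<le> \<bar>x\<bar> \<Longrightarrow> f x = 0"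
  shows "(\<lambda>n. \<integral>\<omega>. (1 - survive \<beta> z (walk B n \<omega>) (Suc (2 ^ n))) * f (B 1 \<omega>) \<partial>M) \<longlonglongrightarrow>
     2 * \<beta> * (\<Sum>m. (1 - 2 * \<beta>) ^ m * (\<integral>\<omega>. f (B 1 \<omega> - 2 * real (Suc m) * z) \<partial>M))"
proof -
  let ?p = "1 - 2 * \<beta>"
  define c where "c m = (\<integral>\<omega>. f (B 1 \<omega> - 2 * real (Suc m) * z) \<partial>M)" for m
  define e where "e n = (\<integral>\<omega>. min 1 (L * (2 * max_step (walk B n \<omega>) (2 ^ n))) \<partial>M)" for n
  have test: "reflected_test_function (path_law n) \<beta> z L (2 ^ n) f" for n
    by (intro reflected_test_function.intro reflection_invariant_path_law
        reflected_test_function_axioms.intro) (use assms in auto)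
  have [measurable]: "f \<in> borel_measurable borel"
    using reflected_test_function.measurable_f[OF test] .
  have p: "\<bar>?p\<bar> < 1" using \<beta> by auto
  show ?thesis unfolding c_def[symmetric]
  proof (rule LIMSEQ_from_truncated_bounds)
    show "\<bar>(\<integral>\<omega>. (1 - survive \<beta> z (walk B n \<omega>) (Suc (2 ^ n))) * f (B 1 \<omega>) \<partial>M) -
        2 * \<beta> * (\<Sum>m<k. ?p ^ m * c m)\<bar> \<le> \<bar>?p\<bar> ^ k + (3 * real k + 1) * e n" for n k
    proof -
      interpret W: reflected_test_function "path_law n" \<beta> z L "2 ^ n" f by (rule test)
      show ?thesis using W.survive_series_approx[of k]
        by (simp add: integral_path_law W.err_def walk_end c_def e_def)
    qed
    show "e \<longlonglongrightarrow> 0"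
    proof -
      have "e \<longlonglongrightarrow> (\<integral>\<omega>. 0 \<partial>M)"
        unfolding e_def
      proof (rule integral_dominated_convergence[where w = "\<lambda>_. 1"])
        show "AE \<omega> in M. (\<lambda>n. min 1 (L * (2 * max_step (walk B n \<omega>) (2 ^ n)))) \<longlonglongrightarrow> 0"
        proof (intro AE_I2)
          fix \<omega> assume "\<omega> \<in> space M"
          then have "(\<lambda>n. min 1 (L * (2 * max_step (walk B n \<omega>) (2 ^ n)))) \<longlonglongrightarrow> min 1 (L * (2 * 0))"
            by (intro tendsto_intros max_step_walk_tendsto_0)
          then show "(\<lambda>n. min 1 (L * (2 * max_step (walk B n \<omega>) (2 ^ n)))) \<longlonglongrightarrow> 0" by simp
        qed
        show "AE \<omega> in M. norm (min 1 (L * (2 * max_step (walk B n \<omega>) (2 ^ n)))) \<le> 1" for n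
          using L max_step_nonneg[of "2 ^ n"] by (intro AE_I2) auto
      qed auto
      then show ?thesis by simp
    qed
    show "(\<lambda>k. \<bar>?p\<bar> ^ k) \<longlonglongrightarrow> 0" using p by (intro LIMSEQ_power_zero) auto
    have c: "\<bar>c m\<bar> \<le> 1" for m
      unfolding c_def by (rule abs_expectation_le_1) (auto simp: f(1,2))
    have "summable (\<lambda>m. ?p ^ m * c m)"
    proof (rule summable_comparison_test')
      show "summable (\<lambda>m. \<bar>?p\<bar> ^ m)" using p by (intro summable_geometric) auto
      show "norm (?p ^ m * c m) \<le> \<bar>?p\<bar> ^ m" for m
        using c[of m] by (simp add: abs_mult power_abs mult_left_le)
    qed
    then show "(\<lambda>k. 2 * \<beta> * (\<Sum>m<k. ?p ^ m * c m)) \<longlonglongrightarrow> 2 * \<beta> * (\<Sum>m. ?p ^ m * c m)"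
      by (intro tendsto_intros summable_LIMSEQ)
  qed
qed

text \<open>Lipschitz functions of slope \<open>j\<close> exhaust the window from inside;
  \<open>\<epsilon> \<le> z\<close> puts their support where the reflection argument allows
  it.\<close>

lemma survive_series_window:
  assumes \<beta>: "0 < \<beta>" "\<beta> < 1" and \<epsilon>: "0 < \<epsilon>" "\<epsilon> \<le> z"
  shows "(\<lambda>n. \<integral>\<omega>. (1 - survive \<beta> z (walk B n \<omega>) (Suc (2 ^ n))) * of_bool (\<bar>B 1 \<omega>\<bar> < \<epsilon>) \<partial>M) \<longlonglongrightarrow>
     2 * \<beta> * (\<Sum>m. (1 - 2 * \<beta>) ^ m * prob {\<omega> \<in> space M. \<bar>B 1 \<omega> - 2 * real (Suc m) * z\<bar> < \<epsilon>})"
proof -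
  let ?p = "1 - 2 * \<beta>" and ?s = "\<lambda>n \<omega>. survive \<beta> z (walk B n \<omega>) (Suc (2 ^ n))"
  define f where "f j x = max 0 (min 1 (real j * (\<epsilon> - \<bar>x\<bar>)))" for j x
  have f01: "0 \<le> f j x" "f j x \<le> 1" for j x by (auto simp: f_def)
  have f_le: "f j x \<le> of_bool (\<bar>x\<bar> < \<epsilon>)" for j x
    using mult_nonneg_nonpos[of "real j" "\<epsilon> - \<bar>x\<bar>"] by (auto simp: f_def)
  have [measurable]: "f j \<in> borel_measurable borel" for j unfolding f_def by measurable
  have lim: "(\<lambda>j. f j x) \<longlonglongrightarrow> of_bool (\<bar>x\<bar> < \<epsilon>)" for x
  proof (cases "\<bar>x\<bar> < \<epsilon>")
    case True
    obtain N where "1 < real N * (\<epsilon> - \<bar>x\<bar>)" using reals_Archimedean3[of "\<epsilon> - \<bar>x\<bar>"] True by auto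
    moreover have "real N * (\<epsilon> - \<bar>x\<bar>) \<le> real j * (\<epsilon> - \<bar>x\<bar>)" if "N \<le> j" for j
      using that True by (intro mult_right_mono) auto
    ultimately have "f j x = 1" if "N \<le> j" for j using that by (force simp: f_def)
    then show ?thesis using True by (intro tendsto_eventually) (auto simp: eventually_sequentially)
  next
    case False
    then have "real j * (\<epsilon> - \<bar>x\<bar>) \<le> 0" for j by (intro mult_nonneg_nonpos) auto
    then have "f j x = 0" for j unfolding f_def by (smt (verit))
    then show ?thesis using False by simp
  qed
  define c where "c j m = (\<integral>\<omega>. f j (B 1 \<omega> - 2 * real (Suc m) * z) \<partial>M)" for j m
  define c' where "c' m = prob {\<omega> \<in> space M. \<bar>B 1 \<omega> - 2 * real (Suc m) * z\<bar> < \<epsilon>}" for m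
  define S where "S j = 2 * \<beta> * (\<Sum>m. ?p ^ m * c j m)" for j
  define r where "r j = prob {\<omega> \<in> space M. \<bar>B 1 \<omega>\<bar> < \<epsilon>} - (\<integral>\<omega>. f j (B 1 \<omega>) \<partial>M)" for j
  define x where "x n = (\<integral>\<omega>. (1 - ?s n \<omega>) * of_bool (\<bar>B 1 \<omega>\<bar> < \<epsilon>) \<partial>M)" for n
  define y where "y j n = (\<integral>\<omega>. (1 - ?s n \<omega>) * f j (B 1 \<omega>) \<partial>M)" for j n
  have prob_eq: "prob {\<omega> \<in> space M. \<bar>B 1 \<omega> - a\<bar> < \<epsilon>} = (\<integral>\<omega>. of_bool (\<bar>B 1 \<omega> - a\<bar> < \<epsilon>) \<partial>M)" for a
  proof -
    have "prob {\<omega> \<in> space M. \<bar>B 1 \<omega> - a\<bar> < \<epsilon>} = (\<integral>\<omega>. indicator {\<omega> \<in> space M. \<bar>B 1 \<omega> - a\<bar> < \<epsilon>} \<omega> \<partial>M)"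
      by simp
    also have "\<dots> = (\<integral>\<omega>. of_bool (\<bar>B 1 \<omega> - a\<bar> < \<epsilon>) \<partial>M)"
      by (rule Bochner_Integration.integral_cong) (auto simp: indicator_def)
    finally show ?thesis .
  qed
  have f_int_lim: "(\<lambda>j. \<integral>\<omega>. f j (B 1 \<omega> - a) \<partial>M) \<longlonglongrightarrow> prob {\<omega> \<in> space M. \<bar>B 1 \<omega> - a\<bar> < \<epsilon>}" for a
    unfolding prob_eq
    by (rule integral_dominated_convergence[where w = "\<lambda>_. 1"]) (auto simp: lim f01)
  have yS: "(\<lambda>n. y j n) \<longlonglongrightarrow> S j" for j
    unfolding y_def S_def c_def
  proof (rule survive_series_Lipschitz[where L = "real j"])
    show "\<bar>f j x - f j y\<bar> \<le> real j * \<bar>x - y\<bar>" for x y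
    proof -
      have "\<bar>f j x - f j y\<bar> \<le> \<bar>real j * (\<epsilon> - \<bar>x\<bar>) - real j * (\<epsilon> - \<bar>y\<bar>)\<bar>"
        unfolding f_def by (auto simp: max_def min_def)
      also have "\<dots> = real j * \<bar>\<bar>x\<bar> - \<bar>y\<bar>\<bar>"
        by (simp add: abs_mult abs_minus_commute flip: right_diff_distrib)
      also have "\<dots> \<le> real j * \<bar>x - y\<bar>" by (intro mult_left_mono) auto
      finally show ?thesis .
    qed
    show "f j x = 0" if "z \<le> \<bar>x\<bar>" for x
      using that \<epsilon> f01(1)[of j x] f_le[of j x] by (auto simp: of_bool_def split: if_splits)
  qed (use assms f01 in \<open>auto simp: f_def\<close>)
  \<comment> \<open>The survival weight lies between 0 and 1, so replacing the window by
    \<open>f j\<close> costs at most \<open>r j\<close>, uniformly in \<open>n\<close>. This permits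
    exchanging the limits in \<open>n\<close> and \<open>j\<close>.\<close>
  have xy: "\<bar>x n - y j n\<bar> \<le> r j" for n j
  proof -
    have [measurable]: "?s n \<in> borel_measurable M" by measurable
    have s: "0 \<le> ?s n \<omega>" "?s n \<omega> \<le> 1" for \<omega> using survive_bounds \<beta> by auto
    have int: "integrable M (\<lambda>\<omega>. (1 - ?s n \<omega>) * of_bool (\<bar>B 1 \<omega>\<bar> < \<epsilon>))"
      "integrable M (\<lambda>\<omega>. (1 - ?s n \<omega>) * f j (B 1 \<omega>))" "integrable M (\<lambda>\<omega>. f j (B 1 \<omega>))"
      "integrable M (\<lambda>\<omega>. of_bool (\<bar>B 1 \<omega>\<bar> < \<epsilon>) :: real)"
      by (rule integrable_abs_le_1; use s f01 in \<open>auto intro!: mult_le_one simp: abs_mult\<close>)+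
    have "x n - y j n = (\<integral>\<omega>. (1 - ?s n \<omega>) * (of_bool (\<bar>B 1 \<omega>\<bar> < \<epsilon>) - f j (B 1 \<omega>)) \<partial>M)"
      unfolding x_def y_def using int by (simp add: right_diff_distrib)
    also have "\<bar>\<dots>\<bar> \<le> (\<integral>\<omega>. of_bool (\<bar>B 1 \<omega>\<bar> < \<epsilon>) - f j (B 1 \<omega>) \<partial>M)"
    proof (rule order_trans[OF integral_abs_bound integral_mono])
      show "\<bar>(1 - ?s n \<omega>) * (of_bool (\<bar>B 1 \<omega>\<bar> < \<epsilon>) - f j (B 1 \<omega>))\<bar> \<le> of_bool (\<bar>B 1 \<omega>\<bar> < \<epsilon>) - f j (B 1 \<omega>)" for \<omega>
        using s[of \<omega>] f_le[of j "B 1 \<omega>"] by (simp add: abs_mult mult_left_le_one_le)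
      show "integrable M (\<lambda>\<omega>. \<bar>(1 - ?s n \<omega>) * (of_bool (\<bar>B 1 \<omega>\<bar> < \<epsilon>) - f j (B 1 \<omega>))\<bar>)"
        using int(1,2) by (intro integrable_abs) (simp add: right_diff_distrib)
    qed (use int in auto)
    also have "\<dots> = r j"
      unfolding r_def using int prob_eq[of 0] by simp
    finally show ?thesis .
  qed
  have p: "\<bar>?p\<bar> < 1" using \<beta> by auto
  have S_lim: "S \<longlonglongrightarrow> 2 * \<beta> * (\<Sum>m. ?p ^ m * c' m)"
    unfolding S_def
  proof (rule tendsto_mult_left, rule tendsto_suminf_dominated)
    show "(\<lambda>j. ?p ^ m * c j m) \<longlonglongrightarrow> ?p ^ m * c' m" for m
      unfolding c_def c'_def by (rule tendsto_mult_left, rule f_int_lim)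
    have "\<bar>c j m\<bar> \<le> 1" for j m
      unfolding c_def by (rule abs_expectation_le_1) (auto simp: f01)
    then show "\<forall>\<^sub>F j in sequentially. \<forall>m. \<bar>?p ^ m * c j m\<bar> \<le> \<bar>?p\<bar> ^ m"
      by (simp add: abs_mult power_abs mult_left_le)
    show "summable (\<lambda>m. \<bar>?p\<bar> ^ m)" using p by (intro summable_geometric) auto
  qed auto
  have r_lim: "r \<longlonglongrightarrow> 0"
    unfolding r_def
    using tendsto_diff[OF tendsto_const[of "prob {\<omega> \<in> space M. \<bar>B 1 \<omega>\<bar> < \<epsilon>}"] f_int_lim[of 0]] by simp
  show ?thesis unfolding x_def[symmetric] c'_def[symmetric]
  proof (rule LIMSEQ_I)
    fix d :: real assume d: "0 < d"
    have "\<forall>\<^sub>F j in sequentially. r j < d / 3" using r_lim d by (auto dest!: order_tendstoD(2)[where a = "d / 3"])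
    moreover have "\<forall>\<^sub>F j in sequentially. dist (S j) (2 * \<beta> * (\<Sum>m. ?p ^ m * c' m)) < d / 3"
      using S_lim d by (auto dest: tendstoD[where e = "d / 3"])
    ultimately have "\<forall>\<^sub>F j in sequentially. r j < d / 3 \<and> dist (S j) (2 * \<beta> * (\<Sum>m. ?p ^ m * c' m)) < d / 3"
      by eventually_elim simp
    then obtain j where j: "r j < d / 3" "dist (S j) (2 * \<beta> * (\<Sum>m. ?p ^ m * c' m)) < d / 3"
      by (auto dest: eventually_happens)
    have "\<forall>\<^sub>F n in sequentially. dist (y j n) (S j) < d / 3"
      using yS[of j] d by (auto dest: tendstoD[where e = "d / 3"])
    then have "\<forall>\<^sub>F n in sequentially. norm (x n - 2 * \<beta> * (\<Sum>m. ?p ^ m * c' m)) < d"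
    proof eventually_elim
      case (elim n)
      then show ?case using j xy[of n j] unfolding dist_real_def real_norm_def by linarith
    qed
    then show "\<exists>N. \<forall>n\<ge>N. norm (x n - 2 * \<beta> * (\<Sum>m. ?p ^ m * c' m)) < d"
      by (simp add: eventually_sequentially)
  qed
qed

end

section \<open>Excursions and their labels\<close>

text \<open>Connected subsets of the line are intervals, so membership becomes a condition on the
  segment between the two times.\<close>

lemma mem_excursion_interval_iff:
  "u \<in> excursion_interval r t \<longleftrightarrow> 0 \<le> t \<and> 0 \<le> u \<and> (\<forall>v\<in>closed_segment t u. r v \<noteq> 0)"
proof
  assume "u \<in> excursion_interval r t"
  then obtain C where C: "connected C" "C \<subseteq> {u. 0 \<le> u \<and> r u \<noteq> 0}" "t \<in> C" "u \<in> C"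
    by (auto simp: excursion_interval_def connected_component_def)
  then have "closed_segment t u \<subseteq> C"
    using connectedD_interval[OF C(1,3,4)] connectedD_interval[OF C(1,4,3)]
    by (auto simp: closed_segment_eq_real_ivl split: if_splits)
  then show "0 \<le> t \<and> 0 \<le> u \<and> (\<forall>v\<in>closed_segment t u. r v \<noteq> 0)" using C by auto
next
  assume *: "0 \<le> t \<and> 0 \<le> u \<and> (\<forall>v\<in>closed_segment t u. r v \<noteq> 0)"
  show "u \<in> excursion_interval r t"
    unfolding excursion_interval_def connected_component_def mem_Collect_eq
    by (rule exI[of _ "closed_segment t u"])
      (use * in \<open>auto simp: closed_segment_eq_real_ivl split: if_splits\<close>)
qed

lemma nonzero_near:
  fixes r :: "real \<Rightarrow> real"
  assumes "continuous_on {0..} r" "0 \<le> t" "r t \<noteq> 0"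
  obtains d where "0 < d" "\<And>u. 0 \<le> u \<Longrightarrow> \<bar>u - t\<bar> < d \<Longrightarrow> r u \<noteq> 0"
proof -
  obtain d where "0 < d" "\<And>u. u \<in> {0..} \<Longrightarrow> dist u t < d \<Longrightarrow> dist (r u) (r t) < \<bar>r t\<bar>"
    using assms unfolding continuous_on_iff by (metis atLeast_iff zero_less_abs_iff)
  then show ?thesis by (intro that[of d]) (force simp: dist_real_def)+
qed

lemma ex_excursion_label:
  assumes "continuous_on {0..} r" "0 \<le> t" "r t \<noteq> 0"
  shows "\<exists>n. real_of_rat (from_nat n) \<in> excursion_interval r t"
proof -
  obtain d where d: "0 < d" "\<And>u. 0 \<le> u \<Longrightarrow> \<bar>u - t\<bar> < d \<Longrightarrow> r u \<noteq> 0"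
    using nonzero_near[OF assms] by blast
  obtain q where q: "t < real_of_rat q" "real_of_rat q < t + d"
    using of_rat_dense[of t "t + d"] d(1) by auto
  have "real_of_rat q \<in> excursion_interval r t"
    unfolding mem_excursion_interval_iff closed_segment_eq_real_ivl
    using assms q d(2) by (auto simp del: zero_le_of_rat_iff of_rat_less_0_iff)
  moreover obtain n where "q = from_nat n" using surj_from_nat by (metis surjD)
  ultimately show ?thesis by blast
qed

lemma excursion_index_mem:
  assumes "continuous_on {0..} r" "0 \<le> t" "r t \<noteq> 0"
  shows "real_of_rat (from_nat (excursion_index r t)) \<in> excursion_interval r t"
  unfolding excursion_index_def by (rule LeastI_ex) (rule ex_excursion_label[OF assms])

text \<open>A common label is a rational lying in both excursion intervals, and the segments from it
  to \<open>s\<close> and to \<open>t\<close> cover everything between these times.\<close>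

lemma excursion_index_eq_iff:
  assumes r: "continuous_on {0..} r" and "0 \<le> s" "s \<le> t" "r s \<noteq> 0" "r t \<noteq> 0"
  shows "excursion_index r s = excursion_index r t \<longleftrightarrow> (\<forall>v\<in>{s..t}. r v \<noteq> 0)"
proof
  assume eq: "excursion_index r s = excursion_index r t"
  define q where "q = real_of_rat (from_nat (excursion_index r s))"
  have "q \<in> excursion_interval r s" "q \<in> excursion_interval r t"
    using excursion_index_mem[OF r] assms eq unfolding q_def by (metis, metis order_trans)
  then show "\<forall>v\<in>{s..t}. r v \<noteq> 0"
    using assms unfolding mem_excursion_interval_iff closed_segment_eq_real_ivl
    by (auto split: if_splits)
next
  assume *: "\<forall>v\<in>{s..t}. r v \<noteq> 0"
  then have "t \<in> excursion_interval r s"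
    using assms by (auto simp: mem_excursion_interval_iff closed_segment_eq_real_ivl)
  then have "excursion_interval r s = excursion_interval r t"
    unfolding excursion_interval_def by (metis connected_component_eq)
  then show "excursion_index r s = excursion_index r t" by (simp add: excursion_index_def)
qed

lemma excursion_index_near:
  assumes r: "continuous_on {0..} r" and "0 \<le> t" "r t \<noteq> 0"
  obtains d where "0 < d" "\<And>u. 0 \<le> u \<Longrightarrow> \<bar>u - t\<bar> < d \<Longrightarrow> excursion_index r u = excursion_index r t"
proof -
  obtain d where d: "0 < d" "\<And>u. 0 \<le> u \<Longrightarrow> \<bar>u - t\<bar> < d \<Longrightarrow> r u \<noteq> 0"
    using nonzero_near[OF assms] by blast
  have "excursion_index r u = excursion_index r t" if u: "0 \<le> u" "\<bar>u - t\<bar> < d" for u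
  proof (cases "u \<le> t")
    case True
    then show ?thesis using u assms d(2) by (subst excursion_index_eq_iff[OF r]) auto
  next
    case False
    then have "excursion_index r t = excursion_index r u"
      using u assms d(2) by (subst excursion_index_eq_iff[OF r]) auto
    then show ?thesis by simp
  qed
  with d(1) show ?thesis using that by blast
qed

text \<open>Away from zeros the label, and with it the sign, is locally constant; at a zero the sign
  does not affect the distance to 0.\<close>

lemma continuous_on_signed_excursions:
  fixes S :: "nat \<Rightarrow> bool" and r :: "real \<Rightarrow> real"
  assumes r: "continuous_on {0..} r"
  shows "continuous_on {0..} (\<lambda>t. if S (excursion_index r t) then r t else - r t)" (is "continuous_on _ ?x")
  unfolding continuous_on_iff
proof (intro ballI allI impI)
  fix t e :: real assume t: "t \<in> {0..}" and e: "0 < e"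
  obtain d where d: "0 < d" "\<And>u. u \<in> {0..} \<Longrightarrow> dist u t < d \<Longrightarrow> dist (r u) (r t) < e"
    using r t e unfolding continuous_on_iff by metis
  show "\<exists>d>0. \<forall>u\<in>{0..}. dist u t < d \<longrightarrow> dist (?x u) (?x t) < e"
  proof (cases "r t = 0")
    case True
    then show ?thesis using d by (intro exI[of _ d]) (auto simp: dist_real_def)
  next
    case False
    obtain d' where d': "0 < d'" "\<And>u. 0 \<le> u \<Longrightarrow> \<bar>u - t\<bar> < d' \<Longrightarrow> excursion_index r u = excursion_index r t"
      using excursion_index_near[OF r _ False] t by auto
    have "dist (?x u) (?x t) < e" if "u \<in> {0..}" "dist u t < min d d'" for u
    proof -
      have "excursion_index r u = excursion_index r t" using that d'(2)[of u] by (simp add: dist_real_def)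
      then show ?thesis using d(2)[OF that(1)] that by (auto simp: dist_real_def abs_minus_commute)
    qed
    then show ?thesis using d d' by (intro exI[of _ "min d d'"]) auto
  qed
qed

text \<open>These are the excursions that the grid observes at height \<open>z\<close>, each counted
  once however many grid points it contains.\<close>

definition high_labels :: "real \<Rightarrow> (real \<Rightarrow> real) \<Rightarrow> nat \<Rightarrow> nat set" where
  "high_labels z r n = (\<lambda>j. excursion_index r (real j / 2 ^ n)) ` {j. j \<le> 2 ^ n \<and> z \<le> r (real j / 2 ^ n)}"

text \<open>Under the hypothesis \<open>runs\<close>, the first grid index with a given high label
  is fresh, and distinct fresh indices carry distinct labels. Each high label therefore accounts for
  exactly one factor \<open>1 - \<beta>\<close>.\<close>

lemma survive_eq_power_card:
  assumes r: "continuous_on {0..} r" and z: "0 < z"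
    and w: "\<And>j. \<bar>w j\<bar> = r (real j / 2 ^ n)"
    and runs: "\<And>j k. j < k \<Longrightarrow> k \<le> 2 ^ n \<Longrightarrow> z \<le> \<bar>w j\<bar> \<Longrightarrow> z \<le> \<bar>w k\<bar> \<Longrightarrow>
        same_side w j k \<longleftrightarrow> (\<forall>v\<in>{real j / 2 ^ n..real k / 2 ^ n}. r v \<noteq> 0)"
  shows "survive \<beta> z w (Suc (2 ^ n)) = (1 - \<beta>) ^ card (high_labels z r n)"
proof -
  let ?l = "\<lambda>j. excursion_index r (real j / 2 ^ n)"
  let ?F = "{j. j \<le> 2 ^ n \<and> fresh z w j}"
  have label: "?l j = ?l k \<longleftrightarrow> same_side w j k"
    if "j < k" "k \<le> 2 ^ n" "z \<le> \<bar>w j\<bar>" "z \<le> \<bar>w k\<bar>" for j k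
  proof -
    have "real j / 2 ^ n \<le> real k / 2 ^ n" using that by (simp add: divide_right_mono)
    then show ?thesis using that runs[OF that] z w[of j] w[of k]
      by (subst excursion_index_eq_iff[OF r]) auto
  qed
  have "inj_on ?l ?F"
  proof (rule linorder_inj_onI)
    fix j k assume "j < k" "j \<in> ?F" "k \<in> ?F"
    then show "?l j \<noteq> ?l k" using label[of j k] by (auto simp: fresh_def)
  qed auto
  moreover have "?l ` ?F = high_labels z r n"
  proof
    show "?l ` ?F \<subseteq> high_labels z r n" using w by (auto simp: high_labels_def fresh_def)
    show "high_labels z r n \<subseteq> ?l ` ?F"
    proof
      fix a assume "a \<in> high_labels z r n"
      then obtain j where j: "j \<le> 2 ^ n" "z \<le> \<bar>w j\<bar>" "a = ?l j" using w by (auto simp: high_labels_def)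
      define P where "P i \<longleftrightarrow> z \<le> \<bar>w i\<bar> \<and> ?l i = a" for i
      define m where "m = (LEAST i. P i)"
      have "P j" using j by (simp add: P_def)
      then have m: "P m" "m \<le> j" unfolding m_def by (rule LeastI, rule Least_le)
      have "fresh z w m"
        unfolding fresh_def
      proof (intro conjI allI impI notI)
        show "z \<le> \<bar>w m\<bar>" using m by (simp add: P_def)
        fix i assume i: "i < m" "z \<le> \<bar>w i\<bar>" "same_side w i m"
        then have "P i" using label[of i m] m j by (simp add: P_def)
        then show False using i not_less_Least unfolding m_def by blast
      qed
      then show "a \<in> ?l ` ?F" using m j by (intro image_eqI[of _ _ m]) (auto simp: P_def)
    qed
  qed
  ultimately have card: "card (high_labels z r n) = card ?F" using card_image by metis
  have "survive \<beta> z w (Suc (2 ^ n)) = (\<Prod>i\<in>?F. 1 - \<beta>)"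
    unfolding survive_def by (rule prod.mono_neutral_cong_right) (auto simp: less_Suc_eq_le)
  then show ?thesis by (simp add: card)
qed


section \<open>Zeros of Brownian motion and sign changes on the grid\<close>

lemma (in prob_space) emeasure_sum_small:
  fixes U V :: "'a \<Rightarrow> real"
  assumes ind: "indep_var borel U borel V" and U: "distributed M lborel U (\<lambda>x. ennreal (f x))"
    and f: "\<And>x. f x \<le> C" and \<delta>: "0 \<le> \<delta>" and C: "0 \<le> C"
  shows "emeasure M {\<omega> \<in> space M. \<bar>U \<omega> + V \<omega>\<bar> \<le> \<delta>} \<le> ennreal (2 * C * \<delta>)"
proof -
  have [measurable]: "U \<in> borel_measurable M" "V \<in> borel_measurable M"
    using indep_var_rv1[OF ind] indep_var_rv2[OF ind] by auto
  interpret DU: prob_space "distr M borel U" by (rule prob_space_distr) measurable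
  interpret DV: prob_space "distr M borel V" by (rule prob_space_distr) measurable
  interpret P: pair_sigma_finite "distr M borel U" "distr M borel V" ..
  let ?A = "{x :: real \<times> real. \<bar>fst x + snd x\<bar> \<le> \<delta>}"
  have A [measurable]: "?A \<in> sets (borel \<Otimes>\<^sub>M borel)"
  proof -
    have "{x \<in> space (borel \<Otimes>\<^sub>M borel). \<bar>fst x + snd x\<bar> \<le> \<delta>} \<in> sets (borel \<Otimes>\<^sub>M borel)" by measurable
    then show ?thesis by (simp add: space_pair_measure)
  qed
  have "emeasure M {\<omega> \<in> space M. \<bar>U \<omega> + V \<omega>\<bar> \<le> \<delta>} =
      emeasure (distr M (borel \<Otimes>\<^sub>M borel) (\<lambda>\<omega>. (U \<omega>, V \<omega>))) ?A"
    by (subst emeasure_distr) (auto intro!: arg_cong[where f = "emeasure M"])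
  also have "\<dots> = emeasure (distr M borel U \<Otimes>\<^sub>M distr M borel V) ?A"
    using ind by (simp add: indep_var_distribution_eq)
  also have "\<dots> = (\<integral>\<^sup>+ y. emeasure (distr M borel U) ((\<lambda>x. (x, y)) -` ?A) \<partial>distr M borel V)"
    by (rule P.emeasure_pair_measure_alt2) simp
  also have "\<dots> \<le> (\<integral>\<^sup>+ y. ennreal (2 * C * \<delta>) \<partial>distr M borel V)"
  proof (rule nn_integral_mono)
    fix y
    \<comment> \<open>For a fixed value \<open>y\<close> of \<open>V\<close>, the variable
      \<open>U\<close> is confined to an interval of length \<open>2 * \<delta>\<close>.\<close>
    have eq: "(\<lambda>x. (x, y)) -` ?A = {- y - \<delta>..- y + \<delta>}" by auto
    have "emeasure (distr M borel U) {- y - \<delta>..- y + \<delta>} = emeasure M (U -` {- y - \<delta>..- y + \<delta>} \<inter> space M)"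
      by (rule emeasure_distr) auto
    also have "\<dots> = (\<integral>\<^sup>+ x. ennreal (f x) * indicator {- y - \<delta>..- y + \<delta>} x \<partial>lborel)"
      by (rule distributed_emeasure[OF U]) simp
    also have "\<dots> \<le> (\<integral>\<^sup>+ x. ennreal C * indicator {- y - \<delta>..- y + \<delta>} x \<partial>lborel)"
      by (intro nn_integral_mono mult_right_mono ennreal_leI f) auto
    also have "\<dots> = ennreal (2 * C * \<delta>)"
      using \<delta> C by (subst nn_integral_cmult_indicator) (auto simp: ennreal_mult'[symmetric] mult_ac)
    finally show "emeasure (distr M borel U) ((\<lambda>x. (x, y)) -` ?A) \<le> ennreal (2 * C * \<delta>)"
      unfolding eq .
  qed
  also have "\<dots> = ennreal (2 * C * \<delta>)" using DV.emeasure_space_1 by simp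
  finally show ?thesis .
qed

lemma normal_density_le: "0 < \<sigma> \<Longrightarrow> normal_density \<mu> \<sigma> x \<le> 1 / sqrt (2 * pi * \<sigma>\<^sup>2)"
  by (simp add: normal_density_def divide_right_mono)

context brownian_motion
begin

lemma emeasure_walk_min_small:
  assumes "0 < k" "k < j" "0 \<le> \<delta>" and s: "\<bar>s\<bar> = 1"
  shows "emeasure M {\<omega> \<in> space M. \<bar>Min ((\<lambda>i. s * walk B n \<omega> i) ` {k..j})\<bar> \<le> \<delta>}
     \<le> ennreal (2 * (1 / sqrt (2 * pi * (sqrt (real k / 2 ^ n))\<^sup>2)) * \<delta>)"
proof -
  \<comment> \<open>The outer factor \<open>s\<close> makes \<open>s\<close> times the minimum equal
    to \<open>V\<close> plus the unsigned value at \<open>k\<close>, whose density is known and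
    which is independent of the later increments.\<close>
  define V where "V x = s * Min ((\<lambda>i. s * (\<Sum>l=k..<i. x l)) ` {k..j})" for x :: "nat \<Rightarrow> real"
  define U where "U x = (\<Sum>l<k. x l)" for x :: "nat \<Rightarrow> real"
  have comp [measurable]: "(\<lambda>x. x l) \<in> borel_measurable (PiM A (\<lambda>_. borel))" if "l \<in> A" for l :: nat and A
    using that by (rule measurable_component_singleton)
  have "indep_var (PiM {..<k} (\<lambda>_. borel)) (\<lambda>\<omega>. restrict (\<lambda>i. walk_step B n i \<omega>) {..<k})
      (PiM {k..} (\<lambda>_. borel)) (\<lambda>\<omega>. restrict (\<lambda>i. walk_step B n i \<omega>) {k..})"
    by (rule indep_var_restrict[OF indep_vars_walk_step]) auto
  then have "indep_var borel (U \<circ> (\<lambda>\<omega>. restrict (\<lambda>i. walk_step B n i \<omega>) {..<k}))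
      borel (V \<circ> (\<lambda>\<omega>. restrict (\<lambda>i. walk_step B n i \<omega>) {k..}))"
  proof (rule indep_var_compose)
    show "U \<in> borel_measurable (PiM {..<k} (\<lambda>_. borel))"
      unfolding U_def by (intro borel_measurable_sum comp) auto
    show "V \<in> borel_measurable (PiM {k..} (\<lambda>_. borel))"
      unfolding V_def
      by (intro borel_measurable_times borel_measurable_const borel_measurable_Max borel_measurable_Min
          borel_measurable_sum comp) auto
  qed
  moreover have "U \<circ> (\<lambda>\<omega>. restrict (\<lambda>i. walk_step B n i \<omega>) {..<k}) = (\<lambda>\<omega>. \<Sum>l<k. walk_step B n l \<omega>)"
    by (auto simp: U_def fun_eq_iff)
  moreover have "V \<circ> (\<lambda>\<omega>. restrict (\<lambda>i. walk_step B n i \<omega>) {k..}) = (\<lambda>\<omega>. V (\<lambda>i. walk_step B n i \<omega>))"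
    by (auto simp: V_def fun_eq_iff intro!: arg_cong[where f = Min] image_cong sum.cong)
  ultimately have ind: "indep_var borel (\<lambda>\<omega>. \<Sum>l<k. walk_step B n l \<omega>) borel (\<lambda>\<omega>. V (\<lambda>i. walk_step B n i \<omega>))"
    by simp
  have kn: "0 < real k / 2 ^ n" using assms by simp
  have "distributed M lborel (B (real k / 2 ^ n)) (normal_density 0 (sqrt (real k / 2 ^ n)))"
    by (rule distributed_B[OF kn])
  moreover have "distr M lborel (B (real k / 2 ^ n)) = distr M lborel (\<lambda>\<omega>. \<Sum>l<k. walk_step B n l \<omega>)"
    by (rule distr_cong) (auto simp: walk_eq_sum[symmetric] walk_def)
  ultimately have dens: "distributed M lborel (\<lambda>\<omega>. \<Sum>l<k. walk_step B n l \<omega>)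
      (normal_density 0 (sqrt (real k / 2 ^ n)))"
    by (simp add: distributed_def)
  have sum_eq: "(\<Sum>l<k. walk_step B n l \<omega>) + V (\<lambda>i. walk_step B n i \<omega>) =
      s * Min ((\<lambda>i. s * walk B n \<omega> i) ` {k..j})" if "\<omega> \<in> space M" for \<omega>
  proof -
    have ss: "s * s = 1" using s by (auto simp: abs_if split: if_splits)
    have shift: "s * walk B n \<omega> i = s * walk B n \<omega> k + s * (\<Sum>l=k..<i. walk_step B n l \<omega>)" if "i \<in> {k..j}" for i
    proof -
      have "(\<Sum>l<i. walk_step B n l \<omega>) = (\<Sum>l<k. walk_step B n l \<omega>) + (\<Sum>l=k..<i. walk_step B n l \<omega>)"
        using that by (subst sum.union_disjoint[symmetric]) (auto intro!: sum.cong)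
      then show ?thesis using \<open>\<omega> \<in> space M\<close> by (simp add: walk_eq_sum distrib_left)
    qed
    have "(\<lambda>i. s * walk B n \<omega> i) ` {k..j} =
        (\<lambda>x. s * walk B n \<omega> k + x) ` (\<lambda>i. s * (\<Sum>l=k..<i. walk_step B n l \<omega>)) ` {k..j}"
      unfolding image_image by (rule image_cong[OF refl shift])
    also have "Min \<dots> = s * walk B n \<omega> k + Min ((\<lambda>i. s * (\<Sum>l=k..<i. walk_step B n l \<omega>)) ` {k..j})"
      using assms by (intro mono_Min_commute[symmetric]) (auto simp: mono_def)
    finally show ?thesis
      using ss that by (simp add: V_def distrib_left mult.assoc[symmetric] walk_eq_sum)
  qed
  have "emeasure M {\<omega> \<in> space M. \<bar>(\<Sum>l<k. walk_step B n l \<omega>) + V (\<lambda>i. walk_step B n i \<omega>)\<bar> \<le> \<delta>}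
     \<le> ennreal (2 * (1 / sqrt (2 * pi * (sqrt (real k / 2 ^ n))\<^sup>2)) * \<delta>)"
    by (rule emeasure_sum_small[OF ind dens normal_density_le]) (use kn assms in auto)
  also have "{\<omega> \<in> space M. \<bar>(\<Sum>l<k. walk_step B n l \<omega>) + V (\<lambda>i. walk_step B n i \<omega>)\<bar> \<le> \<delta>} =
     {\<omega> \<in> space M. \<bar>Min ((\<lambda>i. s * walk B n \<omega> i) ` {k..j})\<bar> \<le> \<delta>}"
    using s by (auto simp: sum_eq abs_mult)
  finally show ?thesis .
qed

text \<open>Almost surely the path has no local extremum of value 0: the extremum over a dyadic interval is
  the sum of the starting value, which has a bounded density, and an independent variable.\<close>

lemma AE_changes_sign_at_zero:
  assumes i: "0 < i" and s: "\<bar>s\<bar> = 1"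
  shows "AE \<omega> in M. (\<exists>v\<in>{real i / 2 ^ c..real (Suc i) / 2 ^ c}. B v \<omega> = 0) \<longrightarrow>
    (\<exists>m. \<exists>j\<in>{i * 2 ^ m..Suc i * 2 ^ m}. s * walk B (c + m) \<omega> j < 0)"
proof -
  define Z where "Z m \<omega> = Min ((\<lambda>j. s * walk B (c + m) \<omega> j) ` {i * 2 ^ m..Suc i * 2 ^ m})" for m \<omega>
  have [measurable]: "Z m \<in> borel_measurable M" for m
    unfolding Z_def by measurable
  define E where "E \<delta> N = {\<omega> \<in> space M. \<forall>m\<ge>N. \<bar>Z m \<omega>\<bar> \<le> \<delta>}" for \<delta> :: real and N
  have [measurable]: "E \<delta> N \<in> sets M" for \<delta> N unfolding E_def by measurable
  define C where "C = 2 * (1 / sqrt (2 * pi * (sqrt (real i / 2 ^ c))\<^sup>2))"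
  have C: "0 \<le> C" by (simp add: C_def)
  \<comment> \<open>The left end of the interval is the same positive time at every level, so the
    density bound, and with it \<open>C\<close>, does not depend on \<open>N\<close>.\<close>
  have E: "emeasure M (E \<delta> N) \<le> ennreal (C * \<delta>)" if "0 \<le> \<delta>" for \<delta> N
  proof -
    have "emeasure M (E \<delta> N) \<le> emeasure M {\<omega> \<in> space M. \<bar>Z N \<omega>\<bar> \<le> \<delta>}"
      by (rule emeasure_mono) (auto simp: E_def)
    also have "\<dots> \<le> ennreal (2 * (1 / sqrt (2 * pi * (sqrt (real (i * 2 ^ N) / 2 ^ (c + N)))\<^sup>2)) * \<delta>)"
      unfolding Z_def using i that s by (intro emeasure_walk_min_small) auto
    also have "real (i * 2 ^ N) / 2 ^ (c + N) = real i / 2 ^ c" by (simp add: power_add)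
    finally show ?thesis by (simp add: C_def)
  qed
  have UE: "emeasure M (\<Union>N. E \<delta> N) \<le> ennreal (C * \<delta>)" if "0 \<le> \<delta>" for \<delta>
  proof -
    have "incseq (E \<delta>)" by (auto simp: incseq_def E_def)
    then have "emeasure M (\<Union>N. E \<delta> N) = (SUP N. emeasure M (E \<delta> N))"
      by (intro SUP_emeasure_incseq[symmetric]) auto
    also have "\<dots> \<le> ennreal (C * \<delta>)" by (intro SUP_least E that)
    finally show ?thesis .
  qed
  \<comment> \<open>\<open>A\<close> is the event that the grid minima \<open>Z m\<close> tend to
    0.\<close>
  define A where "A = (\<Inter>k. \<Union>N. E (1 / real (Suc k)) N)"
  have [measurable]: "A \<in> sets M" unfolding A_def by measurable
  have "emeasure M A \<le> ennreal (C * (1 / real (Suc k)))" for k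
    by (rule order_trans[OF emeasure_mono UE]) (auto simp: A_def)
  moreover have "(\<lambda>k. ennreal (C * (1 / real (Suc k)))) \<longlonglongrightarrow> ennreal (C * 0)"
    by (intro tendsto_ennrealI tendsto_mult tendsto_const)
      (use LIMSEQ_inverse_real_of_nat in \<open>simp add: inverse_eq_divide\<close>)
  ultimately have "emeasure M A \<le> 0"
    by (intro tendsto_lowerbound[where f = "\<lambda>k. ennreal (C * (1 / real (Suc k)))"]) auto
  then have null: "A \<in> null_sets M" by auto
  show ?thesis
  proof (rule AE_I'[OF null], rule subsetI)
    fix \<omega>
    assume bad: "\<omega> \<in> {\<omega> \<in> space M. \<not> ((\<exists>v\<in>{real i / 2 ^ c..real (Suc i) / 2 ^ c}. B v \<omega> = 0) \<longrightarrow>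
      (\<exists>m. \<exists>j\<in>{i * 2 ^ m..Suc i * 2 ^ m}. s * walk B (c + m) \<omega> j < 0))}"
    then obtain v where v: "v \<in> {real i / 2 ^ c..real (Suc i) / 2 ^ c}" "B v \<omega> = 0" by blast
    have \<omega>: "\<omega> \<in> space M"
      and no: "\<not> (\<exists>m. \<exists>j\<in>{i * 2 ^ m..Suc i * 2 ^ m}. s * walk B (c + m) \<omega> j < 0)"
      using bad by blast+
    have v0: "0 \<le> v" using v(1) by (auto intro: order_trans[rotated])
    show "\<omega> \<in> A"
      unfolding A_def
    proof
      fix k
      define \<delta> where "\<delta> = 1 / real (Suc k)"
      have "0 < \<delta>" by (simp add: \<delta>_def)
      then obtain d where d: "0 < d" "\<And>u. 0 \<le> u \<Longrightarrow> \<bar>u - v\<bar> < d \<Longrightarrow> \<bar>B u \<omega>\<bar> < \<delta>"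
        using continuous_B[OF \<omega>] v0 v(2) unfolding continuous_on_iff dist_real_def
        by (metis atLeast_iff diff_zero)
      obtain N where N: "(1 / 2) ^ N < d" using real_arch_pow_inv[OF d(1), of "1/2"] by auto
      \<comment> \<open>Without a negative value the minimum is at least 0, while the grid point
        just before the zero \<open>v\<close> keeps it below \<open>\<delta>\<close>.\<close>
      have "\<bar>Z m \<omega>\<bar> \<le> \<delta>" if "N \<le> m" for m
      proof -
        define j where "j = nat \<lfloor>v * 2 ^ (c + m)\<rfloor>"
        have j: "real j \<le> v * 2 ^ (c + m)" "v * 2 ^ (c + m) < real j + 1"
          unfolding j_def using v0 by (auto simp: of_nat_nat)
        have vm: "real (i * 2 ^ m) \<le> v * 2 ^ (c + m)" "v * 2 ^ (c + m) \<le> real (Suc i * 2 ^ m)"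
        proof -
          have "real i \<le> v * 2 ^ c" "v * 2 ^ c \<le> real (Suc i)" using v(1) by (auto simp: field_simps)
          then have "real i * 2 ^ m \<le> v * 2 ^ c * 2 ^ m" "v * 2 ^ c * 2 ^ m \<le> real (Suc i) * 2 ^ m"
            by (auto intro!: mult_right_mono simp del: of_nat_Suc)
          then show "real (i * 2 ^ m) \<le> v * 2 ^ (c + m)" "v * 2 ^ (c + m) \<le> real (Suc i * 2 ^ m)"
            by (simp_all add: power_add mult.assoc del: of_nat_Suc mult_Suc)
        qed
        have "real (i * 2 ^ m) < real (Suc j)" using vm j by linarith
        then have "i * 2 ^ m \<le> j" by linarith
        moreover have "real j \<le> real (Suc i * 2 ^ m)" using vm j by linarith
        then have "j \<le> Suc i * 2 ^ m" by linarith
        ultimately have jm: "j \<in> {i * 2 ^ m..Suc i * 2 ^ m}" by simp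
        have "\<bar>real j / 2 ^ (c + m) - v\<bar> \<le> 1 / 2 ^ (c + m)"
        proof -
          have "real j / 2 ^ (c + m) \<le> v" "v < (real j + 1) / 2 ^ (c + m)"
            using j by (simp_all add: pos_divide_le_eq pos_less_divide_eq)
          then show ?thesis unfolding add_divide_distrib by linarith
        qed
        also have "\<dots> \<le> (1 / 2) ^ N"
          unfolding power_one_over[symmetric] using that by (intro power_decreasing) auto
        finally have "\<bar>walk B (c + m) \<omega> j\<bar> < \<delta>" unfolding walk_def using N by (intro d(2)) auto
        then have "s * walk B (c + m) \<omega> j \<le> \<delta>" using s by (auto simp: abs_if split: if_splits)
        moreover have "Z m \<omega> \<le> s * walk B (c + m) \<omega> j" unfolding Z_def using jm by (intro Min_le) auto
        moreover have "0 \<le> Z m \<omega>" unfolding Z_def using no by (subst Min_ge_iff) (auto simp: not_less)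
        ultimately show ?thesis by linarith
      qed
      then show "\<omega> \<in> (\<Union>N. E (1 / real (Suc k)) N)" using \<omega> by (auto simp: E_def \<delta>_def)
    qed
  qed
qed

text \<open>A sign change on the grid forces a zero by the intermediate value theorem. Conversely,
  uniform continuity keeps every zero at distance at least \<open>d\<close> from the times of height
  \<open>z\<close>. The block of a fixed level \<open>c\<close> around a zero then fits between the
  two times, and fine grids show both signs inside this block.\<close>

lemma AE_runs_eventually:
  assumes z: "0 < z"
  shows "AE \<omega> in M. \<forall>\<^sub>F n in sequentially. \<forall>j k. j < k \<longrightarrow> k \<le> 2 ^ n \<longrightarrow>
      z \<le> \<bar>walk B n \<omega> j\<bar> \<longrightarrow> z \<le> \<bar>walk B n \<omega> k\<bar> \<longrightarrow>
      same_side (walk B n \<omega>) j k \<longleftrightarrow> (\<forall>v\<in>{real j / 2 ^ n..real k / 2 ^ n}. B v \<omega> \<noteq> 0)"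
proof -
  have "AE \<omega> in M. \<forall>c i. 0 < i \<longrightarrow> (\<exists>v\<in>{real i / 2 ^ c..real (Suc i) / 2 ^ c}. B v \<omega> = 0) \<longrightarrow>
      (\<forall>s\<in>{1, -1}. \<exists>m. \<exists>j\<in>{i * 2 ^ m..Suc i * 2 ^ m}. s * walk B (c + m) \<omega> j < 0)"
    unfolding AE_all_countable ball_simps
  proof (intro allI)
    fix c i
    show "AE \<omega> in M. 0 < i \<longrightarrow> (\<exists>v\<in>{real i / 2 ^ c..real (Suc i) / 2 ^ c}. B v \<omega> = 0) \<longrightarrow>
      (\<forall>s\<in>{1, -1}. \<exists>m. \<exists>j\<in>{i * 2 ^ m..Suc i * 2 ^ m}. s * walk B (c + m) \<omega> j < 0)"
    proof (cases "0 < i")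
      case True
      have "AE \<omega> in M. (\<exists>v\<in>{real i / 2 ^ c..real (Suc i) / 2 ^ c}. B v \<omega> = 0) \<longrightarrow>
          (\<exists>m. \<exists>j\<in>{i * 2 ^ m..Suc i * 2 ^ m}. 1 * walk B (c + m) \<omega> j < 0)"
        by (rule AE_changes_sign_at_zero[OF True]) simp
      moreover have "AE \<omega> in M. (\<exists>v\<in>{real i / 2 ^ c..real (Suc i) / 2 ^ c}. B v \<omega> = 0) \<longrightarrow>
          (\<exists>m. \<exists>j\<in>{i * 2 ^ m..Suc i * 2 ^ m}. (-1) * walk B (c + m) \<omega> j < 0)"
        by (rule AE_changes_sign_at_zero[OF True]) simp
      ultimately show ?thesis by eventually_elim blast
    qed simp
  qed
  then show ?thesis
    using AE_space
  proof eventually_elim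
    case (elim \<omega>)
    note \<omega> = elim(2)
    have cont: "continuous_on {a..b} (\<lambda>t. B t \<omega>)" if "0 \<le> a" for a b
      by (rule continuous_on_subset[OF continuous_B[OF \<omega>]]) (use that in auto)
    have "uniformly_continuous_on {0..1} (\<lambda>t. B t \<omega>)"
      by (intro compact_uniformly_continuous cont) auto
    then obtain d where d: "0 < d"
      "\<And>s t. s \<in> {0..1} \<Longrightarrow> t \<in> {0..1} \<Longrightarrow> \<bar>t - s\<bar> < d \<Longrightarrow> \<bar>B t \<omega> - B s \<omega>\<bar> < z"
      unfolding uniformly_continuous_on_def dist_real_def using z by metis
    obtain c where c: "(1 / 2) ^ c < d" using real_arch_pow_inv[OF d(1), of "1/2"] by auto
    define I where "I i = {real i / 2 ^ c..real (Suc i) / 2 ^ c}" for i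
    define both where "both n i \<longleftrightarrow> (\<exists>l. real l / 2 ^ n \<in> I i \<and> walk B n \<omega> l > 0) \<and>
        (\<exists>l. real l / 2 ^ n \<in> I i \<and> walk B n \<omega> l < 0)" for n i
    have ev: "\<forall>\<^sub>F n in sequentially. both n i" if i: "0 < i" "\<exists>v\<in>I i. B v \<omega> = 0" for i
    proof -
      have one: "\<forall>\<^sub>F n in sequentially. \<exists>l. real l / 2 ^ n \<in> I i \<and> s * walk B n \<omega> l < 0" if s: "s \<in> {1, -1}" for s
      proof -
        obtain m j where j: "j \<in> {i * 2 ^ m..Suc i * 2 ^ m}" "s * walk B (c + m) \<omega> j < 0"
          using elim(1) i s unfolding I_def by blast
        have "\<exists>l. real l / 2 ^ n \<in> I i \<and> s * walk B n \<omega> l < 0" if "c + m \<le> n" for n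
        proof (intro exI conjI)
          have "real (j * 2 ^ (n - (c + m))) / 2 ^ n = real j * 2 ^ (n - (c + m)) / (2 ^ (c + m) * 2 ^ (n - (c + m)))"
            using that by (simp flip: power_add)
          then have eq: "real (j * 2 ^ (n - (c + m))) / 2 ^ n = real j / 2 ^ (c + m)" by simp
          have "real (i * 2 ^ m) \<le> real j" "real j \<le> real (Suc i * 2 ^ m)"
            using j by (auto simp only: atLeastAtMost_iff of_nat_le_iff)
          then have "real i * 2 ^ m \<le> real j" "real j \<le> real (Suc i) * 2 ^ m"
            by (simp_all del: of_nat_Suc mult_Suc)
          then have "real i / 2 ^ c \<le> real j / (2 ^ c * 2 ^ m)" "real j / (2 ^ c * 2 ^ m) \<le> real (Suc i) / 2 ^ c"
            by (simp_all add: field_simps)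
          then show "real (j * 2 ^ (n - (c + m))) / 2 ^ n \<in> I i"
            unfolding eq I_def by (simp add: power_add)
          show "s * walk B n \<omega> (j * 2 ^ (n - (c + m))) < 0"
            using j(2) eq by (simp add: walk_def)
        qed
        then show ?thesis by (auto simp: eventually_sequentially)
      qed
      have "\<forall>\<^sub>F n in sequentially. \<exists>l. real l / 2 ^ n \<in> I i \<and> walk B n \<omega> l > 0"
        using one[of "-1"] by simp
      moreover have "\<forall>\<^sub>F n in sequentially. \<exists>l. real l / 2 ^ n \<in> I i \<and> walk B n \<omega> l < 0"
        using one[of 1] by simp
      ultimately show ?thesis unfolding both_def by (rule eventually_conj)
    qed
    \<comment> \<open>The level \<open>c\<close> is fixed, so only finitely many blocks matter and
      one \<open>n\<close> serves all of them.\<close>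
    have "\<forall>\<^sub>F n in sequentially. \<forall>i\<in>{i. i < 2 ^ c \<and> 0 < i \<and> (\<exists>v\<in>I i. B v \<omega> = 0)}. both n i"
      by (rule eventually_ball_finite) (use ev in auto)
    then show ?case
    proof eventually_elim
      case (elim n)
      show ?case
      proof (intro allI impI)
        fix j k :: nat
        assume jk: "j < k" "k \<le> 2 ^ n" and high: "z \<le> \<bar>walk B n \<omega> j\<bar>" "z \<le> \<bar>walk B n \<omega> k\<bar>"
        let ?s = "real j / 2 ^ n" and ?t = "real k / 2 ^ n"
        have st: "0 \<le> ?s" "?s \<le> ?t" using jk by (auto simp: divide_right_mono)
        have "real k \<le> 2 ^ n" using jk(2) by simp
        then have t1: "?t \<le> 1" by (simp add: divide_le_eq_1)
        have s01: "?s \<in> {0..1}" and t01: "?t \<in> {0..1}"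
          unfolding atLeastAtMost_iff using st t1 by linarith+
        have far: "d \<le> \<bar>u - v\<bar>" if "B v \<omega> = 0" "z \<le> \<bar>B u \<omega>\<bar>" "u \<in> {0..1}" "v \<in> {0..1}" for u v
          using d(2)[of v u] that by (cases "\<bar>u - v\<bar> < d") auto
        show "same_side (walk B n \<omega>) j k \<longleftrightarrow> (\<forall>v\<in>{?s..?t}. B v \<omega> \<noteq> 0)"
        proof (intro iffI ballI notI)
          fix v assume same: "same_side (walk B n \<omega>) j k" and v: "v \<in> {?s..?t}" "B v \<omega> = 0"
          define i where "i = nat \<lfloor>v * 2 ^ c\<rfloor>"
          have "0 \<le> v" using v(1) st(1) unfolding atLeastAtMost_iff by linarith
          then have i: "real i \<le> v * 2 ^ c" "v * 2 ^ c < real i + 1"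
            unfolding i_def by (auto simp: of_nat_nat)
          have vi: "real i / 2 ^ c \<le> v" "v < real (Suc i) / 2 ^ c"
            using i by (simp_all add: pos_divide_le_eq pos_less_divide_eq)
          have len: "real (Suc i) / 2 ^ c - real i / 2 ^ c < d"
            using c by (simp add: power_one_over flip: diff_divide_distrib)
          have v01: "v \<in> {0..1}" using \<open>0 \<le> v\<close> v(1) t1 unfolding atLeastAtMost_iff by linarith
          have "d \<le> \<bar>?s - v\<bar>" "d \<le> \<bar>?t - v\<bar>"
            using far[OF v(2) _ s01 v01] far[OF v(2) _ t01 v01] high by (auto simp: walk_def)
          then have dv: "?s + d \<le> v" "v + d \<le> ?t" using v(1) unfolding atLeastAtMost_iff by linarith+
          \<comment> \<open>The statement about sign changes excludes the block at time 0. It cannot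
            contain \<open>v\<close>, because it is shorter than \<open>d\<close> and
            \<open>v\<close> is at least \<open>d\<close>.\<close>
          have "i \<noteq> 0"
          proof
            assume "i = 0"
            then have "real (Suc i) / 2 ^ c < d" using len by simp
            then show False using vi(2) dv(1) st(1) by linarith
          qed
          then have "0 < i" by simp
          moreover have "i < 2 ^ c"
          proof -
            have "real i / 2 ^ c < 1" using vi dv t1 d(1) by linarith
            then have "real i < 2 ^ c" by (simp add: divide_less_eq_1)
            then show ?thesis by simp
          qed
          moreover have "\<exists>v\<in>I i. B v \<omega> = 0" using vi v by (auto simp: I_def intro!: bexI[of _ v])
          ultimately have "both n i" using elim by blast
          moreover have "l \<in> {j..k}" if "real l / 2 ^ n \<in> I i" for l
          proof -
            have "?s \<le> real l / 2 ^ n" "real l / 2 ^ n \<le> ?t"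
              using that vi dv len unfolding I_def atLeastAtMost_iff by linarith+
            then show ?thesis by (simp add: divide_le_cancel)
          qed
          ultimately show False using same unfolding both_def same_side_def by (meson less_asym not_less)
        next
          assume nz: "\<forall>v\<in>{?s..?t}. B v \<omega> \<noteq> 0"
          show "same_side (walk B n \<omega>) j k"
          proof (rule ccontr)
            assume "\<not> same_side (walk B n \<omega>) j k"
            then obtain l l' where l: "l \<in> {j..k}" "l' \<in> {j..k}" "walk B n \<omega> l \<le> 0" "0 < walk B n \<omega> l'"
              unfolding same_side_def by (meson not_less)
            let ?u = "real l / 2 ^ n" and ?u' = "real l' / 2 ^ n"
            have u: "?s \<le> ?u" "?u \<le> ?t" "?s \<le> ?u'" "?u' \<le> ?t"
              using l by (auto simp: divide_right_mono)
            have "\<exists>v. min ?u ?u' \<le> v \<and> v \<le> max ?u ?u' \<and> B v \<omega> = 0"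
            proof (cases "?u \<le> ?u'")
              case True
              then show ?thesis using l u st IVT'[of "\<lambda>t. B t \<omega>" ?u 0 ?u'] cont[of ?u ?u'] by (auto simp: walk_def)
            next
              case False
              then show ?thesis using l u st IVT2'[of "\<lambda>t. B t \<omega>" ?u 0 ?u'] cont[of ?u' ?u] by (auto simp: walk_def)
            qed
            then obtain v where v: "min ?u ?u' \<le> v" "v \<le> max ?u ?u'" "B v \<omega> = 0" by blast
            have "v \<in> {?s..?t}" using v(1,2) u unfolding atLeastAtMost_iff by linarith
            then show False using nz v(3) by blast
          qed
        qed
      qed
    qed
  qed
qed

end

section \<open>Signed excursions\<close>

text \<open>A positive continuous function on a compact segment is bounded away from 0, and rational
  points detect such a bound. The resulting countable condition makes labels measurable; the
  parameter \<open>\<theta>\<close> handles both orders of \<open>t\<close> and \<open>q\<close> at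
  once.\<close>

lemma excursion_segment_iff_rational:
  fixes r :: "real \<Rightarrow> real"
  assumes r: "continuous_on {0..} r" and pos: "\<And>u. 0 \<le> u \<Longrightarrow> 0 \<le> r u" and "0 \<le> t" "0 \<le> q"
  shows "(\<forall>v\<in>closed_segment t q. r v \<noteq> 0) \<longleftrightarrow>
    (\<exists>k::nat. \<forall>\<theta>::rat. 0 \<le> \<theta> \<and> \<theta> \<le> 1 \<longrightarrow> 1 / real (Suc k) \<le> r ((1 - of_rat \<theta>) * t + of_rat \<theta> * q))"
proof -
  define g where "g \<theta> = r ((1 - \<theta>) * t + \<theta> * q)" for \<theta>
  have cont: "continuous_on {0..1} g"
    unfolding g_def
  proof (rule continuous_on_compose2[OF r])
    show "continuous_on {0..1} (\<lambda>\<theta>. (1 - \<theta>) * t + \<theta> * q)" by (intro continuous_intros)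
  qed (use assms(3,4) in auto)
  have seg: "closed_segment t q = (\<lambda>\<theta>. (1 - \<theta>) * t + \<theta> * q) ` {0..1}"
    by (auto simp: closed_segment_def)
  have nonneg: "0 \<le> g \<theta>" if "\<theta> \<in> {0..1}" for \<theta>
    unfolding g_def using that assms(3,4) by (intro pos) auto
  have "(\<forall>\<theta>\<in>{0..1}. g \<theta> \<noteq> 0) \<longleftrightarrow>
      (\<exists>k::nat. \<forall>\<theta>::rat. 0 \<le> \<theta> \<and> \<theta> \<le> 1 \<longrightarrow> 1 / real (Suc k) \<le> g (of_rat \<theta>))"
  proof
    assume nz: "\<forall>\<theta>\<in>{0..1}. g \<theta> \<noteq> 0"
    obtain \<theta>0 where \<theta>0: "\<theta>0 \<in> {0..1}" "\<forall>\<theta>\<in>{0..1}. g \<theta>0 \<le> g \<theta>"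
      using continuous_attains_inf[OF _ _ cont] by auto
    then have "0 < g \<theta>0" using nz nonneg by (metis order_less_le)
    then obtain k where k: "inverse (real (Suc k)) < g \<theta>0" using reals_Archimedean by blast
    have "1 / real (Suc k) \<le> g (of_rat \<theta>)" if "0 \<le> \<theta>" "\<theta> \<le> 1" for \<theta> :: rat
    proof -
      have "real_of_rat \<theta> \<in> {0..1}" using that by simp
      then have "g \<theta>0 \<le> g (of_rat \<theta>)" using \<theta>0(2) by blast
      with k show ?thesis by (simp add: inverse_eq_divide)
    qed
    then show "\<exists>k::nat. \<forall>\<theta>::rat. 0 \<le> \<theta> \<and> \<theta> \<le> 1 \<longrightarrow> 1 / real (Suc k) \<le> g (of_rat \<theta>)" by blast
  next
    assume "\<exists>k::nat. \<forall>\<theta>::rat. 0 \<le> \<theta> \<and> \<theta> \<le> 1 \<longrightarrow> 1 / real (Suc k) \<le> g (of_rat \<theta>)"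
    then obtain k :: nat where k: "\<And>\<theta>::rat. 0 \<le> \<theta> \<Longrightarrow> \<theta> \<le> 1 \<Longrightarrow> 1 / real (Suc k) \<le> g (of_rat \<theta>)" by blast
    show "\<forall>\<theta>\<in>{0..1}. g \<theta> \<noteq> 0"
    proof (intro ballI notI)
      fix \<theta>0 assume \<theta>0: "\<theta>0 \<in> {0..1}" "g \<theta>0 = 0"
      have "0 < 1 / real (Suc k)" by simp
      then obtain d where d: "0 < d" "\<And>\<theta>. \<theta> \<in> {0..1} \<Longrightarrow> dist \<theta> \<theta>0 < d \<Longrightarrow> dist (g \<theta>) (g \<theta>0) < 1 / real (Suc k)"
        using cont \<theta>0(1) unfolding continuous_on_iff by metis
      have "max 0 (\<theta>0 - d) < min 1 (\<theta>0 + d)" using \<theta>0 d(1) by auto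
      then obtain \<theta> :: rat where \<theta>: "max 0 (\<theta>0 - d) < of_rat \<theta>" "of_rat \<theta> < min 1 (\<theta>0 + d)"
        using of_rat_dense by blast
      then have "dist (g (of_rat \<theta>)) (g \<theta>0) < 1 / real (Suc k)"
        by (intro d(2)) (auto simp: dist_real_def)
      moreover have "1 / real (Suc k) \<le> g (of_rat \<theta>)" using \<theta> by (intro k) auto
      ultimately show False using \<theta>0(2) by (simp add: dist_real_def)
    qed
  qed
  then show ?thesis unfolding seg g_def by simp
qed

locale signed_excursions = brownian_motion M B for M :: "'a measure" and B +
  fixes \<beta> :: real and X R :: "real \<Rightarrow> 'a \<Rightarrow> real" and S :: "nat \<Rightarrow> 'a \<Rightarrow> bool"
  assumes \<beta>: "0 < \<beta>" "\<beta> < 1"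
    and R_eq: "\<And>t \<omega>. 0 \<le> t \<Longrightarrow> \<omega> \<in> space M \<Longrightarrow> R t \<omega> = \<bar>B t \<omega>\<bar>"
    and S_indep: "indep_vars (\<lambda>_. count_space UNIV) S UNIV"
    and S_distr: "\<And>n. distr M (count_space UNIV) (S n) = measure_pmf (bernoulli_pmf \<beta>)"
    and R_S_indep: "indep_set
          (sets (vimage_algebra (space M) (\<lambda>\<omega>. \<lambda>t\<in>{0..}. R t \<omega>) (\<Pi>\<^sub>M t\<in>{0..}. borel)))
          (sets (vimage_algebra (space M) (\<lambda>\<omega> n. S n \<omega>) (\<Pi>\<^sub>M n\<in>UNIV. count_space UNIV)))"
    and X_eq: "\<And>t \<omega>. 0 \<le> t \<Longrightarrow> \<omega> \<in> space M \<Longrightarrow>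
           X t \<omega> = (if S (excursion_index (\<lambda>u. R u \<omega>) t) \<omega> then R t \<omega> else - R t \<omega>)"
begin

text \<open>Labels have to be measurable for this sigma-algebra and not just for \<open>M\<close>,
  since the independence of path and signs is formulated with it.\<close>

definition R_algebra :: "'a measure" where
  "R_algebra = vimage_algebra (space M) (\<lambda>\<omega>. \<lambda>t\<in>{0..}. R t \<omega>) (\<Pi>\<^sub>M t\<in>{0..}. borel)"

lemma space_R_algebra [simp]: "space R_algebra = space M"
  by (simp add: R_algebra_def)

lemma measurable_S [measurable]: "S n \<in> measurable M (count_space UNIV)"
  using S_indep by (simp add: indep_vars_def)

lemma measurable_R: "0 \<le> t \<Longrightarrow> R t \<in> borel_measurable M"
  using R_eq[of t] measurable_B[of t] by (subst measurable_cong[of M _ "\<lambda>\<omega>. \<bar>B t \<omega>\<bar>"]) auto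

lemma measurable_R_algebra_R: "0 \<le> t \<Longrightarrow> R t \<in> borel_measurable R_algebra"
proof -
  assume t: "0 \<le> t"
  have "(\<lambda>\<omega>. \<lambda>t\<in>{0..}. R t \<omega>) \<in> measurable R_algebra (\<Pi>\<^sub>M t\<in>{0..}. borel)"
    unfolding R_algebra_def by (rule measurable_vimage_algebra1) (auto simp: space_PiM)
  moreover have "(\<lambda>f. f t) \<in> measurable (\<Pi>\<^sub>M t\<in>{0..}. borel :: real measure) borel"
    using t by (intro measurable_component_singleton) auto
  ultimately have "(\<lambda>f. f t) \<circ> (\<lambda>\<omega>. \<lambda>t\<in>{0..}. R t \<omega>) \<in> borel_measurable R_algebra"
    by (rule measurable_comp)
  then show ?thesis using t by (simp add: comp_def)
qed

lemma sets_R_algebra_subset: "sets R_algebra \<subseteq> sets M"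
  using R_S_indep by (auto simp: R_algebra_def indep_set_def indep_sets_def UNIV_bool)

lemma measurable_from_R_algebra: "f \<in> measurable R_algebra N \<Longrightarrow> f \<in> measurable M N"
  using sets_R_algebra_subset by (auto simp: measurable_def)

lemma R_nonneg: "0 \<le> t \<Longrightarrow> \<omega> \<in> space M \<Longrightarrow> 0 \<le> R t \<omega>"
  by (simp add: R_eq)

lemma continuous_R: "\<omega> \<in> space M \<Longrightarrow> continuous_on {0..} (\<lambda>t. R t \<omega>)"
proof -
  assume \<omega>: "\<omega> \<in> space M"
  have "continuous_on {0..} (\<lambda>t. \<bar>B t \<omega>\<bar>)" by (intro continuous_intros continuous_B \<omega>)
  then show ?thesis by (rule continuous_on_eq) (use R_eq \<omega> in auto)
qed

lemma continuous_X: "\<omega> \<in> space M \<Longrightarrow> continuous_on {0..} (\<lambda>t. X t \<omega>)"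
proof -
  assume \<omega>: "\<omega> \<in> space M"
  show ?thesis
    by (rule continuous_on_eq[OF continuous_on_signed_excursions[OF continuous_R[OF \<omega>]]])
      (use X_eq \<omega> in auto)
qed

lemma abs_X: "0 \<le> t \<Longrightarrow> \<omega> \<in> space M \<Longrightarrow> \<bar>X t \<omega>\<bar> = \<bar>B t \<omega>\<bar>"
  by (simp add: X_eq R_eq)

lemma measurable_excursion_index:
  assumes t: "0 \<le> t"
  shows "(\<lambda>\<omega>. excursion_index (\<lambda>u. R u \<omega>) t) \<in> measurable R_algebra (count_space UNIV)"
  unfolding excursion_index_def
proof (rule measurable_Least)
  fix i
  define q where "q = real_of_rat (from_nat i)"
  show "Measurable.pred R_algebra (\<lambda>\<omega>. real_of_rat (from_nat i) \<in> excursion_interval (\<lambda>u. R u \<omega>) t)"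
    unfolding q_def[symmetric]
  proof (cases "0 \<le> q")
    case True
    have nonneg: "0 \<le> (1 - of_rat \<theta>) * t + of_rat \<theta> * q" if "0 \<le> \<theta>" "\<theta> \<le> 1" for \<theta> :: rat
      using that t True by simp
    have "q \<in> excursion_interval (\<lambda>u. R u \<omega>) t \<longleftrightarrow>
      (\<exists>k::nat. \<forall>\<theta>::rat. 0 \<le> \<theta> \<and> \<theta> \<le> 1 \<longrightarrow> 1 / real (Suc k) \<le> R ((1 - of_rat \<theta>) * t + of_rat \<theta> * q) \<omega>)"
      if "\<omega> \<in> space R_algebra" for \<omega>
      using excursion_segment_iff_rational[OF continuous_R R_nonneg t True] that t True
      by (simp add: mem_excursion_interval_iff)
    moreover have "Measurable.pred R_algebra (\<lambda>\<omega>. \<exists>k::nat. \<forall>\<theta>::rat. 0 \<le> \<theta> \<and> \<theta> \<le> 1 \<longrightarrow>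
         1 / real (Suc k) \<le> R ((1 - of_rat \<theta>) * t + of_rat \<theta> * q) \<omega>)"
    proof (intro pred_intros_countable)
      fix k :: nat and \<theta> :: rat
      show "Measurable.pred R_algebra (\<lambda>\<omega>. 0 \<le> \<theta> \<and> \<theta> \<le> 1 \<longrightarrow>
         1 / real (Suc k) \<le> R ((1 - of_rat \<theta>) * t + of_rat \<theta> * q) \<omega>)"
      proof (cases "0 \<le> \<theta> \<and> \<theta> \<le> 1")
        case True
        have [measurable]: "R ((1 - of_rat \<theta>) * t + of_rat \<theta> * q) \<in> borel_measurable R_algebra"
          using True by (intro measurable_R_algebra_R nonneg) auto
        show ?thesis by measurable
      qed auto
    qed
    ultimately show "Measurable.pred R_algebra (\<lambda>\<omega>. q \<in> excursion_interval (\<lambda>u. R u \<omega>) t)"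
      by (subst measurable_cong) auto
  next
    case False
    then show "Measurable.pred R_algebra (\<lambda>\<omega>. q \<in> excursion_interval (\<lambda>u. R u \<omega>) t)"
      by (simp add: mem_excursion_interval_iff)
  qed
qed

lemma measurable_X:
  assumes "0 \<le> t"
  shows "X t \<in> borel_measurable M"
proof -
  have [measurable]: "(\<lambda>\<omega>. excursion_index (\<lambda>u. R u \<omega>) t) \<in> measurable M (count_space UNIV)"
    by (rule measurable_from_R_algebra[OF measurable_excursion_index[OF assms]])
  have [measurable]: "R t \<in> borel_measurable M" by (rule measurable_R[OF assms])
  have [measurable]: "(\<lambda>\<omega>. S (excursion_index (\<lambda>u. R u \<omega>) t) \<omega>) \<in> measurable M (count_space UNIV)"
    by (rule measurable_compose_countable) measurable
  have "(\<lambda>\<omega>. if S (excursion_index (\<lambda>u. R u \<omega>) t) \<omega> then R t \<omega> else - R t \<omega>) \<in> borel_measurable M"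
    by measurable
  then show ?thesis using assms by (subst measurable_cong[OF X_eq]) auto
qed

section \<open>Integrating out the independent signs\<close>

lemma prob_all_negative:
  assumes "finite J"
  shows "prob {\<omega> \<in> space M. \<forall>n\<in>J. \<not> S n \<omega>} = (1 - \<beta>) ^ card J"
proof (cases "J = {}")
  case True
  then show ?thesis by (simp add: prob_space)
next
  case False
  have "prob {\<omega> \<in> space M. \<forall>n\<in>J. \<not> S n \<omega>} = prob (\<Inter>n\<in>J. S n -` {False} \<inter> space M)"
    using False by (auto intro!: arg_cong[where f = prob])
  also have "\<dots> = (\<Prod>n\<in>J. prob (S n -` {False} \<inter> space M))"
    by (rule indep_varsD[OF S_indep]) (use assms False in auto)
  also have "\<dots> = (\<Prod>n\<in>J. 1 - \<beta>)"
  proof (rule prod.cong[OF refl])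
    fix n
    have "prob (S n -` {False} \<inter> space M) = measure (distr M (count_space UNIV) (S n)) {False}"
      by (rule measure_distr[symmetric]) auto
    also have "\<dots> = 1 - \<beta>" using \<beta> by (simp add: S_distr measure_pmf_single)
    finally show "prob (S n -` {False} \<inter> space M) = 1 - \<beta>" .
  qed
  finally show ?thesis by simp
qed

text \<open>Labels, signs and the event \<^prop>\<open>R 1 \<omega> < \<epsilon>\<close> are coded in vectors of natural numbers, because
  \<^const>\<open>indep_var\<close> requires both variables to have the same type. A coordinate 0 of the label
  vector means that the grid point is irrelevant; other labels are shifted by 1.\<close>

definition label_vector :: "real \<Rightarrow> real \<Rightarrow> nat \<Rightarrow> 'a \<Rightarrow> nat \<Rightarrow> nat" where
  "label_vector z \<epsilon> n \<omega> j =
    (if j \<le> 2 ^ n then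
       (if z \<le> R (real j / 2 ^ n) \<omega> then Suc (excursion_index (\<lambda>u. R u \<omega>) (real j / 2 ^ n)) else 0)
     else if R 1 \<omega> < \<epsilon> then 1 else 0)"

definition sign_vector :: "'a \<Rightarrow> nat \<Rightarrow> nat" where
  "sign_vector \<omega> l = (if S l \<omega> then 1 else 0)"

text \<open>\<open>v j - 1\<close> undoes the shift of the labels. The coordinate
  \<open>Suc (2 ^ n)\<close>, the first one beyond the grid, records whether
  \<open>R 1 \<omega> < \<epsilon>\<close>.\<close>

definition below_event :: "nat \<Rightarrow> ((nat \<Rightarrow> nat) \<times> (nat \<Rightarrow> nat)) set" where
  "below_event n = {(v, s). (\<forall>j\<le>2 ^ n. v j \<noteq> 0 \<longrightarrow> s (v j - 1) = 0) \<and> v (Suc (2 ^ n)) \<noteq> 0}"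

definition grid_below :: "real \<Rightarrow> real \<Rightarrow> nat \<Rightarrow> 'a set" where
  "grid_below z \<epsilon> n = {\<omega> \<in> space M. (\<forall>j\<le>2 ^ n. X (real j / 2 ^ n) \<omega> < z) \<and> \<bar>X 1 \<omega>\<bar> < \<epsilon>}"

abbreviation label_space :: "(nat \<Rightarrow> nat) measure" where
  "label_space \<equiv> PiM UNIV (\<lambda>_. count_space UNIV)"

lemma measurable_label_vector: "label_vector z \<epsilon> n \<in> measurable R_algebra label_space"
proof -
  have "(\<lambda>\<omega> j. label_vector z \<epsilon> n \<omega> j) \<in> measurable R_algebra label_space"
  proof (rule measurable_PiM_single')
    fix j
    have [measurable]: "(\<lambda>\<omega>. excursion_index (\<lambda>u. R u \<omega>) (real j / 2 ^ n)) \<in> measurable R_algebra (count_space UNIV)"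
      by (rule measurable_excursion_index) simp
    have [measurable]: "R (real j / 2 ^ n) \<in> borel_measurable R_algebra" "R 1 \<in> borel_measurable R_algebra"
      by (auto intro: measurable_R_algebra_R)
    show "(\<lambda>\<omega>. label_vector z \<epsilon> n \<omega> j) \<in> measurable R_algebra (count_space UNIV)"
      unfolding label_vector_def by (cases "j \<le> 2 ^ n") (simp_all, measurable)
  qed auto
  then show ?thesis by simp
qed

abbreviation S_algebra :: "'a measure" where
  "S_algebra \<equiv> vimage_algebra (space M) (\<lambda>\<omega> n. S n \<omega>) (\<Pi>\<^sub>M n\<in>UNIV. count_space UNIV)"

lemma measurable_sign_vector: "sign_vector \<in> measurable S_algebra label_space"
proof -
  have "(\<lambda>\<omega> n. S n \<omega>) \<in> measurable S_algebra (\<Pi>\<^sub>M n\<in>UNIV. count_space UNIV)"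
    by (rule measurable_vimage_algebra1) (auto simp: space_PiM)
  from measurable_compose[OF this measurable_component_singleton[OF UNIV_I]]
  have [measurable]: "S l \<in> measurable S_algebra (count_space UNIV)" for l by simp
  have "(\<lambda>\<omega> l. sign_vector \<omega> l) \<in> measurable S_algebra label_space"
    unfolding sign_vector_def by (rule measurable_PiM_single') auto
  then show ?thesis by simp
qed

lemma measurable_signs: "sign_vector \<in> measurable M label_space"
proof -
  have "(\<lambda>\<omega> l. sign_vector \<omega> l) \<in> measurable M label_space"
    unfolding sign_vector_def by (rule measurable_PiM_single') auto
  then show ?thesis by simp
qed

lemma measurable_below_event: "below_event n \<in> sets (label_space \<Otimes>\<^sub>M label_space)"
proof -
  have [measurable]: "(\<lambda>x. fst x j) \<in> measurable (label_space \<Otimes>\<^sub>M label_space) (count_space UNIV)" for j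
    by (rule measurable_compose[OF measurable_fst measurable_component_singleton]) simp
  have [measurable]: "(\<lambda>x. snd x j) \<in> measurable (label_space \<Otimes>\<^sub>M label_space) (count_space UNIV)" for j
    by (rule measurable_compose[OF measurable_snd measurable_component_singleton]) simp
  have [measurable]: "(\<lambda>x. snd x (fst x j - 1)) \<in> measurable (label_space \<Otimes>\<^sub>M label_space) (count_space UNIV)" for j
    by (rule measurable_compose_countable[where g = "\<lambda>x. fst x j - 1"]) measurable
  have "{x \<in> space (label_space \<Otimes>\<^sub>M label_space).
      (\<forall>j\<le>2 ^ n. fst x j \<noteq> 0 \<longrightarrow> snd x (fst x j - 1) = 0) \<and> fst x (Suc (2 ^ n)) \<noteq> 0}
    \<in> sets (label_space \<Otimes>\<^sub>M label_space)"
    by measurable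
  also have "{x \<in> space (label_space \<Otimes>\<^sub>M label_space).
      (\<forall>j\<le>2 ^ n. fst x j \<noteq> 0 \<longrightarrow> snd x (fst x j - 1) = 0) \<and> fst x (Suc (2 ^ n)) \<noteq> 0} = below_event n"
    by (auto simp: below_event_def space_pair_measure space_PiM)
  finally show ?thesis .
qed

lemma indep_var_labels_signs:
  "indep_var label_space (label_vector z \<epsilon> n) label_space sign_vector"
  unfolding indep_var_eq
proof (intro conjI)
  show "random_variable label_space (label_vector z \<epsilon> n)"
    by (rule measurable_from_R_algebra[OF measurable_label_vector])
  show "random_variable label_space sign_vector" by (rule measurable_signs)
  have 1: "sigma_sets (space M) {label_vector z \<epsilon> n -` A \<inter> space M |A. A \<in> sets label_space} \<subseteq> sets R_algebra"
    using measurable_sets[OF measurable_label_vector, of _ z \<epsilon> n]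
    by (intro sets.sigma_sets_subset[of _ R_algebra, simplified]) auto
  have 2: "sigma_sets (space M) {sign_vector -` A \<inter> space M |A. A \<in> sets label_space} \<subseteq> sets S_algebra"
    using measurable_sets[OF measurable_sign_vector]
    by (intro sets.sigma_sets_subset[of _ S_algebra, simplified]) auto
  show "indep_set (sigma_sets (space M) {label_vector z \<epsilon> n -` A \<inter> space M |A. A \<in> sets label_space})
     (sigma_sets (space M) {sign_vector -` A \<inter> space M |A. A \<in> sets label_space})"
    using R_S_indep unfolding indep_set_def R_algebra_def[symmetric]
    by (rule indep_sets_mono_sets) (use 1 2 in \<open>auto split: bool.splits\<close>)
qed

lemma grid_below_eq:
  assumes z: "0 < z"
  shows "grid_below z \<epsilon> n = {\<omega> \<in> space M. (label_vector z \<epsilon> n \<omega>, sign_vector \<omega>) \<in> below_event n}"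
proof -
  have "X t \<omega> < z \<longleftrightarrow> (z \<le> R t \<omega> \<longrightarrow> \<not> S (excursion_index (\<lambda>u. R u \<omega>) t) \<omega>)"
    if "0 \<le> t" "\<omega> \<in> space M" for t \<omega>
    using X_eq[OF that] R_nonneg[OF that] z by auto
  moreover have "\<bar>X 1 \<omega>\<bar> = R 1 \<omega>" if "\<omega> \<in> space M" for \<omega>
    using that by (simp add: abs_X R_eq)
  ultimately show ?thesis
    by (auto simp: grid_below_def below_event_def label_vector_def sign_vector_def)
qed

lemma grid_below_measurable [measurable]: "grid_below z \<epsilon> n \<in> sets M"
proof -
  have [measurable]: "X (real j / 2 ^ n) \<in> borel_measurable M" "X 1 \<in> borel_measurable M" for j
    by (auto intro: measurable_X)
  show ?thesis unfolding grid_below_def by measurable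
qed

text \<open>By Fubini the signs can be integrated out first: once the label vector is frozen, every
  high label has to carry a negative sign, and the signs are independent.\<close>

lemma grid_below_prob:
  fixes n :: nat and \<epsilon> z :: real
  assumes z: "0 < z"
  defines "G \<equiv> \<lambda>\<omega>. (1 - \<beta>) ^ card (high_labels z (\<lambda>u. R u \<omega>) n) * of_bool (\<bar>B 1 \<omega>\<bar> < \<epsilon>)"
  shows "G \<in> borel_measurable M" "prob (grid_below z \<epsilon> n) = (\<integral>\<omega>. G \<omega> \<partial>M)"
proof -
  let ?V = "label_vector z \<epsilon> n" and ?S = "sign_vector"
  have V [measurable]: "?V \<in> measurable M label_space"
    by (rule measurable_from_R_algebra[OF measurable_label_vector])
  note measurable_signs [measurable] measurable_below_event [measurable]
  interpret DV: prob_space "distr M label_space ?V" by (rule prob_space_distr) measurable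
  interpret DS: prob_space "distr M label_space ?S" by (rule prob_space_distr) measurable
  have Gv: "emeasure (distr M label_space ?S) (Pair (?V \<omega>) -` below_event n) = ennreal (G \<omega>)"
    if \<omega>: "\<omega> \<in> space M" for \<omega>
  proof -
    have "emeasure (distr M label_space ?S) (Pair (?V \<omega>) -` below_event n) =
        emeasure M (?S -` (Pair (?V \<omega>) -` below_event n) \<inter> space M)"
      by (rule emeasure_distr) (auto intro: sets_Pair1)
    also have "?S -` (Pair (?V \<omega>) -` below_event n) \<inter> space M =
        (if R 1 \<omega> < \<epsilon> then {\<omega>' \<in> space M. \<forall>l\<in>high_labels z (\<lambda>u. R u \<omega>) n. \<not> S l \<omega>'} else {})"
      by (auto simp: below_event_def label_vector_def sign_vector_def high_labels_def)
    also have "emeasure M \<dots> = ennreal (G \<omega>)"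
      using prob_all_negative[of "high_labels z (\<lambda>u. R u \<omega>) n"] R_eq[of 1 \<omega>] \<omega>
      by (simp add: G_def emeasure_eq_measure high_labels_def)
    finally show ?thesis .
  qed
  have G0: "0 \<le> G \<omega>" "G \<omega> \<le> 1" for \<omega> using \<beta> by (auto simp: G_def power_le_one)
  have meas: "(\<lambda>v. emeasure (distr M label_space ?S) (Pair v -` below_event n)) \<in> borel_measurable label_space"
    using DS.measurable_emeasure_Pair[of "below_event n" label_space] by simp
  \<comment> \<open>\<open>G\<close> depends on the size of a random set of labels; its
    measurability is read off from the measures of the sections.\<close>
  have "(\<lambda>\<omega>. enn2real (emeasure (distr M label_space ?S) (Pair (?V \<omega>) -` below_event n))) \<in> borel_measurable M"
    using measurable_compose[OF V meas] by simp
  then show G [measurable]: "G \<in> borel_measurable M"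
    by (subst (asm) measurable_cong[where g = G]) (simp_all add: Gv G0)
  have "emeasure M (grid_below z \<epsilon> n) = emeasure (distr M (label_space \<Otimes>\<^sub>M label_space) (\<lambda>\<omega>. (?V \<omega>, ?S \<omega>))) (below_event n)"
    by (subst emeasure_distr) (auto simp: grid_below_eq[OF z] intro!: arg_cong[where f = "emeasure M"])
  also have "\<dots> = emeasure (distr M label_space ?V \<Otimes>\<^sub>M distr M label_space ?S) (below_event n)"
    using indep_var_labels_signs[of z \<epsilon> n] by (simp add: indep_var_distribution_eq)
  also have "\<dots> = (\<integral>\<^sup>+ v. emeasure (distr M label_space ?S) (Pair v -` below_event n) \<partial>distr M label_space ?V)"
    by (rule DS.emeasure_pair_measure_alt) simp
  also have "\<dots> = (\<integral>\<^sup>+ \<omega>. emeasure (distr M label_space ?S) (Pair (?V \<omega>) -` below_event n) \<partial>M)"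
    by (rule nn_integral_distr[OF V]) (use meas in simp)
  also have "\<dots> = (\<integral>\<^sup>+ \<omega>. ennreal (G \<omega>) \<partial>M)" by (rule nn_integral_cong) (simp add: Gv)
  also have "\<dots> = ennreal (\<integral>\<omega>. G \<omega> \<partial>M)"
    by (rule nn_integral_eq_integral) (auto intro!: integrable_abs_le_1 simp: G0)
  finally show "prob (grid_below z \<epsilon> n) = (\<integral>\<omega>. G \<omega> \<partial>M)"
    by (simp add: measure_def G0 integral_nonneg)
qed

text \<open>Almost surely the label count and \<open>survive\<close> agree on fine grids, so the
  grid probabilities have the limit computed for the walk. As the grids are nested, they also
  decrease to the probability of staying below \<open>z\<close> at all dyadic times.\<close>

lemma prob_dyadic_below:
  assumes \<epsilon>: "0 < \<epsilon>" "\<epsilon> \<le> z"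
  shows "prob {\<omega> \<in> space M. (\<forall>n. \<forall>j\<le>2 ^ n. X (real j / 2 ^ n) \<omega> < z) \<and> \<bar>X 1 \<omega>\<bar> < \<epsilon>} =
    prob {\<omega> \<in> space M. \<bar>B 1 \<omega>\<bar> < \<epsilon>} -
    2 * \<beta> * (\<Sum>m. (1 - 2 * \<beta>) ^ m * prob {\<omega> \<in> space M. \<bar>B 1 \<omega> - 2 * real (Suc m) * z\<bar> < \<epsilon>})"
    (is "prob ?A = ?b - ?s")
proof -
  have z: "0 < z" using \<epsilon> by simp
  let ?G = "\<lambda>n \<omega>. (1 - \<beta>) ^ card (high_labels z (\<lambda>u. R u \<omega>) n) * of_bool (\<bar>B 1 \<omega>\<bar> < \<epsilon>)"
  let ?sv = "\<lambda>n \<omega>. survive \<beta> z (walk B n \<omega>) (Suc (2 ^ n))"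
  note grid_below_prob(1)[OF z, measurable]
  have sv: "0 \<le> ?sv n \<omega>" "?sv n \<omega> \<le> 1" for n \<omega> using survive_bounds \<beta> by auto
  have pw: "0 \<le> (1 - \<beta>) ^ k" "(1 - \<beta>) ^ k \<le> 1" for k using \<beta> by (auto simp: power_le_one)
  have int: "integrable M (?G n)" "integrable M (\<lambda>\<omega>. ?sv n \<omega> * of_bool (\<bar>B 1 \<omega>\<bar> < \<epsilon>))"
    "integrable M (\<lambda>\<omega>. of_bool (\<bar>B 1 \<omega>\<bar> < \<epsilon>) :: real)" for n
    by (rule integrable_abs_le_1; use sv pw in \<open>auto intro!: mult_le_one simp: abs_mult\<close>)+
  have "(\<lambda>n. \<integral>\<omega>. ?G n \<omega> - ?sv n \<omega> * of_bool (\<bar>B 1 \<omega>\<bar> < \<epsilon>) \<partial>M) \<longlonglongrightarrow> (\<integral>\<omega>. 0 \<partial>M)"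
  proof (rule integral_dominated_convergence[where w = "\<lambda>_. 2"])
    show "AE \<omega> in M. (\<lambda>n. ?G n \<omega> - ?sv n \<omega> * of_bool (\<bar>B 1 \<omega>\<bar> < \<epsilon>)) \<longlonglongrightarrow> 0"
      using AE_runs_eventually[OF z] AE_space
    proof eventually_elim
      case (elim \<omega>)
      have "\<forall>\<^sub>F n in sequentially. ?sv n \<omega> = (1 - \<beta>) ^ card (high_labels z (\<lambda>u. R u \<omega>) n)"
        using elim(1)
      proof eventually_elim
        case (elim n)
        show ?case
        proof (rule survive_eq_power_card[OF continuous_R z])
          show "\<omega> \<in> space M" by fact
          show "\<bar>walk B n \<omega> j\<bar> = R (real j / 2 ^ n) \<omega>" for j
            using \<open>\<omega> \<in> space M\<close> by (simp add: walk_def R_eq)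
          fix j k assume jk: "j < k" "k \<le> 2 ^ n" "z \<le> \<bar>walk B n \<omega> j\<bar>" "z \<le> \<bar>walk B n \<omega> k\<bar>"
          have "R v \<omega> \<noteq> 0 \<longleftrightarrow> B v \<omega> \<noteq> 0" if "v \<in> {real j / 2 ^ n..real k / 2 ^ n}" for v
          proof -
            have "0 \<le> real j / 2 ^ n" by simp
            then have "0 \<le> v" using that unfolding atLeastAtMost_iff by linarith
            then show ?thesis using \<open>\<omega> \<in> space M\<close> by (simp add: R_eq)
          qed
          then show "same_side (walk B n \<omega>) j k \<longleftrightarrow> (\<forall>v\<in>{real j / 2 ^ n..real k / 2 ^ n}. R v \<omega> \<noteq> 0)"
            using elim jk by simp
        qed
      qed
      then show ?case by (intro tendsto_eventually) (auto elim: eventually_mono)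
    qed
    show "AE \<omega> in M. norm (?G n \<omega> - ?sv n \<omega> * of_bool (\<bar>B 1 \<omega>\<bar> < \<epsilon>)) \<le> 2" for n
    proof (intro AE_I2)
      fix \<omega>
      show "norm (?G n \<omega> - ?sv n \<omega> * of_bool (\<bar>B 1 \<omega>\<bar> < \<epsilon>)) \<le> 2"
        using sv[of n \<omega>] pw[of "card (high_labels z (\<lambda>u. R u \<omega>) n)"] by (cases "\<bar>B 1 \<omega>\<bar> < \<epsilon>") auto
    qed
  qed auto
  then have "(\<lambda>n. (\<integral>\<omega>. ?G n \<omega> \<partial>M) - (\<integral>\<omega>. ?sv n \<omega> * of_bool (\<bar>B 1 \<omega>\<bar> < \<epsilon>) \<partial>M)) \<longlonglongrightarrow> 0"
    using int by simp
  moreover have "(\<lambda>n. \<integral>\<omega>. (1 - ?sv n \<omega>) * of_bool (\<bar>B 1 \<omega>\<bar> < \<epsilon>) \<partial>M) \<longlonglongrightarrow> ?s"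
    by (rule survive_series_window) (use \<beta> \<epsilon> in auto)
  moreover have "(\<integral>\<omega>. (1 - ?sv n \<omega>) * of_bool (\<bar>B 1 \<omega>\<bar> < \<epsilon>) \<partial>M) =
      ?b - (\<integral>\<omega>. ?sv n \<omega> * of_bool (\<bar>B 1 \<omega>\<bar> < \<epsilon>) \<partial>M)" for n
  proof -
    have "?b = (\<integral>\<omega>. indicator {\<omega> \<in> space M. \<bar>B 1 \<omega>\<bar> < \<epsilon>} \<omega> \<partial>M)" by simp
    also have "\<dots> = (\<integral>\<omega>. of_bool (\<bar>B 1 \<omega>\<bar> < \<epsilon>) \<partial>M)"
      by (rule Bochner_Integration.integral_cong) (auto simp: indicator_def)
    finally show ?thesis using int by (simp add: left_diff_distrib)
  qed
  ultimately have "(\<lambda>n. ((\<integral>\<omega>. ?G n \<omega> \<partial>M) - (\<integral>\<omega>. ?sv n \<omega> * of_bool (\<bar>B 1 \<omega>\<bar> < \<epsilon>) \<partial>M)) +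
      (?b - (?b - (\<integral>\<omega>. ?sv n \<omega> * of_bool (\<bar>B 1 \<omega>\<bar> < \<epsilon>) \<partial>M)))) \<longlonglongrightarrow> 0 + (?b - ?s)"
    by (intro tendsto_add tendsto_diff tendsto_const) simp_all
  then have lim: "(\<lambda>n. prob (grid_below z \<epsilon> n)) \<longlonglongrightarrow> ?b - ?s"
    using grid_below_prob(2)[OF z] by simp
  have lim': "(\<lambda>n. prob (grid_below z \<epsilon> n)) \<longlonglongrightarrow> prob (\<Inter>n. grid_below z \<epsilon> n)"
  proof (rule finite_Lim_measure_decseq)
    show "decseq (grid_below z \<epsilon>)"
    proof (rule decseq_SucI, rule subsetI)
      fix n \<omega> assume \<omega>: "\<omega> \<in> grid_below z \<epsilon> (Suc n)"
      have "X (real j / 2 ^ n) \<omega> < z" if "j \<le> 2 ^ n" for j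
      proof -
        have "X (real (2 * j) / 2 ^ Suc n) \<omega> < z"
          using \<omega> that unfolding grid_below_def mem_Collect_eq by (metis mult_le_mono2 power_Suc)
        then show ?thesis by simp
      qed
      then show "\<omega> \<in> grid_below z \<epsilon> n" using \<omega> by (simp add: grid_below_def)
    qed
  qed auto
  have "(\<Inter>n. grid_below z \<epsilon> n) = ?A" by (auto simp: grid_below_def)
  with LIMSEQ_unique[OF lim' lim] show ?thesis by simp
qed

end

section \<open>Tail and density of the maximum\<close>

text \<open>The exponential is \<open>exp (- a\<^sup>2 / 2)\<close> with
  \<open>a = 2 * real (Suc k) * z\<close>, the ratio of the standard normal densities at
  \<open>a\<close> and at 0.\<close>

definition bridge_tail :: "real \<Rightarrow> real \<Rightarrow> real" where
  "bridge_tail \<beta> z = (\<Sum>k. 2 * \<beta> * (1 - 2 * \<beta>) ^ k * exp (- 2 * (real (Suc k))\<^sup>2 * z\<^sup>2))"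

text \<open>Differentiating the geometric series twice gives the coefficients
  \<open>(k + 1) * (k + 2)\<close>, which dominate the squares.\<close>

lemma summable_squares_geometric:
  fixes r :: real
  assumes "\<bar>r\<bar> < 1"
  shows "summable (\<lambda>k. (real (Suc k))\<^sup>2 * \<bar>r\<bar> ^ k)"
proof -
  have 1: "summable (\<lambda>n. diffs (\<lambda>_. 1) n * x ^ n)" if "norm x < 1" for x :: real
    using that by (rule termdiff_converges) (auto intro: summable_geometric)
  have 2: "summable (\<lambda>n. diffs (diffs (\<lambda>_. 1)) n * \<bar>r\<bar> ^ n)"
    by (rule termdiff_converges[where K = 1]) (use assms in \<open>auto intro: 1\<close>)
  have le: "(real (Suc k))\<^sup>2 * \<bar>r\<bar> ^ k \<le> diffs (diffs (\<lambda>_. 1)) k * \<bar>r\<bar> ^ k" for k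
    by (rule mult_right_mono) (auto simp: diffs_def power2_eq_square)
  show ?thesis
  proof (rule summable_comparison_test'[OF 2])
    show "norm ((real (Suc k))\<^sup>2 * \<bar>r\<bar> ^ k) \<le> diffs (diffs (\<lambda>_. 1)) k * \<bar>r\<bar> ^ k" for k
      using le[of k] by (simp add: abs_mult)
  qed
qed

lemma summable_bridge_density:
  assumes "0 < \<beta>" "\<beta> < 1"
  shows "summable (\<lambda>k. (1 - 2 * \<beta>) ^ k * (real (Suc k))\<^sup>2 * exp (- 2 * (real (Suc k))\<^sup>2 * z\<^sup>2))"
proof (rule summable_comparison_test'[OF summable_squares_geometric])
  show "\<bar>1 - 2 * \<beta>\<bar> < 1" using assms by auto
  show "norm ((1 - 2 * \<beta>) ^ k * (real (Suc k))\<^sup>2 * exp (- 2 * (real (Suc k))\<^sup>2 * z\<^sup>2)) \<le>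
     (real (Suc k))\<^sup>2 * \<bar>1 - 2 * \<beta>\<bar> ^ k" for k
    by (simp add: abs_mult power_abs mult.commute mult_left_le)
qed

lemma has_derivative_bridge_tail:
  assumes \<beta>: "0 < \<beta>" "\<beta> < 1"
  shows "(bridge_tail \<beta> has_real_derivative
    - (8 * \<beta> * z * (\<Sum>k. (1 - 2 * \<beta>) ^ k * (real (Suc k))\<^sup>2 * exp (- 2 * (real (Suc k))\<^sup>2 * z\<^sup>2)))) (at z)"
proof -
  let ?p = "1 - 2 * \<beta>"
  have p: "\<bar>?p\<bar> < 1" using \<beta> by auto
  define f where "f k x = 2 * \<beta> * ?p ^ k * exp (- 2 * (real (Suc k))\<^sup>2 * x\<^sup>2)" for k and x :: real
  define f' where "f' k x = - (8 * \<beta> * x) * (?p ^ k * (real (Suc k))\<^sup>2 * exp (- 2 * (real (Suc k))\<^sup>2 * x\<^sup>2))" for k and x :: real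
  have "((\<lambda>x. \<Sum>k. f k x) has_real_derivative (\<Sum>k. f' k z)) (at z)"
  proof (rule has_field_derivative_series'(2)[of UNIV f f' 0 z])
    show "(f k has_real_derivative f' k x) (at x within UNIV)" for k x
      unfolding f_def f'_def by (auto intro!: derivative_eq_intros simp: power2_eq_square)
    show "uniformly_convergent_on UNIV (\<lambda>n x. \<Sum>i<n. f' i x)"
    proof (rule Weierstrass_m_test')
      show "summable (\<lambda>k. 8 * \<beta> * ((real (Suc k))\<^sup>2 * \<bar>?p\<bar> ^ k))"
        by (intro summable_mult summable_squares_geometric p)
      show "norm (f' k x) \<le> 8 * \<beta> * ((real (Suc k))\<^sup>2 * \<bar>?p\<bar> ^ k)" for k x
      proof -
        \<comment> \<open>A bound free of \<open>x\<close> is wanted. The factor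
          \<open>\<bar>x\<bar>\<close> is at most \<open>exp (x\<^sup>2)\<close>, which the Gaussian
          factor absorbs already for \<open>k = 0\<close>.\<close>
        have "\<bar>x\<bar> \<le> 1 + x\<^sup>2"
          using sum_squares_bound[of "\<bar>x\<bar>" 1] by (simp add: power2_eq_square)
        also have "\<dots> \<le> exp (x\<^sup>2)" by (rule exp_ge_add_one_self)
        finally have "\<bar>x\<bar> * exp (- 2 * (real (Suc k))\<^sup>2 * x\<^sup>2) \<le> exp (x\<^sup>2) * exp (- 2 * (real (Suc k))\<^sup>2 * x\<^sup>2)"
          by (rule mult_right_mono) simp
        also have "\<dots> \<le> 1"
        proof -
          have "1 * x\<^sup>2 \<le> 2 * (real (Suc k))\<^sup>2 * x\<^sup>2"
            by (rule mult_right_mono) (auto simp: power2_eq_square algebra_simps)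
          then show ?thesis by (simp flip: exp_add)
        qed
        finally have "\<bar>x\<bar> * exp (- 2 * (real (Suc k))\<^sup>2 * x\<^sup>2) \<le> 1" .
        then have "(8 * \<beta> * ((real (Suc k))\<^sup>2 * \<bar>?p\<bar> ^ k)) * (\<bar>x\<bar> * exp (- 2 * (real (Suc k))\<^sup>2 * x\<^sup>2))
            \<le> 8 * \<beta> * ((real (Suc k))\<^sup>2 * \<bar>?p\<bar> ^ k)"
          using \<beta> by (intro mult_left_le) auto
        then show ?thesis using \<beta> by (simp add: f'_def abs_mult power_abs mult_ac)
      qed
    qed
    show "summable (\<lambda>k. f k 0)" unfolding f_def using p by (auto intro!: summable_mult summable_geometric)
  qed auto
  moreover have "(\<Sum>k. f' k z) =
    - (8 * \<beta> * z * (\<Sum>k. ?p ^ k * (real (Suc k))\<^sup>2 * exp (- 2 * (real (Suc k))\<^sup>2 * z\<^sup>2)))"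
    unfolding f'_def by (subst suminf_mult[OF summable_bridge_density[OF \<beta>]]) simp
  ultimately show ?thesis unfolding f_def bridge_tail_def[abs_def] by simp
qed

text \<open>The geometric series sums to \<open>1 / (2 * \<beta>)\<close>. The value 1 will exclude
  mass at or below 0.\<close>

lemma bridge_tail_0:
  assumes "0 < \<beta>" "\<beta> < 1"
  shows "bridge_tail \<beta> 0 = 1"
proof -
  have "\<bar>1 - 2 * \<beta>\<bar> < 1" using assms by auto
  then show ?thesis
    using assms by (simp add: bridge_tail_def suminf_mult summable_geometric suminf_geometric)
qed

lemma isCont_bridge_tail: "0 < \<beta> \<Longrightarrow> \<beta> < 1 \<Longrightarrow> isCont (bridge_tail \<beta>) z"
  using has_derivative_bridge_tail DERIV_isCont by blast

section \<open>Suprema of continuous functions on the unit interval\<close>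

lemma dyadic_near:
  assumes "u \<in> {0..1::real}"
  obtains j :: "nat \<Rightarrow> nat" where "\<And>n. j n \<le> 2 ^ n" "(\<lambda>n. real (j n) / 2 ^ n) \<longlonglongrightarrow> u"
proof
  define j where "j n = nat \<lfloor>u * 2 ^ n\<rfloor>" for n
  have j: "real (j n) \<le> u * 2 ^ n" "u * 2 ^ n < real (j n) + 1" for n
    unfolding j_def using assms by (auto simp: of_nat_nat)
  show "j n \<le> 2 ^ n" for n
  proof -
    have "u * 2 ^ n \<le> 1 * 2 ^ n" using assms by (intro mult_right_mono) auto
    then have "real (j n) \<le> 2 ^ n" using j(1)[of n] by linarith
    then show ?thesis by simp
  qed
  have near: "\<bar>real (j n) / 2 ^ n - u\<bar> \<le> (1 / 2) ^ n" for n
  proof -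
    have "real (j n) / 2 ^ n \<le> u" "u < (real (j n) + 1) / 2 ^ n"
      using j[of n] by (simp_all add: pos_divide_le_eq pos_less_divide_eq)
    then show ?thesis unfolding add_divide_distrib power_one_over by linarith
  qed
  have "(\<lambda>n. real (j n) / 2 ^ n - u) \<longlonglongrightarrow> 0"
  proof (rule Lim_null_comparison)
    show "\<forall>\<^sub>F n in sequentially. norm (real (j n) / 2 ^ n - u) \<le> (1 / 2) ^ n"
      unfolding real_norm_def by (intro always_eventually allI near)
    show "(\<lambda>n. (1 / 2 :: real) ^ n) \<longlonglongrightarrow> 0" by (rule LIMSEQ_power_zero) simp
  qed
  then show "(\<lambda>n. real (j n) / 2 ^ n) \<longlonglongrightarrow> u" by (rule LIM_zero_cancel)
qed

lemma dyadic_mem_unit: "j \<le> 2 ^ n \<Longrightarrow> real j / 2 ^ n \<in> {0..1}"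
  by (simp add: divide_le_eq_1)

lemma bdd_above_unit: "continuous_on {0..1} x \<Longrightarrow> bdd_above (x ` {0..1})" for x :: "real \<Rightarrow> real"
  by (intro bounded_imp_bdd_above compact_imp_bounded compact_continuous_image) auto

lemma SUP_unit_le_iff:
  fixes x :: "real \<Rightarrow> real"
  assumes x: "continuous_on {0..1} x"
  shows "(SUP u\<in>{0..1}. x u) \<le> a \<longleftrightarrow> (\<forall>n. \<forall>j\<le>2 ^ n. x (real j / 2 ^ n) \<le> a)"
proof
  assume "(SUP u\<in>{0..1}. x u) \<le> a"
  then show "\<forall>n. \<forall>j\<le>2 ^ n. x (real j / 2 ^ n) \<le> a"
    using cSUP_upper[OF dyadic_mem_unit bdd_above_unit[OF x]] by (meson order_trans)
next
  assume *: "\<forall>n. \<forall>j\<le>2 ^ n. x (real j / 2 ^ n) \<le> a"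
  show "(SUP u\<in>{0..1}. x u) \<le> a"
  proof (rule cSUP_least)
    fix u :: real assume u: "u \<in> {0..1}"
    obtain j :: "nat \<Rightarrow> nat" where j: "\<And>n. j n \<le> 2 ^ n" "(\<lambda>n. real (j n) / 2 ^ n) \<longlonglongrightarrow> u"
      using dyadic_near[OF u] by blast
    have "(\<lambda>n. x (real (j n) / 2 ^ n)) \<longlonglongrightarrow> x u"
      by (rule continuous_on_tendsto_compose[OF x j(2) u]) (intro always_eventually allI dyadic_mem_unit j)
    then show "x u \<le> a" by (rule LIMSEQ_le_const2) (use * j in auto)
  qed simp
qed

text \<open>With strict bounds only this direction holds: a strict bound at all dyadic times yields
  just a weak one for the supremum.\<close>

lemma SUP_unit_less:
  fixes x :: "real \<Rightarrow> real"
  assumes x: "continuous_on {0..1} x" and "(SUP u\<in>{0..1}. x u) < a" "j \<le> 2 ^ n"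
  shows "x (real j / 2 ^ n) < a"
  using cSUP_upper[OF dyadic_mem_unit bdd_above_unit[OF x]] assms by (meson le_less_trans)

lemma measurable_SUP_unit:
  fixes Z :: "real \<Rightarrow> 'c \<Rightarrow> real"
  assumes Z: "\<And>t. t \<in> {0..1} \<Longrightarrow> Z t \<in> borel_measurable P"
    and cont: "\<And>\<omega>. \<omega> \<in> space P \<Longrightarrow> continuous_on {0..1} (\<lambda>t. Z t \<omega>)"
  shows "(\<lambda>\<omega>. SUP u\<in>{0..1}. Z u \<omega>) \<in> borel_measurable P"
proof (rule borel_measurable_iff_le[THEN iffD2], rule allI)
  fix a
  have "{\<omega> \<in> space P. (SUP u\<in>{0..1}. Z u \<omega>) \<le> a} =
      {\<omega> \<in> space P. \<forall>n j. j \<in> {..2 ^ n} \<longrightarrow> Z (real j / 2 ^ n) \<omega> \<le> a}"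
    using SUP_unit_le_iff[OF cont] by auto
  also have "\<dots> \<in> sets P"
  proof (intro predE pred_intros_countable)
    fix n j :: nat
    show "Measurable.pred P (\<lambda>\<omega>. j \<in> {..2 ^ n} \<longrightarrow> Z (real j / 2 ^ n) \<omega> \<le> a)"
    proof (cases "j \<le> 2 ^ n")
      case True
      then have [measurable]: "Z (real j / 2 ^ n) \<in> borel_measurable P" by (intro Z dyadic_mem_unit)
      show ?thesis by measurable
    qed simp
  qed
  finally show "{\<omega> \<in> space P. (SUP u\<in>{0..1}. Z u \<omega>) \<le> a} \<in> sets P" .
qed

lemma apply_unit_path:
  assumes "continuous_on {0..1} (\<lambda>t. Z t \<omega>)" "u \<in> {0..1}"
  shows "apply_bcontfun (unit_path Z \<omega>) u = Z u \<omega>"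
proof -
  have c: "continuous_on (cbox 0 1) (\<lambda>t. Z t \<omega>)" using assms by simp
  have "continuous_on UNIV (ext_cont (\<lambda>t. Z t \<omega>) 0 1)" by (rule continuous_on_ext_cont[OF c])
  moreover have "bounded (range (ext_cont (\<lambda>t. Z t \<omega>) 0 1))"
  proof (rule bounded_subset)
    show "bounded ((\<lambda>t. Z t \<omega>) ` cbox 0 1)"
      by (intro compact_imp_bounded compact_continuous_image c compact_cbox)
    show "range (ext_cont (\<lambda>t. Z t \<omega>) 0 1) \<subseteq> (\<lambda>t. Z t \<omega>) ` cbox 0 1"
      by (auto simp: ext_cont_def intro!: imageI clamp_in_interval simp del: box_real)
  qed
  ultimately have "apply_bcontfun (unit_path Z \<omega>) = ext_cont (\<lambda>t. Z t \<omega>) 0 1"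
    unfolding unit_path_def by (intro Bcontfun_inverse) (simp add: bcontfun_def)
  then show ?thesis using assms by simp
qed

lemma continuous_SUP_bcontfun:
  "continuous_on UNIV (\<lambda>g :: real \<Rightarrow>\<^sub>C real. SUP u\<in>{0..1::real}. apply_bcontfun g u)"
proof -
  have le: "(SUP u\<in>{0..1}. apply_bcontfun g u) \<le> (SUP u\<in>{0..1}. apply_bcontfun h u) + dist g h"
    for g h :: "real \<Rightarrow>\<^sub>C real"
  proof (rule cSUP_least)
    fix u :: real assume u: "u \<in> {0..1}"
    have "apply_bcontfun h u \<le> (SUP u\<in>{0..1}. apply_bcontfun h u)"
      by (rule cSUP_upper[OF u bdd_above_unit]) simp
    moreover have "\<bar>apply_bcontfun g u - apply_bcontfun h u\<bar> \<le> dist g h"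
      using dist_bounded[of g u h] by (simp add: dist_real_def)
    ultimately show "apply_bcontfun g u \<le> (SUP u\<in>{0..1}. apply_bcontfun h u) + dist g h" by linarith
  qed simp
  show ?thesis
  proof (rule lipschitz_on_continuous_on[of 1], rule lipschitz_onI)
    show "dist (SUP u\<in>{0..1}. apply_bcontfun g u) (SUP u\<in>{0..1}. apply_bcontfun h u) \<le> 1 * dist g h" for g h :: "real \<Rightarrow>\<^sub>C real"
      using le[of g h] le[of h g] by (simp add: dist_real_def dist_commute)
  qed simp
qed

section \<open>Gaussian windows and their ratios\<close>

context brownian_motion
begin

definition window :: "real \<Rightarrow> real \<Rightarrow> real" where
  "window a \<epsilon> = prob {\<omega> \<in> space M. \<bar>B 1 \<omega> - a\<bar> < \<epsilon>}"

text \<open>Shifting by \<open>a\<close> makes all windows integrals over the same interval, where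
  the densities can be compared pointwise.\<close>

lemma window_eq_nn_integral:
  "ennreal (window a \<epsilon>) = (\<integral>\<^sup>+ x. ennreal (std_normal_density (a + x)) * indicator {-\<epsilon><..<\<epsilon>} x \<partial>lborel)"
proof -
  have D: "distributed M lborel (B 1) std_normal_density" using distributed_B[of 1] by simp
  have "ennreal (window a \<epsilon>) = emeasure M (B 1 -` {a - \<epsilon><..<a + \<epsilon>} \<inter> space M)"
    unfolding window_def emeasure_eq_measure by (auto intro!: arg_cong[where f = prob])
  also have "\<dots> = (\<integral>\<^sup>+ x. ennreal (std_normal_density x) * indicator {a - \<epsilon><..<a + \<epsilon>} x \<partial>lborel)"
    by (rule distributed_emeasure[OF D]) simp
  also have "\<dots> = (\<integral>\<^sup>+ x. ennreal (std_normal_density (a + x)) * indicator {a - \<epsilon><..<a + \<epsilon>} (a + x) \<partial>lborel)"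
    by (subst nn_integral_real_affine[where t = a and c = 1]) auto
  also have "\<dots> = (\<integral>\<^sup>+ x. ennreal (std_normal_density (a + x)) * indicator {-\<epsilon><..<\<epsilon>} x \<partial>lborel)"
    by (intro nn_integral_cong) (auto simp: indicator_def)
  finally show ?thesis .
qed

lemma window_nonneg: "0 \<le> window a \<epsilon>"
  by (simp add: window_def)

lemma std_normal_density_shift:
  "std_normal_density (a + x) = std_normal_density x * exp (- a\<^sup>2 / 2 - a * x)"
  by (simp add: std_normal_density_def power2_sum field_simps flip: exp_add)

lemma window_upper: "window a \<epsilon> \<le> exp (- a\<^sup>2 / 2 + \<bar>a\<bar> * \<epsilon>) * window 0 \<epsilon>"
proof -
  let ?c = "exp (- a\<^sup>2 / 2 + \<bar>a\<bar> * \<epsilon>)"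
  have "std_normal_density (a + x) \<le> ?c * std_normal_density x" if "\<bar>x\<bar> < \<epsilon>" for x
  proof -
    have "\<bar>a * x\<bar> \<le> \<bar>a\<bar> * \<epsilon>" unfolding abs_mult using that by (intro mult_left_mono) auto
    then have "exp (- a\<^sup>2 / 2 - a * x) \<le> ?c" by (simp add: abs_le_iff)
    then show ?thesis unfolding std_normal_density_shift by (subst mult.commute) (intro mult_right_mono, auto)
  qed
  then have "ennreal (window a \<epsilon>) \<le> (\<integral>\<^sup>+ x. ennreal ?c * (ennreal (std_normal_density (0 + x)) * indicator {-\<epsilon><..<\<epsilon>} x) \<partial>lborel)"
    unfolding window_eq_nn_integral
    by (intro nn_integral_mono) (auto simp: indicator_def ennreal_mult'[symmetric] intro!: ennreal_leI)
  also have "\<dots> = ennreal ?c * ennreal (window 0 \<epsilon>)"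
    unfolding window_eq_nn_integral by (rule nn_integral_cmult) auto
  finally show ?thesis using window_nonneg by (simp add: ennreal_mult'[symmetric] ennreal_le_iff)
qed

lemma window_lower: "exp (- a\<^sup>2 / 2 - \<bar>a\<bar> * \<epsilon>) * window 0 \<epsilon> \<le> window a \<epsilon>"
proof -
  let ?c = "exp (- a\<^sup>2 / 2 - \<bar>a\<bar> * \<epsilon>)"
  have "?c * std_normal_density x \<le> std_normal_density (a + x)" if "\<bar>x\<bar> < \<epsilon>" for x
  proof -
    have "\<bar>a * x\<bar> \<le> \<bar>a\<bar> * \<epsilon>" unfolding abs_mult using that by (intro mult_left_mono) auto
    then have "?c \<le> exp (- a\<^sup>2 / 2 - a * x)" by (simp add: abs_le_iff)
    then show ?thesis unfolding std_normal_density_shift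
      by (subst (2) mult.commute) (intro mult_right_mono, auto)
  qed
  then have "(\<integral>\<^sup>+ x. ennreal ?c * (ennreal (std_normal_density (0 + x)) * indicator {-\<epsilon><..<\<epsilon>} x) \<partial>lborel) \<le> ennreal (window a \<epsilon>)"
    unfolding window_eq_nn_integral
    by (intro nn_integral_mono) (auto simp: indicator_def ennreal_mult'[symmetric] intro!: ennreal_leI)
  moreover have "(\<integral>\<^sup>+ x. ennreal ?c * (ennreal (std_normal_density (0 + x)) * indicator {-\<epsilon><..<\<epsilon>} x) \<partial>lborel) =
      ennreal ?c * ennreal (window 0 \<epsilon>)"
    unfolding window_eq_nn_integral by (rule nn_integral_cmult) auto
  ultimately show ?thesis using window_nonneg by (simp add: ennreal_mult'[symmetric] ennreal_le_iff)
qed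

lemma window_pos:
  assumes "0 < \<epsilon>"
  shows "0 < window 0 \<epsilon>"
proof -
  have "0 < ennreal (std_normal_density \<epsilon> * (2 * \<epsilon>))"
    using assms by (simp add: normal_density_pos ennreal_zero_less_mult_iff del: ennreal_mult)
  also have "\<dots> = (\<integral>\<^sup>+ x. ennreal (std_normal_density \<epsilon>) * indicator {-\<epsilon><..<\<epsilon>} x \<partial>lborel)"
    using assms by (subst nn_integral_cmult_indicator) (auto simp: ennreal_mult)
  also have "\<dots> \<le> ennreal (window 0 \<epsilon>)"
    unfolding window_eq_nn_integral
  proof (intro nn_integral_mono)
    fix x
    have "std_normal_density \<epsilon> \<le> std_normal_density x" if "\<bar>x\<bar> < \<epsilon>"
    proof -
      have "x\<^sup>2 \<le> \<epsilon>\<^sup>2" using that abs_le_square_iff[of x \<epsilon>] by auto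
      then show ?thesis by (simp add: std_normal_density_def divide_right_mono)
    qed
    then show "ennreal (std_normal_density \<epsilon>) * indicator {-\<epsilon><..<\<epsilon>} x
        \<le> ennreal (std_normal_density (0 + x)) * indicator {-\<epsilon><..<\<epsilon>} x"
      by (auto simp: indicator_def intro!: ennreal_leI)
  qed
  finally show ?thesis by simp
qed

lemma window_ratio_tendsto:
  "((\<lambda>\<epsilon>. window a \<epsilon> / window 0 \<epsilon>) \<longlongrightarrow> exp (- a\<^sup>2 / 2)) (at_right 0)"
proof (rule tendsto_sandwich)
  have pos: "\<forall>\<^sub>F \<epsilon> in at_right 0. 0 < (\<epsilon> :: real)" by (simp add: eventually_at_right_less)
  show "\<forall>\<^sub>F \<epsilon> in at_right 0. exp (- a\<^sup>2 / 2 - \<bar>a\<bar> * \<epsilon>) \<le> window a \<epsilon> / window 0 \<epsilon>"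
    using pos by eventually_elim (use window_lower window_pos in \<open>auto simp: pos_le_divide_eq\<close>)
  show "\<forall>\<^sub>F \<epsilon> in at_right 0. window a \<epsilon> / window 0 \<epsilon> \<le> exp (- a\<^sup>2 / 2 + \<bar>a\<bar> * \<epsilon>)"
    using pos by eventually_elim (use window_upper window_pos in \<open>auto simp: pos_divide_le_eq\<close>)
  have "((\<lambda>\<epsilon>. exp (- a\<^sup>2 / 2 - \<bar>a\<bar> * \<epsilon>)) \<longlongrightarrow> exp (- a\<^sup>2 / 2 - \<bar>a\<bar> * 0)) (at_right 0)"
    by (intro tendsto_intros)
  then show "((\<lambda>\<epsilon>. exp (- a\<^sup>2 / 2 - \<bar>a\<bar> * \<epsilon>)) \<longlongrightarrow> exp (- a\<^sup>2 / 2)) (at_right 0)" by simp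
  have "((\<lambda>\<epsilon>. exp (- a\<^sup>2 / 2 + \<bar>a\<bar> * \<epsilon>)) \<longlongrightarrow> exp (- a\<^sup>2 / 2 + \<bar>a\<bar> * 0)) (at_right 0)"
    by (intro tendsto_intros)
  then show "((\<lambda>\<epsilon>. exp (- a\<^sup>2 / 2 + \<bar>a\<bar> * \<epsilon>)) \<longlongrightarrow> exp (- a\<^sup>2 / 2)) (at_right 0)" by simp
qed

end

section \<open>Conditioning on a small end point and passage to the bridge\<close>

context signed_excursions
begin

definition dyadic_below :: "real \<Rightarrow> 'a set" where
  "dyadic_below z = {\<omega> \<in> space M. \<forall>n. \<forall>j\<le>2 ^ n. X (real j / 2 ^ n) \<omega> < z}"

abbreviation near_0 :: "real \<Rightarrow> 'a set" where
  "near_0 \<epsilon> \<equiv> {\<omega> \<in> space M. \<bar>X 1 \<omega>\<bar> < \<epsilon>}"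

lemma dyadic_below_measurable [measurable]: "dyadic_below z \<in> sets M"
proof -
  have [measurable]: "X (real j / 2 ^ n) \<in> borel_measurable M" for j n by (rule measurable_X) simp
  show ?thesis unfolding dyadic_below_def by measurable
qed

lemma prob_near_0: "prob (near_0 \<epsilon>) = window 0 \<epsilon>"
  unfolding window_def by (rule arg_cong[where f = prob]) (auto simp: abs_X)

text \<open>Division by \<open>window 0 \<epsilon>\<close> turns each term of
  \<open>prob_dyadic_below\<close> into a ratio of Gaussian windows, and dominated summation gives
  the limit.\<close>

lemma conditional_dyadic_below_tendsto:
  assumes z: "0 < z"
  shows "((\<lambda>\<epsilon>. prob (near_0 \<epsilon> \<inter> dyadic_below z) / prob (near_0 \<epsilon>)) \<longlongrightarrow> 1 - bridge_tail \<beta> z) (at_right 0)"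
proof -
  let ?p = "1 - 2 * \<beta>" and ?r = "\<lambda>m \<epsilon>. window (2 * real (Suc m) * z) \<epsilon> / window 0 \<epsilon>"
  have p: "\<bar>?p\<bar> < 1" using \<beta> by auto
  have ev: "\<forall>\<^sub>F \<epsilon> in at_right 0. 0 < \<epsilon> \<and> \<epsilon> \<le> z"
    unfolding eventually_at_right_field using z by (intro exI[of _ z]) auto
  have "((\<lambda>\<epsilon>. \<Sum>m. 2 * \<beta> * ?p ^ m * ?r m \<epsilon>) \<longlongrightarrow> (\<Sum>m. 2 * \<beta> * ?p ^ m * exp (- 2 * (real (Suc m))\<^sup>2 * z\<^sup>2))) (at_right 0)"
  proof (rule tendsto_suminf_dominated)
    show "((\<lambda>\<epsilon>. 2 * \<beta> * ?p ^ m * ?r m \<epsilon>) \<longlongrightarrow> 2 * \<beta> * ?p ^ m * exp (- 2 * (real (Suc m))\<^sup>2 * z\<^sup>2)) (at_right 0)" for m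
    proof -
      have eq: "- (2 * real (Suc m) * z)\<^sup>2 / 2 = - 2 * (real (Suc m))\<^sup>2 * z\<^sup>2"
        by (simp add: power_mult_distrib del: of_nat_Suc)
      show ?thesis
        unfolding eq[symmetric] by (rule tendsto_mult_left[OF window_ratio_tendsto])
    qed
    show "\<forall>\<^sub>F \<epsilon> in at_right 0. \<forall>m. \<bar>2 * \<beta> * ?p ^ m * ?r m \<epsilon>\<bar> \<le> 2 * \<beta> * \<bar>?p\<bar> ^ m"
      using ev
    proof (rule eventually_mono, intro allI)
      fix \<epsilon> m assume \<epsilon>: "0 < \<epsilon> \<and> \<epsilon> \<le> z"
      let ?a = "2 * real (Suc m) * z"
      \<comment> \<open>As \<open>\<epsilon> \<le> z \<le> ?a / 2\<close>, the exponent in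
        \<open>window_upper\<close> is at most 0, so that all ratios are bounded by 1.\<close>
      have "?a * \<epsilon> \<le> ?a * z" using \<epsilon> z by (intro mult_left_mono) auto
      also have "z \<le> ?a / 2" using z by simp
      then have "?a * z \<le> ?a * (?a / 2)" using z by (intro mult_left_mono) auto
      finally have "- ?a\<^sup>2 / 2 + \<bar>?a\<bar> * \<epsilon> \<le> 0" using z by (simp add: power2_eq_square)
      then have "exp (- ?a\<^sup>2 / 2 + \<bar>?a\<bar> * \<epsilon>) * window 0 \<epsilon> \<le> 1 * window 0 \<epsilon>"
        by (intro mult_right_mono) (auto simp: window_nonneg)
      then have "window ?a \<epsilon> \<le> window 0 \<epsilon>" using window_upper[of ?a \<epsilon>] by linarith
      then have "\<bar>?r m \<epsilon>\<bar> \<le> 1" using window_pos[of \<epsilon>] window_nonneg[of ?a \<epsilon>] \<epsilon> by simp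
      then have "2 * \<beta> * \<bar>?p\<bar> ^ m * \<bar>?r m \<epsilon>\<bar> \<le> 2 * \<beta> * \<bar>?p\<bar> ^ m" using \<beta> by (intro mult_left_le) auto
      then show "\<bar>2 * \<beta> * ?p ^ m * ?r m \<epsilon>\<bar> \<le> 2 * \<beta> * \<bar>?p\<bar> ^ m" using \<beta> by (simp add: abs_mult power_abs)
    qed
    show "summable (\<lambda>m. 2 * \<beta> * \<bar>?p\<bar> ^ m)" using p by (intro summable_mult summable_geometric) auto
  qed simp
  then have "((\<lambda>\<epsilon>. 1 - (\<Sum>m. 2 * \<beta> * ?p ^ m * ?r m \<epsilon>)) \<longlongrightarrow> 1 - bridge_tail \<beta> z) (at_right 0)"
    unfolding bridge_tail_def by (intro tendsto_diff tendsto_const)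
  moreover have "\<forall>\<^sub>F \<epsilon> in at_right 0. 1 - (\<Sum>m. 2 * \<beta> * ?p ^ m * ?r m \<epsilon>) =
      prob (near_0 \<epsilon> \<inter> dyadic_below z) / prob (near_0 \<epsilon>)"
    using ev
  proof eventually_elim
    case (elim \<epsilon>)
    have "near_0 \<epsilon> \<inter> dyadic_below z =
        {\<omega> \<in> space M. (\<forall>n. \<forall>j\<le>2 ^ n. X (real j / 2 ^ n) \<omega> < z) \<and> \<bar>X 1 \<omega>\<bar> < \<epsilon>}"
      by (auto simp: dyadic_below_def)
    then have eq: "prob (near_0 \<epsilon> \<inter> dyadic_below z) =
        window 0 \<epsilon> - 2 * \<beta> * (\<Sum>m. ?p ^ m * window (2 * real (Suc m) * z) \<epsilon>)"
      using prob_dyadic_below[of \<epsilon> z] elim by (simp add: window_def)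
    have w: "window 0 \<epsilon> \<noteq> 0" using window_pos[of \<epsilon>] elim by simp
    have "summable (\<lambda>m. ?p ^ m * window (2 * real (Suc m) * z) \<epsilon>)"
    proof (rule summable_comparison_test')
      show "summable (\<lambda>m. \<bar>?p\<bar> ^ m)" using p by (intro summable_geometric) auto
      show "norm (?p ^ m * window (2 * real (Suc m) * z) \<epsilon>) \<le> \<bar>?p\<bar> ^ m" for m
        by (simp add: abs_mult power_abs window_def mult_left_le)
    qed
    then have "(\<Sum>m. ?p ^ m * window (2 * real (Suc m) * z) \<epsilon> * (2 * \<beta> / window 0 \<epsilon>)) =
        (\<Sum>m. ?p ^ m * window (2 * real (Suc m) * z) \<epsilon>) * (2 * \<beta> / window 0 \<epsilon>)"
      by (rule suminf_mult2[symmetric])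
    moreover have "(\<lambda>m. ?p ^ m * window (2 * real (Suc m) * z) \<epsilon> * (2 * \<beta> / window 0 \<epsilon>)) =
        (\<lambda>m. 2 * \<beta> * ?p ^ m * ?r m \<epsilon>)"
      by (simp add: fun_eq_iff)
    ultimately show ?case
      unfolding prob_near_0 eq using w by (simp add: diff_divide_distrib)
  qed
  ultimately show ?thesis by (rule Lim_transform_eventually)
qed

text \<open>Weak convergence sees continuous functionals only. The indicator of a low maximum is
  therefore replaced by a ramp falling from 1 at \<open>z1\<close> to 0 at \<open>z2\<close>,
  applied to the supremum.\<close>

lemma bridge_test_function_bounds:
  assumes Y: "conditioned_to_vanish_at_1 M X N Y" and z: "0 < z1" "z1 < z2"
  defines "\<phi> \<equiv> \<lambda>x. max 0 (min 1 ((z2 - x) / (z2 - z1)))"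
  shows "1 - bridge_tail \<beta> z1 \<le> (\<integral>\<omega>. \<phi> (SUP u\<in>{0..1}. Y u \<omega>) \<partial>N)"
    and "(\<integral>\<omega>. \<phi> (SUP u\<in>{0..1}. Y u \<omega>) \<partial>N) \<le> 1 - bridge_tail \<beta> z2"
proof -
  let ?D = "\<lambda>\<omega>. SUP u\<in>{0..1}. X u \<omega>"
  define F where "F g = \<phi> (SUP u\<in>{0..1::real}. apply_bcontfun g u)" for g :: "real \<Rightarrow>\<^sub>C real"
  have \<phi>_cont: "continuous_on UNIV \<phi>" unfolding \<phi>_def by (intro continuous_intros) (use z in auto)
  have [measurable]: "\<phi> \<in> borel_measurable borel" by (rule borel_measurable_continuous_onI[OF \<phi>_cont])
  have \<phi>01: "0 \<le> \<phi> x" "\<phi> x \<le> 1" for x by (auto simp: \<phi>_def)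
  have \<phi>_1: "\<phi> x = 1" if "x \<le> z1" for x using that z by (simp add: \<phi>_def min_def)
  have \<phi>_0: "\<phi> x = 0" if "z2 \<le> x" for x using that z by (simp add: \<phi>_def divide_nonpos_pos)
  have "continuous_on UNIV F"
    unfolding F_def by (rule continuous_on_compose2[OF \<phi>_cont continuous_SUP_bcontfun]) simp
  moreover have "bounded (range F)"
    unfolding bounded_iff F_def using \<phi>01 by (intro exI[of _ 1]) auto
  ultimately have lim: "((\<lambda>\<epsilon>. \<integral>\<omega>. F (unit_path X \<omega>) \<partial>uniform_measure M (near_0 \<epsilon>))
           \<longlongrightarrow> (\<integral>\<omega>. F (unit_path Y \<omega>) \<partial>N)) (at_right 0)"
    using Y unfolding conditioned_to_vanish_at_1_def by blast
  have X_cont: "continuous_on {0..1} (\<lambda>t. X t \<omega>)" if "\<omega> \<in> space M" for \<omega>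
    by (rule continuous_on_subset[OF continuous_X[OF that]]) auto
  have Y_cont: "continuous_on {0..1} (\<lambda>t. Y t \<omega>)" if "\<omega> \<in> space N" for \<omega>
    using Y that by (simp add: conditioned_to_vanish_at_1_def)
  have FX: "F (unit_path X \<omega>) = \<phi> (?D \<omega>)" if "\<omega> \<in> space M" for \<omega>
    unfolding F_def using apply_unit_path[of X \<omega>, OF X_cont[OF that]] by (intro arg_cong[where f = \<phi>] SUP_cong) auto
  have "F (unit_path Y \<omega>) = \<phi> (SUP u\<in>{0..1}. Y u \<omega>)" if "\<omega> \<in> space N" for \<omega>
    unfolding F_def using apply_unit_path[of Y \<omega>, OF Y_cont[OF that]] by (intro arg_cong[where f = \<phi>] SUP_cong) auto
  then have FY: "(\<integral>\<omega>. F (unit_path Y \<omega>) \<partial>N) = (\<integral>\<omega>. \<phi> (SUP u\<in>{0..1}. Y u \<omega>) \<partial>N)"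
    by (rule Bochner_Integration.integral_cong[OF refl])
  have D [measurable]: "?D \<in> borel_measurable M"
    by (rule measurable_SUP_unit) (auto intro: measurable_X X_cont)
  have [measurable]: "X 1 \<in> borel_measurable M" by (rule measurable_X) simp
  have pos: "\<forall>\<^sub>F \<epsilon> in at_right 0. 0 < (\<epsilon> :: real)" by (simp add: eventually_at_right_less)
  \<comment> \<open>For fixed \<open>\<epsilon>\<close>, the ramp lies on every path between the
    indicators of \<open>dyadic_below z1\<close> and \<open>dyadic_below z2\<close>.\<close>
  have bounds: "prob (near_0 \<epsilon> \<inter> dyadic_below z1) / prob (near_0 \<epsilon>) \<le> (\<integral>\<omega>. F (unit_path X \<omega>) \<partial>uniform_measure M (near_0 \<epsilon>))"
    "(\<integral>\<omega>. F (unit_path X \<omega>) \<partial>uniform_measure M (near_0 \<epsilon>)) \<le> prob (near_0 \<epsilon> \<inter> dyadic_below z2) / prob (near_0 \<epsilon>)"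
    if \<epsilon>: "0 < \<epsilon>" for \<epsilon>
  proof -
    let ?U = "uniform_measure M (near_0 \<epsilon>)"
    have nz: "emeasure M (near_0 \<epsilon>) \<noteq> 0" "emeasure M (near_0 \<epsilon>) \<noteq> \<infinity>"
      using window_pos[OF \<epsilon>] prob_near_0[of \<epsilon>] by (auto simp: emeasure_eq_measure)
    interpret U: prob_space ?U by (rule prob_space_uniform_measure[OF nz])
    have cond: "measure ?U (dyadic_below z) = prob (near_0 \<epsilon> \<inter> dyadic_below z) / prob (near_0 \<epsilon>)" for z
      by (rule measure_uniform_measure[OF nz]) simp
    have ind: "measure ?U (dyadic_below z) = (\<integral>\<omega>. indicator (dyadic_below z) \<omega> \<partial>?U)" for z
      using sets.sets_into_space[OF dyadic_below_measurable[of z]] by (simp add: Int_absorb2)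
    have Feq: "(\<integral>\<omega>. F (unit_path X \<omega>) \<partial>?U) = (\<integral>\<omega>. \<phi> (?D \<omega>) \<partial>?U)"
      by (rule Bochner_Integration.integral_cong[OF refl]) (simp add: FX)
    have int: "integrable ?U (\<lambda>\<omega>. \<phi> (?D \<omega>))"
      by (rule U.integrable_abs_le_1) (auto simp: \<phi>01)
    have int': "integrable ?U (indicator (dyadic_below z) :: 'a \<Rightarrow> real)" for z
      by (rule U.integrable_abs_le_1) auto
    have "(\<integral>\<omega>. indicator (dyadic_below z1) \<omega> \<partial>?U) \<le> (\<integral>\<omega>. \<phi> (?D \<omega>) \<partial>?U)"
    proof (rule integral_mono[OF int' int])
      fix \<omega> assume "\<omega> \<in> space ?U"
      then have \<omega>: "\<omega> \<in> space M" by simp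
      show "indicator (dyadic_below z1) \<omega> \<le> \<phi> (?D \<omega>)"
      proof (cases "\<omega> \<in> dyadic_below z1")
        case True
        then have "?D \<omega> \<le> z1"
          by (subst SUP_unit_le_iff[OF X_cont[OF \<omega>]]) (auto simp: dyadic_below_def intro: less_imp_le)
        then show ?thesis by (simp add: \<phi>_1)
      qed (simp add: \<phi>01)
    qed
    then show "prob (near_0 \<epsilon> \<inter> dyadic_below z1) / prob (near_0 \<epsilon>) \<le> (\<integral>\<omega>. F (unit_path X \<omega>) \<partial>?U)"
      unfolding Feq by (simp only: ind[symmetric] cond)
    have "(\<integral>\<omega>. \<phi> (?D \<omega>) \<partial>?U) \<le> (\<integral>\<omega>. indicator (dyadic_below z2) \<omega> \<partial>?U)"
    proof (rule integral_mono[OF int int'])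
      fix \<omega> assume "\<omega> \<in> space ?U"
      then have \<omega>: "\<omega> \<in> space M" by simp
      show "\<phi> (?D \<omega>) \<le> indicator (dyadic_below z2) \<omega>"
      proof (cases "?D \<omega> < z2")
        case True
        then have "\<omega> \<in> dyadic_below z2"
          using SUP_unit_less[OF X_cont[OF \<omega>] True] \<omega> by (simp add: dyadic_below_def)
        then show ?thesis by (simp add: \<phi>01)
      qed (simp add: \<phi>_0)
    qed
    then show "(\<integral>\<omega>. F (unit_path X \<omega>) \<partial>?U) \<le> prob (near_0 \<epsilon> \<inter> dyadic_below z2) / prob (near_0 \<epsilon>)"
      unfolding Feq by (simp only: ind[symmetric] cond)
  qed
  show "1 - bridge_tail \<beta> z1 \<le> (\<integral>\<omega>. \<phi> (SUP u\<in>{0..1}. Y u \<omega>) \<partial>N)"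
    unfolding FY[symmetric]
    by (rule tendsto_le[OF _ lim conditional_dyadic_below_tendsto])
      (use z in \<open>auto intro!: eventually_mono[OF pos] bounds\<close>)
  show "(\<integral>\<omega>. \<phi> (SUP u\<in>{0..1}. Y u \<omega>) \<partial>N) \<le> 1 - bridge_tail \<beta> z2"
    unfolding FY[symmetric]
    by (rule tendsto_le[OF _ conditional_dyadic_below_tendsto lim])
      (use z in \<open>auto intro!: eventually_mono[OF pos] bounds\<close>)
qed

text \<open>Ramps just above and just below \<open>z\<close> squeeze the probability, and continuity
  of \<open>bridge_tail\<close> makes the two bounds meet.\<close>

lemma bridge_max_cdf:
  assumes Y: "conditioned_to_vanish_at_1 M X N Y" and z: "0 < z"
  shows "measure N {\<omega> \<in> space N. (SUP u\<in>{0..1}. Y u \<omega>) \<le> z} = 1 - bridge_tail \<beta> z"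
proof -
  let ?D = "\<lambda>\<omega>. SUP u\<in>{0..1}. Y u \<omega>"
  interpret N: prob_space N using Y by (simp add: conditioned_to_vanish_at_1_def)
  have [measurable]: "?D \<in> borel_measurable N"
    using Y by (intro measurable_SUP_unit) (auto simp: conditioned_to_vanish_at_1_def)
  have cont: "(bridge_tail \<beta> \<longlongrightarrow> bridge_tail \<beta> z) (at z within A)" for A
    using isCont_bridge_tail[OF \<beta>, of z] by (auto simp: isCont_def intro: tendsto_within_subset)
  have prob_ind: "N.prob {\<omega> \<in> space N. ?D \<omega> \<le> z} = (\<integral>\<omega>. indicator {\<omega> \<in> space N. ?D \<omega> \<le> z} \<omega> \<partial>N)" by simp
  have "N.prob {\<omega> \<in> space N. ?D \<omega> \<le> z} \<le> 1 - bridge_tail \<beta> z2" if "z < z2" for z2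
  proof -
    define \<phi> where "\<phi> x = max 0 (min 1 ((z2 - x) / (z2 - z)))" for x
    have [measurable]: "\<phi> \<in> borel_measurable borel" unfolding \<phi>_def by measurable
    have "(\<integral>\<omega>. indicator {\<omega> \<in> space N. ?D \<omega> \<le> z} \<omega> \<partial>N) \<le> (\<integral>\<omega>. \<phi> (?D \<omega>) \<partial>N)"
    proof (rule integral_mono)
      show "integrable N (\<lambda>\<omega>. \<phi> (?D \<omega>))" by (rule N.integrable_abs_le_1) (auto simp: \<phi>_def)
      show "indicator {\<omega> \<in> space N. ?D \<omega> \<le> z} \<omega> \<le> \<phi> (?D \<omega>)" for \<omega>
        using that by (auto simp: \<phi>_def indicator_def min_def max_def pos_divide_le_eq not_le)
    qed (rule N.integrable_abs_le_1, auto)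
    then show ?thesis
      using bridge_test_function_bounds(2)[OF Y z that] prob_ind unfolding \<phi>_def by linarith
  qed
  then have "N.prob {\<omega> \<in> space N. ?D \<omega> \<le> z} \<le> 1 - bridge_tail \<beta> z"
    by (intro tendsto_lowerbound[OF tendsto_diff[OF tendsto_const cont[of "{z<..}"]]])
      (auto simp: eventually_at_right_less eventually_mono[OF eventually_at_right_less[of z]])
  moreover have "1 - bridge_tail \<beta> z1 \<le> N.prob {\<omega> \<in> space N. ?D \<omega> \<le> z}" if z1: "0 < z1" "z1 < z" for z1
  proof -
    define \<phi> where "\<phi> x = max 0 (min 1 ((z - x) / (z - z1)))" for x
    have [measurable]: "\<phi> \<in> borel_measurable borel" unfolding \<phi>_def by measurable
    have "(\<integral>\<omega>. \<phi> (?D \<omega>) \<partial>N) \<le> (\<integral>\<omega>. indicator {\<omega> \<in> space N. ?D \<omega> \<le> z} \<omega> \<partial>N)"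
    proof (rule integral_mono)
      show "integrable N (\<lambda>\<omega>. \<phi> (?D \<omega>))" by (rule N.integrable_abs_le_1) (auto simp: \<phi>_def)
      show "\<phi> (?D \<omega>) \<le> indicator {\<omega> \<in> space N. ?D \<omega> \<le> z} \<omega>" if "\<omega> \<in> space N" for \<omega>
        using that z1 divide_nonpos_pos[of "z - ?D \<omega>" "z - z1"] by (auto simp: \<phi>_def indicator_def)
    qed (rule N.integrable_abs_le_1, auto)
    then show ?thesis
      using bridge_test_function_bounds(1)[OF Y z1] prob_ind unfolding \<phi>_def by linarith
  qed
  then have "1 - bridge_tail \<beta> z \<le> N.prob {\<omega> \<in> space N. ?D \<omega> \<le> z}"
    using z by (intro tendsto_upperbound[OF tendsto_diff[OF tendsto_const cont[of "{..<z}"]]])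
      (auto intro!: eventually_at_leftI[of 0])
  ultimately show ?thesis by simp
qed

end

section \<open>Density of the maximum\<close>

lemma skew_brownian_motion_signed_excursions:
  assumes "skew_brownian_motion \<beta> M X" "0 < \<beta>" "\<beta> < 1"
  obtains B R S where "signed_excursions M B \<beta> X R S"
proof -
  obtain R S where RS: "reflected_brownian_motion M R"
    "prob_space.indep_vars M (\<lambda>_. count_space UNIV) S UNIV"
    "\<forall>n. distr M (count_space UNIV) (S n) = measure_pmf (bernoulli_pmf \<beta>)"
    "prob_space.indep_set M
          (sets (vimage_algebra (space M) (\<lambda>\<omega>. \<lambda>t\<in>{0..}. R t \<omega>) (\<Pi>\<^sub>M t\<in>{0..}. borel)))
          (sets (vimage_algebra (space M) (\<lambda>\<omega> n. S n \<omega>) (\<Pi>\<^sub>M n\<in>UNIV. count_space UNIV)))"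
    "\<forall>t\<ge>0. \<forall>\<omega>\<in>space M. X t \<omega> = (if S (excursion_index (\<lambda>u. R u \<omega>) t) \<omega> then R t \<omega> else - R t \<omega>)"
    using assms(1) unfolding skew_brownian_motion_def by blast
  obtain B where B: "standard_brownian_motion M B" "\<forall>t\<ge>0. \<forall>\<omega>\<in>space M. R t \<omega> = \<bar>B t \<omega>\<bar>"
    using RS(1) unfolding reflected_brownian_motion_def by blast
  have "signed_excursions M B \<beta> X R S"
    by (intro signed_excursions.intro brownian_motion.intro signed_excursions_axioms.intro)
      (use RS B assms in auto)
  then show ?thesis by (rule that)
qed

theorem theorem8:
  fixes \<beta> :: real
    and M :: "'a measure" and X :: "real \<Rightarrow> 'a \<Rightarrow> real"
    and N :: "'b measure" and Y :: "real \<Rightarrow> 'b \<Rightarrow> real"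
  assumes "0 < \<beta>" and "\<beta> < 1"
    and "skew_brownian_bridge \<beta> M X N Y"
  shows "distributed N lborel (\<lambda>\<omega>. SUP u\<in>{0..1}. Y u \<omega>)
    (\<lambda>z. ennreal (if z > 0
       then 8 * \<beta> * z * (\<Sum>k. (1 - 2 * \<beta>) ^ k * (real (Suc k))\<^sup>2 * exp (- 2 * (real (Suc k))\<^sup>2 * z\<^sup>2))
       else 0))"
proof -
  let ?D = "\<lambda>\<omega>. SUP u\<in>{0..1}. Y u \<omega>"
  define d where "d z = 8 * \<beta> * z * (\<Sum>k. (1 - 2 * \<beta>) ^ k * (real (Suc k))\<^sup>2 * exp (- 2 * (real (Suc k))\<^sup>2 * z\<^sup>2))" for z
  have skew: "skew_brownian_motion \<beta> M X" and Y: "conditioned_to_vanish_at_1 M X N Y"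
    using assms(3) by (auto simp: skew_brownian_bridge_def)
  obtain B R S where "signed_excursions M B \<beta> X R S"
    using skew_brownian_motion_signed_excursions[OF skew assms(1,2)] .
  then interpret signed_excursions M B \<beta> X R S .
  interpret N: prob_space N using Y by (simp add: conditioned_to_vanish_at_1_def)
  have D [measurable]: "?D \<in> borel_measurable N"
    using Y by (intro measurable_SUP_unit) (auto simp: conditioned_to_vanish_at_1_def)
  have deriv: "((\<lambda>z. 1 - bridge_tail \<beta> z) has_real_derivative d z) (at z)" for z
    using has_derivative_bridge_tail[OF \<beta>, of z] by (auto intro!: derivative_eq_intros simp: d_def)
  have cdf: "N.prob {\<omega> \<in> space N. ?D \<omega> \<le> z} = 1 - bridge_tail \<beta> z" if "0 < z" for z
    by (rule bridge_max_cdf[OF Y that])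
  \<comment> \<open>For \<open>\<beta> > 1 / 2\<close> the series alternates and its sign is not
    apparent; nonnegativity is deduced from the monotonicity of the distribution function.\<close>
  have "mono_on {0<..} (\<lambda>z. 1 - bridge_tail \<beta> z)"
    by (rule mono_onI) (auto simp flip: cdf intro!: N.finite_measure_mono)
  then have d_pos: "0 \<le> d z" if "0 < z" for z
    by (rule mono_on_imp_deriv_nonneg[OF _ deriv]) (use that in \<open>simp add: interior_open\<close>)
  \<comment> \<open>The formula vanishes at 0, so that the density can be integrated over the closed
    interval \<open>{0..a}\<close>.\<close>
  have d0: "d 0 = 0" by (simp add: d_def)
  \<comment> \<open>The distribution function at positive \<open>z\<close> tends to
    \<open>1 - bridge_tail \<beta> 0 = 0\<close> as \<open>z\<close> decreases to 0, which leaves no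
    mass at or below 0.\<close>
  have cdf0: "N.prob {\<omega> \<in> space N. ?D \<omega> \<le> a} = 0" if "a \<le> 0" for a
  proof -
    have "N.prob {\<omega> \<in> space N. ?D \<omega> \<le> a} \<le> 1 - bridge_tail \<beta> z" if "0 < z" for z
      unfolding cdf[OF that, symmetric] using \<open>a \<le> 0\<close> that by (intro N.finite_measure_mono) auto
    moreover have "((\<lambda>z. 1 - bridge_tail \<beta> z) \<longlongrightarrow> 1 - bridge_tail \<beta> 0) (at_right 0)"
      using isCont_bridge_tail[OF \<beta>, of 0] unfolding isCont_def
      by (intro tendsto_intros) (auto intro: tendsto_within_subset)
    ultimately have "N.prob {\<omega> \<in> space N. ?D \<omega> \<le> a} \<le> 1 - bridge_tail \<beta> 0"
      by (intro tendsto_lowerbound[where F = "at_right 0"])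
        (auto intro!: eventually_mono[OF eventually_at_right_less[of 0]])
    then show ?thesis using bridge_tail_0[OF \<beta>] by (simp add: measure_le_0_iff)
  qed
  have [measurable]: "d \<in> borel_measurable borel"
    unfolding d_def by measurable
  show ?thesis
    unfolding d_def[symmetric]
  proof (rule distributedI_borel_atMost[where g = "\<lambda>a. if a \<le> 0 then 0 else 1 - bridge_tail \<beta> a"])
    show "AE z in lborel. 0 \<le> (if 0 < z then d z else 0)" using d_pos by auto
    fix a
    show "emeasure N {\<omega> \<in> space N. ?D \<omega> \<le> a} = ennreal (if a \<le> 0 then 0 else 1 - bridge_tail \<beta> a)"
      using cdf0[of a] cdf[of a] by (simp add: N.emeasure_eq_measure)
    show "(\<integral>\<^sup>+ x. ennreal ((if 0 < x then d x else 0) * indicator {..a} x) \<partial>lborel) =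
        ennreal (if a \<le> 0 then 0 else 1 - bridge_tail \<beta> a)"
    proof (cases "a \<le> 0")
      case True
      have "(\<integral>\<^sup>+ x. ennreal ((if 0 < x then d x else 0) * indicator {..a} x) \<partial>lborel) = (\<integral>\<^sup>+ x. 0 \<partial>(lborel :: real measure))"
        by (rule nn_integral_cong) (use True in \<open>auto simp: indicator_def\<close>)
      then show ?thesis using True by simp
    next
      case False
      have "(\<integral>\<^sup>+ x. ennreal ((if 0 < x then d x else 0) * indicator {..a} x) \<partial>lborel) =
          (\<integral>\<^sup>+ x. ennreal (d x) * indicator {0..a} x \<partial>lborel)"
        by (intro nn_integral_cong) (auto simp: indicator_def d0 le_less)
      also have "\<dots> = ennreal ((1 - bridge_tail \<beta> a) - (1 - bridge_tail \<beta> 0))"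
        by (rule nn_integral_FTC_Icc) (use False d_pos d0 deriv in \<open>auto simp: le_less\<close>)
      finally show ?thesis using False bridge_tail_0[OF \<beta>] by simp
    qed
  qed auto
qed

end
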